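(* Assume [H0], [H1], [H2] and [H3] (as listed in the context). Then the value function $v:\mathcal S\to\mathbb R$ of the infinite horizon optimal control problem is a bounded viscosity solution of the Hamilton–Jacobi equation (HJ) in $\mathcal S$.
   Context: **Geometry.** In $\mathbb R^3$ with Euclidean scalar product $x\cdot y$ and norm $|x|$, let $N>1$ and let $e_0,e_1,\dots,e_N$ be distinct unit vectors with $e_i\cdot e_0=0$ for $i=1,\dots,N$. Write $\mathbb R e_0\times\mathbb R e_i$ for the plane spanned by $e_0,e_i$. Let $\mathcal P_i=\{x_0e_0+x_ie_i: x_0\in\mathbb R,\ x_i\ge 0\}$ (closed half-plane), $\Gamma=\mathbb R e_0$, $\mathcal S=\bigcup_{i=1}^N\mathcal P_i$. **Assumptions.** $A$ is a metric space and $\lambda>0$. [H0] For $i=1,\dots,N$, $A_i\subset A$ is non-empty and compact, the $A_i$ are pairwise disjoint, $f_i:\mathcal P_i\times A_i\to\mathbb R e_0\times\mathbb R e_i$ is continuous and bounded, and there is $L_f>0$ with $|f_i(x,a)-f_i(y,a)|\le L_f|x-y|$ for all $i$, $x,y\in\mathcal P_i$, $a\in A_i$. [H1] For $i=1,\dots,N$, $\ell_i:\mathcal P_i\times A_i\to\mathbb R$ is continuous and bounded, and there is a modulus of continuity $\omega_\ell$ with $|\ell_i(x,a)-\ell_i(y,a)|\le\omega_\ell(|x-y|)$ for all $i$, $x,y\in\mathcal P_i$, $a\in A_i$. [H2] For all $i$ and $x\in\mathcal P_i$, the set $\mathrm{FL}_i(x)=\{(f_i(x,a),\ell_i(x,a)):a\in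 A_i\}$ is convex (it is non-empty and closed). [H3] There is $\delta>0$ such that for all $i$ and $x\in\Gamma$, $B(0,\delta)\cap(\mathbb R e_0\times\mathbb R e_i)\subset\{f_i(x,a):a\in A_i\}$. **Control problem.** $M=\{(x,a): x\in\mathcal S,\ a\in A_i\text{ if }x\in\mathcal P_i\setminus\Gamma,\ a\in\bigcup_{i=1}^NA_i\text{ if }x\in\Gamma\}$. On $M$ define $f(x,a)=f_i(x,a)$ and $\ell(x,a)=\ell_i(x,a)$ if $x\in\mathcal P_i\setminus\Gamma$, or if $x\in\Gamma$ and $a\in A_i$. For $x\in\mathcal S$, $\mathcal T_x$ is the set of $(y_x,\alpha)\in L^\infty_{\rm loc}(\mathbb R^+;M)$ such that $y_x:\mathbb R^+\to\mathcal S$ is Lipschitz and $y_x(t)=x+\int_0^tf(y_x(s),\alpha(s))\,ds$ for all $t\ge0$. The value function is $v(x)=\inf_{(y_x,\alpha)\in\mathcal T_x}\int_0^\infty\ell(y_x(t),\alpha(t))e^{-\lambda t}\,dt$. **Viscosity solutions.** $\mathcal R(\mathcal S)$ is the set of continuous $\varphi:\mathcal S\to\mathbb R$ with $\varphi|_{\mathcal P_j}\in C^1(\mathcal P_j)$ (up to the boundary $\Gamma$) for every $j$; $D(\varphi|_{\mathcal P_j})(x)\in\mathbb R e_0\times\mathbb R e_j$ is the gradient (for $x\in\Gamma$, the limit of gradients from $\mathcal P_j\setminus\Gamma$). Let $H_i(x,p)=\max_{a\in A_i}(-p\cdot f_i(x,a)-\ell_i(x,a))$ for $x\in\mathcal P_i$,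 $p\in\mathbb R e_0\times\mathbb R e_i$; for $x\in\Gamma$, $H_i^+(x,p)=\max_{a\in A_i,\ f_i(x,a)\cdot e_i\ge0}(-p\cdot f_i(x,a)-\ell_i(x,a))$ and $H_\Gamma(x,p_1,\dots,p_N)=\max_iH_i^+(x,p_i)$. (HJ) denotes the equation $\lambda u+H_i(x,Du)=0$ in $\mathcal P_i\setminus\Gamma$ ($i=1,\dots,N$), $\lambda u+H_\Gamma(x,D(u|_{\mathcal P_1}),\dots,D(u|_{\mathcal P_N}))=0$ on $\Gamma$, in the following sense. An upper semicontinuous $u:\mathcal S\to\mathbb R$ is a viscosity subsolution if, for every $x\in\mathcal S$ and $\varphi\in\mathcal R(\mathcal S)$ such that $u-\varphi$ has a local maximum (on $\mathcal S$) at $x$: $\lambda u(x)+H_i(x,D(\varphi|_{\mathcal P_i})(x))\le0$ if $x\in\mathcal P_i\setminus\Gamma$, and $\lambda u(x)+H_\Gamma(x,D(\varphi|_{\mathcal P_1})(x),\dots,D(\varphi|_{\mathcal P_N})(x))\le0$ if $x\in\Gamma$. A lower semicontinuous $u$ is a viscosity supersolution if the reverse inequalities ($\ge0$) hold whenever $u-\varphi$ has a local minimum at $x$. A viscosity solution is a continuous function that is both. *)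

theory Defs
  imports "HOL-Analysis.Analysis"
begin

section \<open>Geometry of the junction\<close>

type_synonym pt = "real ^ 3"

text \<open>The unit vectors \<open>e\<^sub>0, e\<^sub>1, \<dots>, e\<^sub>N\<close> are the values \<open>e 0, \<dots>, e N\<close> of a sequence;
  the half-planes are indexed by \<open>{1..N}\<close>.\<close>

definition junction :: "nat \<Rightarrow> (nat \<Rightarrow> pt) \<Rightarrow> bool" where
  "junction N e \<longleftrightarrow> N > 1 \<and> inj_on e {0..N} \<and> (\<forall>i\<in>{0..N}. norm (e i) = 1)
     \<and> (\<forall>i\<in>{1..N}. e i \<bullet> e 0 = 0)"

definition plane :: "(nat \<Rightarrow> pt) \<Rightarrow> nat \<Rightarrow> pt set" where
  "plane e i = span {e 0, e i}"

definition halfplane :: "(nat \<Rightarrow> pt) \<Rightarrow> nat \<Rightarrow> pt set" where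
  "halfplane e i = {x0 *\<^sub>R e 0 + xi *\<^sub>R e i | x0 xi. 0 \<le> xi}"

definition interface :: "(nat \<Rightarrow> pt) \<Rightarrow> pt set" where
  "interface e = span {e 0}"

definition network :: "nat \<Rightarrow> (nat \<Rightarrow> pt) \<Rightarrow> pt set" where
  "network N e = (\<Union>i\<in>{1..N}. halfplane e i)"


section \<open>Standing assumptions\<close>

text \<open>The metric space of controls is the type \<open>'a\<close>; \<open>A i\<close>, \<open>f i\<close> and \<open>l i\<close> are the control set,
  dynamics and running cost on the \<open>i\<close>-th half-plane. Only the restrictions of \<open>f i\<close> and \<open>l i\<close>
  to \<open>halfplane e i \<times> A i\<close> matter.\<close>

definition H0 ::
  "nat \<Rightarrow> (nat \<Rightarrow> pt) \<Rightarrow> (nat \<Rightarrow> 'a::metric_space set) \<Rightarrow> (nat \<Rightarrow> pt \<Rightarrow> 'a \<Rightarrow> pt) \<Rightarrow> bool" where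
  "H0 N e A f \<longleftrightarrow>
     (\<forall>i\<in>{1..N}. A i \<noteq> {} \<and> compact (A i)) \<and>
     (\<forall>i\<in>{1..N}. \<forall>j\<in>{1..N}. i \<noteq> j \<longrightarrow> A i \<inter> A j = {}) \<and>
     (\<forall>i\<in>{1..N}.
        (\<forall>x\<in>halfplane e i. \<forall>a\<in>A i. f i x a \<in> plane e i) \<and>
        continuous_on (halfplane e i \<times> A i) (\<lambda>(x, a). f i x a) \<and>
        bounded ((\<lambda>(x, a). f i x a) ` (halfplane e i \<times> A i))) \<and>
     (\<exists>L>0. \<forall>i\<in>{1..N}. \<forall>x\<in>halfplane e i. \<forall>y\<in>halfplane e i. \<forall>a\<in>A i.
        norm (f i x a - f i y a) \<le> L * norm (x - y))"

definition modulus_of_continuity :: "(real \<Rightarrow> real) \<Rightarrow> bool" where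
  "modulus_of_continuity \<omega> \<longleftrightarrow>
     \<omega> 0 = 0 \<and> mono_on {0..} \<omega> \<and> (\<omega> \<longlongrightarrow> 0) (at_right 0)"

definition H1 ::
  "nat \<Rightarrow> (nat \<Rightarrow> pt) \<Rightarrow> (nat \<Rightarrow> 'a::metric_space set) \<Rightarrow> (nat \<Rightarrow> pt \<Rightarrow> 'a \<Rightarrow> real) \<Rightarrow> bool" where
  "H1 N e A l \<longleftrightarrow>
     (\<forall>i\<in>{1..N}.
        continuous_on (halfplane e i \<times> A i) (\<lambda>(x, a). l i x a) \<and>
        bounded ((\<lambda>(x, a). l i x a) ` (halfplane e i \<times> A i))) \<and>
     (\<exists>\<omega>. modulus_of_continuity \<omega> \<and>
        (\<forall>i\<in>{1..N}. \<forall>x\<in>halfplane e i. \<forall>y\<in>halfplane e i. \<forall>a\<in>A i.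
           \<bar>l i x a - l i y a\<bar> \<le> \<omega> (norm (x - y))))"

definition FL ::
  "(nat \<Rightarrow> 'a set) \<Rightarrow> (nat \<Rightarrow> pt \<Rightarrow> 'a \<Rightarrow> pt) \<Rightarrow> (nat \<Rightarrow> pt \<Rightarrow> 'a \<Rightarrow> real) \<Rightarrow> nat \<Rightarrow> pt \<Rightarrow> (pt \<times> real) set"
  where "FL A f l i x = (\<lambda>a. (f i x a, l i x a)) ` A i"

definition H2 ::
  "nat \<Rightarrow> (nat \<Rightarrow> pt) \<Rightarrow> (nat \<Rightarrow> 'a set) \<Rightarrow> (nat \<Rightarrow> pt \<Rightarrow> 'a \<Rightarrow> pt) \<Rightarrow> (nat \<Rightarrow> pt \<Rightarrow> 'a \<Rightarrow> real) \<Rightarrow> bool"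
  where "H2 N e A f l \<longleftrightarrow> (\<forall>i\<in>{1..N}. \<forall>x\<in>halfplane e i. convex (FL A f l i x))"

definition H3 ::
  "nat \<Rightarrow> (nat \<Rightarrow> pt) \<Rightarrow> (nat \<Rightarrow> 'a set) \<Rightarrow> (nat \<Rightarrow> pt \<Rightarrow> 'a \<Rightarrow> pt) \<Rightarrow> bool" where
  "H3 N e A f \<longleftrightarrow>
     (\<exists>\<delta>>0. \<forall>i\<in>{1..N}. \<forall>x\<in>interface e. ball 0 \<delta> \<inter> plane e i \<subseteq> f i x ` A i)"


section \<open>The control problem\<close>

definition M_set :: "nat \<Rightarrow> (nat \<Rightarrow> pt) \<Rightarrow> (nat \<Rightarrow> 'a set) \<Rightarrow> (pt \<times> 'a) set" where
  "M_set N e A = {(x, a). x \<in> network N e \<and>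
     (\<forall>i\<in>{1..N}. x \<in> halfplane e i - interface e \<longrightarrow> a \<in> A i) \<and>
     (x \<in> interface e \<longrightarrow> a \<in> (\<Union>i\<in>{1..N}. A i))}"

text \<open>On \<open>M_set N e A\<close> the active index is unique, because the sets
  \<open>halfplane e i - interface e\<close> are pairwise disjoint and so are the sets \<open>A i\<close>.\<close>

definition active_index :: "nat \<Rightarrow> (nat \<Rightarrow> pt) \<Rightarrow> (nat \<Rightarrow> 'a set) \<Rightarrow> pt \<Rightarrow> 'a \<Rightarrow> nat" where
  "active_index N e A x a =
     (THE i. i \<in> {1..N} \<and> (x \<in> halfplane e i - interface e \<or> x \<in> interface e \<and> a \<in> A i))"

definition dynamics ::
  "nat \<Rightarrow> (nat \<Rightarrow> pt) \<Rightarrow> (nat \<Rightarrow> 'a set) \<Rightarrow> (nat \<Rightarrow> pt \<Rightarrow> 'a \<Rightarrow> pt) \<Rightarrow> pt \<Rightarrow> 'a \<Rightarrow> pt" where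
  "dynamics N e A f x a = f (active_index N e A x a) x a"

definition running_cost ::
  "nat \<Rightarrow> (nat \<Rightarrow> pt) \<Rightarrow> (nat \<Rightarrow> 'a set) \<Rightarrow> (nat \<Rightarrow> pt \<Rightarrow> 'a \<Rightarrow> real) \<Rightarrow> pt \<Rightarrow> 'a \<Rightarrow> real" where
  "running_cost N e A l x a = l (active_index N e A x a) x a"

text \<open>\<open>L\<^sup>\<infinity>\<^sub>l\<^sub>o\<^sub>c(\<real>\<^sup>+; X)\<close>, as a set of Lebesgue measurable representatives: the constraint to lie in \<open>X\<close>
  is imposed almost everywhere. Values at negative times are irrelevant.\<close>

definition Linf_loc :: "'b::metric_space set \<Rightarrow> (real \<Rightarrow> 'b) set" where
  "Linf_loc X = {g \<in> borel_measurable (lebesgue_on {0..}).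
     (AE t in lebesgue_on {0..}. g t \<in> X) \<and>
     (\<forall>T>0. \<exists>z C. AE t in lebesgue_on {0..T}. dist z (g t) \<le> C)}"

definition trajectories ::
  "nat \<Rightarrow> (nat \<Rightarrow> pt) \<Rightarrow> (nat \<Rightarrow> 'a::metric_space set) \<Rightarrow> (nat \<Rightarrow> pt \<Rightarrow> 'a \<Rightarrow> pt) \<Rightarrow> pt
     \<Rightarrow> ((real \<Rightarrow> pt) \<times> (real \<Rightarrow> 'a)) set" where
  "trajectories N e A f x = {(y, \<alpha>).
     (\<lambda>t. (y t, \<alpha> t)) \<in> Linf_loc (M_set N e A) \<and>
     (\<forall>t\<ge>0. y t \<in> network N e) \<and>
     (\<exists>L. L-lipschitz_on {0..} y) \<and>
     (\<forall>t\<ge>0. y t = x + (LINT s:{0..t}|lebesgue. dynamics N e A f (y s) (\<alpha> s)))}"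

definition cost ::
  "nat \<Rightarrow> (nat \<Rightarrow> pt) \<Rightarrow> (nat \<Rightarrow> 'a set) \<Rightarrow> (nat \<Rightarrow> pt \<Rightarrow> 'a \<Rightarrow> real) \<Rightarrow> real
     \<Rightarrow> (real \<Rightarrow> pt) \<times> (real \<Rightarrow> 'a) \<Rightarrow> real" where
  "cost N e A l lam = (\<lambda>(y, \<alpha>).
     LINT t:{0..}|lebesgue. running_cost N e A l (y t) (\<alpha> t) * exp (- lam * t))"

text \<open>The infimum is taken in the extended reals, so that it is meaningful before one knows that
  there are admissible trajectories and that their costs are bounded below.\<close>

definition value_function ::
  "nat \<Rightarrow> (nat \<Rightarrow> pt) \<Rightarrow> (nat \<Rightarrow> 'a::metric_space set) \<Rightarrow> (nat \<Rightarrow> pt \<Rightarrow> 'a \<Rightarrow> pt)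
     \<Rightarrow> (nat \<Rightarrow> pt \<Rightarrow> 'a \<Rightarrow> real) \<Rightarrow> real \<Rightarrow> pt \<Rightarrow> ereal" where
  "value_function N e A f l lam x =
     (INF tr\<in>trajectories N e A f x. ereal (cost N e A l lam tr))"


section \<open>Test functions\<close>

text \<open>The function on the \<open>j\<close>-th half-plane is differentiated within that half-plane, and its gradient
  is the representing vector in \<open>plane e j\<close>, which makes it unique. On the interface the gradient is
  the limit of the gradients from the open half-plane.\<close>

definition has_plane_gradient :: "(nat \<Rightarrow> pt) \<Rightarrow> nat \<Rightarrow> (pt \<Rightarrow> real) \<Rightarrow> pt \<Rightarrow> pt \<Rightarrow> bool" where
  "has_plane_gradient e j \<phi> x p \<longleftrightarrow>
     p \<in> plane e j \<and> (\<phi> has_derivative (\<lambda>h. p \<bullet> h)) (at x within halfplane e j)"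

definition gradient :: "(nat \<Rightarrow> pt) \<Rightarrow> nat \<Rightarrow> (pt \<Rightarrow> real) \<Rightarrow> pt \<Rightarrow> pt" where
  "gradient e j \<phi> x =
     (if x \<in> interface e
      then Lim (at x within (halfplane e j - interface e)) (\<lambda>z. THE p. has_plane_gradient e j \<phi> z p)
      else (THE p. has_plane_gradient e j \<phi> x p))"

text \<open>If the limit defining \<open>gradient\<close> at an interface point did not exist, \<open>gradient\<close> would be
  discontinuous there, so the last conjunct below includes its existence.\<close>

definition C1_on_halfplane :: "(nat \<Rightarrow> pt) \<Rightarrow> nat \<Rightarrow> (pt \<Rightarrow> real) \<Rightarrow> bool" where
  "C1_on_halfplane e j \<phi> \<longleftrightarrow>
     continuous_on (halfplane e j) \<phi> \<and>
     (\<forall>x\<in>halfplane e j - interface e. \<exists>p. has_plane_gradient e j \<phi> x p) \<and>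
     continuous_on (halfplane e j) (gradient e j \<phi>)"

definition test_functions :: "nat \<Rightarrow> (nat \<Rightarrow> pt) \<Rightarrow> (pt \<Rightarrow> real) set" where
  "test_functions N e = {\<phi>. continuous_on (network N e) \<phi> \<and> (\<forall>j\<in>{1..N}. C1_on_halfplane e j \<phi>)}"


section \<open>Hamiltonians\<close>

text \<open>The suprema below are maxima under the standing assumptions: the functions are continuous in \<open>a\<close>
  and the sets over which they are taken are compact and non-empty.\<close>

definition Ham ::
  "(nat \<Rightarrow> 'a set) \<Rightarrow> (nat \<Rightarrow> pt \<Rightarrow> 'a \<Rightarrow> pt) \<Rightarrow> (nat \<Rightarrow> pt \<Rightarrow> 'a \<Rightarrow> real) \<Rightarrow> nat \<Rightarrow> pt \<Rightarrow> pt \<Rightarrow> real"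
  where "Ham A f l i x p = (SUP a\<in>A i. - (p \<bullet> f i x a) - l i x a)"

definition Ham_plus ::
  "(nat \<Rightarrow> pt) \<Rightarrow> (nat \<Rightarrow> 'a set) \<Rightarrow> (nat \<Rightarrow> pt \<Rightarrow> 'a \<Rightarrow> pt) \<Rightarrow> (nat \<Rightarrow> pt \<Rightarrow> 'a \<Rightarrow> real)
     \<Rightarrow> nat \<Rightarrow> pt \<Rightarrow> pt \<Rightarrow> real" where
  "Ham_plus e A f l i x p =
     (SUP a\<in>{a \<in> A i. f i x a \<bullet> e i \<ge> 0}. - (p \<bullet> f i x a) - l i x a)"

definition Ham_interface ::
  "nat \<Rightarrow> (nat \<Rightarrow> pt) \<Rightarrow> (nat \<Rightarrow> 'a set) \<Rightarrow> (nat \<Rightarrow> pt \<Rightarrow> 'a \<Rightarrow> pt) \<Rightarrow> (nat \<Rightarrow> pt \<Rightarrow> 'a \<Rightarrow> real)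
     \<Rightarrow> pt \<Rightarrow> (nat \<Rightarrow> pt) \<Rightarrow> real" where
  "Ham_interface N e A f l x p = Max ((\<lambda>i. Ham_plus e A f l i x (p i)) ` {1..N})"


section \<open>Viscosity solutions\<close>

definition usc_on :: "'b::topological_space set \<Rightarrow> ('b \<Rightarrow> real) \<Rightarrow> bool" where
  "usc_on S u \<longleftrightarrow> (\<forall>x\<in>S. \<forall>c>u x. eventually (\<lambda>z. u z < c) (at x within S))"

definition lsc_on :: "'b::topological_space set \<Rightarrow> ('b \<Rightarrow> real) \<Rightarrow> bool" where
  "lsc_on S u \<longleftrightarrow> (\<forall>x\<in>S. \<forall>c<u x. eventually (\<lambda>z. c < u z) (at x within S))"

definition local_max_on :: "'b::topological_space set \<Rightarrow> ('b \<Rightarrow> real) \<Rightarrow> 'b \<Rightarrow> bool" where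
  "local_max_on S g x \<longleftrightarrow> eventually (\<lambda>z. g z \<le> g x) (at x within S)"

definition local_min_on :: "'b::topological_space set \<Rightarrow> ('b \<Rightarrow> real) \<Rightarrow> 'b \<Rightarrow> bool" where
  "local_min_on S g x \<longleftrightarrow> eventually (\<lambda>z. g x \<le> g z) (at x within S)"

definition viscosity_subsolution ::
  "nat \<Rightarrow> (nat \<Rightarrow> pt) \<Rightarrow> (nat \<Rightarrow> 'a set) \<Rightarrow> (nat \<Rightarrow> pt \<Rightarrow> 'a \<Rightarrow> pt) \<Rightarrow> (nat \<Rightarrow> pt \<Rightarrow> 'a \<Rightarrow> real)
     \<Rightarrow> real \<Rightarrow> (pt \<Rightarrow> real) \<Rightarrow> bool" where
  "viscosity_subsolution N e A f l lam u \<longleftrightarrow> usc_on (network N e) u \<and>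
     (\<forall>x\<in>network N e. \<forall>\<phi>\<in>test_functions N e.
        local_max_on (network N e) (\<lambda>z. u z - \<phi> z) x \<longrightarrow>
          (\<forall>i\<in>{1..N}. x \<in> halfplane e i - interface e \<longrightarrow>
             lam * u x + Ham A f l i x (gradient e i \<phi> x) \<le> 0) \<and>
          (x \<in> interface e \<longrightarrow>
             lam * u x + Ham_interface N e A f l x (\<lambda>i. gradient e i \<phi> x) \<le> 0))"

definition viscosity_supersolution ::
  "nat \<Rightarrow> (nat \<Rightarrow> pt) \<Rightarrow> (nat \<Rightarrow> 'a set) \<Rightarrow> (nat \<Rightarrow> pt \<Rightarrow> 'a \<Rightarrow> pt) \<Rightarrow> (nat \<Rightarrow> pt \<Rightarrow> 'a \<Rightarrow> real)
     \<Rightarrow> real \<Rightarrow> (pt \<Rightarrow> real) \<Rightarrow> bool" where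
  "viscosity_supersolution N e A f l lam u \<longleftrightarrow> lsc_on (network N e) u \<and>
     (\<forall>x\<in>network N e. \<forall>\<phi>\<in>test_functions N e.
        local_min_on (network N e) (\<lambda>z. u z - \<phi> z) x \<longrightarrow>
          (\<forall>i\<in>{1..N}. x \<in> halfplane e i - interface e \<longrightarrow>
             lam * u x + Ham A f l i x (gradient e i \<phi> x) \<ge> 0) \<and>
          (x \<in> interface e \<longrightarrow>
             lam * u x + Ham_interface N e A f l x (\<lambda>i. gradient e i \<phi> x) \<ge> 0))"

definition viscosity_solution ::
  "nat \<Rightarrow> (nat \<Rightarrow> pt) \<Rightarrow> (nat \<Rightarrow> 'a set) \<Rightarrow> (nat \<Rightarrow> pt \<Rightarrow> 'a \<Rightarrow> pt) \<Rightarrow> (nat \<Rightarrow> pt \<Rightarrow> 'a \<Rightarrow> real)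
     \<Rightarrow> real \<Rightarrow> (pt \<Rightarrow> real) \<Rightarrow> bool" where
  "viscosity_solution N e A f l lam u \<longleftrightarrow> continuous_on (network N e) u \<and>
     viscosity_subsolution N e A f l lam u \<and> viscosity_supersolution N e A f l lam u"

end

theory Submission
  imports Defs
begin

text \<open>Both viscosity inequalities are extracted from the dynamic programming principle; the work is
  in the regularity of the value function \<open>v\<close> and in the behaviour of trajectories at \<open>\<Gamma>\<close>.

  By [H3] and convexity, near \<open>\<Gamma>\<close> every small velocity is available, so that a point of
  \<open>\<Gamma>\<close> and a nearby point of a half-plane can be joined in both directions along the straight
  segment, in a time comparable with their distance (the control is a measurable selection).
  This bounds the oscillation of \<open>v\<close> near \<open>\<Gamma>\<close>. Away from \<open>\<Gamma>\<close> one
  follows the control of a nearly optimal trajectory until either trajectory hits \<open>\<Gamma>\<close>;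
  hence \<open>v\<close> is uniformly continuous on each half-plane.

  Subsolution: follow a constant control. On \<open>\<Gamma>\<close> a control that is only tangential is
  approximated by inward pointing ones, by convexity of \<open>FL\<close>.

  Supersolution on \<open>\<Gamma>\<close>: by convex duality there is \<open>\<mu>\<^sub>i \<ge> 0\<close> such that
  \<open>H\<^sub>i(x, p\<^sub>i - \<mu>\<^sub>i e\<^sub>i) \<le> H\<^sub>i\<^sup>+(x, p\<^sub>i)\<close>. Since the normal velocity vanishes at almost every
  time spent on \<open>\<Gamma>\<close>, and each complete excursion into a half-plane has zero normal
  displacement, the multipliers only contribute the non-negative final distance to \<open>\<Gamma>\<close>.\<close>

text \<open>Two obstacles shape the proof. First, a half-plane is not invariant under its own
  dynamics, so a control with values in \<open>A i\<close> cannot simply be run for ever. The field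
  is extended to the whole plane through the nearest-point projection, and the solution is used only
  while it stays in \<open>P i\<close>; competitors for the infimum are arcs up to a stopping time,
  continued by another trajectory. Second, a trajectory may return to \<Gamma> infinitely often and
  change branch each time, so there is no finite list of excursions to sum over. Moreover,
  velocities pointing towards \<Gamma> are used inside \<open>P i\<close> although
  \<open>H\<^sub>i\<^sup>+\<close> ignores them. The multiplier pays for them, by a different amount
  on each branch. The accounts balance because the gradients of a test function agree along
  \<open>e 0\<close>: what is left is the rate of change of a function vanishing on \<Gamma>.
  Convexity of \<open>FL\<close> enters in three places: velocities near \<Gamma>, tangential
  controls, multipliers. Since the space of controls need not be separable, joint measurability of
  state and control rests on compactness of the sets \<open>A i\<close>.\<close>

section \<open>Integral equations\<close>

text \<open>Extending \<open>F\<close> by zero off the closed set \<open>S\<close> gives a Borel map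
  on the whole space. Composing with it changes the function only on a null set, which the
  completeness of Lebesgue measure absorbs.\<close>

lemma measurable_comp_continuous_AE:
  fixes g :: "'a::euclidean_space \<Rightarrow> 'b::metric_space" and F :: "'b \<Rightarrow> 'c::euclidean_space"
  assumes F: "continuous_on S F" and S: "closed S"
    and g: "g \<in> borel_measurable (lebesgue_on X)" and X: "X \<in> sets lebesgue"
    and ae: "AE t in lebesgue_on X. g t \<in> S"
  shows "(\<lambda>t. F (g t)) \<in> borel_measurable (lebesgue_on X)"
proof -
  have "(\<lambda>b. indicator S b *\<^sub>R F b) \<in> borel_measurable borel"
    by (intro borel_measurable_continuous_on_indicator F) (use S in auto)
  from measurable_compose[OF g this]
  have "(\<lambda>t. indicator S (g t) *\<^sub>R F (g t)) \<in> borel_measurable (lebesgue_on X)" .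
  then have 1: "(\<lambda>t. if t \<in> X then indicator S (g t) *\<^sub>R F (g t) else 0) \<in> borel_measurable lebesgue"
    by (simp add: borel_measurable_if X)
  have "AE t in lebesgue. t \<in> X \<longrightarrow> g t \<in> S"
    using ae X by (simp add: AE_restrict_space_iff)
  then have "AE t in lebesgue. (if t \<in> X then indicator S (g t) *\<^sub>R F (g t) else 0)
      = (if t \<in> X then F (g t) else 0)"
    by eventually_elim auto
  from borel_measurable_AE[OF 1 this] show ?thesis
    by (simp add: borel_measurable_if X)
qed

lemma bounded_measurable_absolutely_integrable:
  fixes h :: "real \<Rightarrow> 'b::euclidean_space"
  assumes h: "h \<in> borel_measurable (lebesgue_on {a..b})"
    and B: "AE s in lebesgue_on {a..b}. norm (h s) \<le> B"
  shows "h absolutely_integrable_on {a..b}"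
proof -
  interpret finite_measure "lebesgue_on {a..b}"
    by (simp add: finite_measure_lebesgue_on)
  have "integrable (lebesgue_on {a..b}) h"
    by (rule integrable_const_bound[OF B h])
  then show ?thesis
    by (simp add: integrable_restrict_space set_integrable_def)
qed

lemma AE_norm_integral_le:
  fixes h :: "real \<Rightarrow> 'b::euclidean_space"
  assumes h: "h \<in> borel_measurable (lebesgue_on {a..b})" and ab: "a \<le> b"
    and B: "AE s in lebesgue_on {a..b}. norm (h s) \<le> B"
  shows "norm (integral {a..b} h) \<le> B * (b - a)"
proof -
  have ai: "h absolutely_integrable_on {a..b}"
    by (rule bounded_measurable_absolutely_integrable[OF h B])
  have "norm (integral {a..b} h) = norm (LINT s:{a..b}|lebesgue. h s)"
    by (simp add: set_lebesgue_integral_eq_integral(2)[OF ai])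
  also have "\<dots> \<le> (LINT s:{a..b}|lebesgue. norm (h s))"
    by (rule set_integral_norm_bound[OF ai])
  also have "\<dots> \<le> (LINT s:{a..b}|lebesgue. B)"
  proof (rule set_integral_mono_AE)
    show "set_integrable lebesgue {a..b} (\<lambda>s. norm (h s))"
      using ai by (rule set_integrable_norm)
    show "set_integrable lebesgue {a..b} (\<lambda>s. B)"
      by (simp add: absolutely_integrable_on_def integrable_const_ivl)
    show "AE s \<in> {a..b} in lebesgue. norm (h s) \<le> B"
      using B by (simp add: AE_restrict_space_iff)
  qed
  also have "\<dots> = B * (b - a)"
    using ab by (simp add: set_integral_const)
  finally show ?thesis .
qed

text \<open>At a maximum point \<open>t0\<close> of \<open>exp (- 2 L s) * u s\<close> the integral
  term is at most half of \<open>u t0\<close>, because of the weight \<open>2 L\<close>, and can be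
  absorbed into the left-hand side. The constants are not sharp; what counts is a bound proportional
  to \<open>c\<close> on bounded time intervals.\<close>

lemma gronwall_weighted:
  fixes u :: "real \<Rightarrow> real"
  assumes cont: "continuous_on {0..T} u" and L: "L > 0"
    and nn: "\<And>t. t \<in> {0..T} \<Longrightarrow> 0 \<le> u t"
    and le: "\<And>t. t \<in> {0..T} \<Longrightarrow> u t \<le> c + L * integral {0..t} u"
    and t: "t \<in> {0..T}"
  shows "u t \<le> 2 * c * exp (2 * L * t)"
proof -
  define w where "w = (\<lambda>s. exp (- (2 * L * s)) * u s)"
  have "continuous_on {0..T} w" unfolding w_def by (intro continuous_intros cont)
  then obtain t0 where t0: "t0 \<in> {0..T}" and mx: "\<And>s. s \<in> {0..T} \<Longrightarrow> w s \<le> w t0"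
    using continuous_attains_sup[of "{0..T}" w] t by fastforce
  define m where "m = w t0"
  have u_le: "u s \<le> m * exp (2 * L * s)" if "s \<in> {0..T}" for s
    using mx[OF that] by (simp add: w_def m_def exp_minus field_simps)
  have I: "((\<lambda>s. m * exp (2 * L * s)) has_integral
      m * exp (2 * L * t0) / (2 * L) - m * exp (2 * L * 0) / (2 * L)) {0..t0}"
    using t0 L
    by (intro fundamental_theorem_of_calculus)
      (auto intro!: derivative_eq_intros simp flip: has_real_derivative_iff_has_vector_derivative)
  have ui: "u integrable_on {0..t0}"
    by (rule integrable_continuous_real[OF continuous_on_subset[OF cont]]) (use t0 in auto)
  have "integral {0..t0} u \<le> m * exp (2 * L * t0) / (2 * L) - m * exp (2 * L * 0) / (2 * L)"
    using integral_le[OF ui has_integral_integrable[OF I]] u_le t0 integral_unique[OF I] by auto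
  then have "L * integral {0..t0} u \<le> L * (m * exp (2 * L * t0) / (2 * L) - m * exp (2 * L * 0) / (2 * L))"
    using L by (simp only: mult_le_cancel_left_pos)
  also have "\<dots> = (m * exp (2 * L * t0) - m) / 2" using L by (simp add: field_simps)
  finally have i: "L * integral {0..t0} u \<le> (m * exp (2 * L * t0) - m) / 2" .
  define q where "q = m * exp (2 * L * t0)"
  have "u t0 \<le> c + (q - m) / 2"
    using le[OF t0] i unfolding q_def by linarith
  moreover have "u t0 = q" by (simp add: m_def w_def exp_minus q_def)
  moreover have "m \<ge> 0" using nn[OF t0] by (simp add: m_def w_def)
  moreover have "c \<ge> 0" using le[of 0] nn[of 0] t by auto
  moreover have "m \<le> q" unfolding q_def using \<open>m \<ge> 0\<close> t0 L
    by (simp add: mult_le_cancel_left1)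
  ultimately have "m \<le> 2 * c" by (simp add: field_simps)
  then show ?thesis using u_le[OF t] order_trans[OF _ mult_right_mono[of m "2*c" "exp (2*L*t)"]]
    by (simp only: exp_ge_zero)
qed

lemma caratheodory_ode_exists:
  fixes F :: "real \<Rightarrow> 'b::euclidean_space \<Rightarrow> 'b"
  assumes L: "L > 0" and lip: "\<And>t x y. t \<ge> 0 \<Longrightarrow> norm (F t x - F t y) \<le> L * norm (x - y)"
    and bd: "\<And>t x. t \<ge> 0 \<Longrightarrow> norm (F t x) \<le> B"
    and meas: "\<And>y. continuous_on UNIV y \<Longrightarrow> (\<lambda>t. F t (y t)) \<in> borel_measurable (lebesgue_on {0..})"
  obtains y where "continuous_on UNIV y" "\<And>t. t \<ge> 0 \<Longrightarrow> y t = x + integral {0..t} (\<lambda>s. F s (y s))"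
proof -
  \<comment> \<open>The unknown is \<open>z t = exp (- 2 L t) (y t - x)\<close>; in this weighted norm the integral
    operator is a contraction on the whole half-line.\<close>
  define W where "W = (\<lambda>z s. x + exp (2 * L * s) *\<^sub>R (z s :: 'b))"
  \<comment> \<open>With \<open>max t 0\<close> in place of \<open>t\<close> the image is zero at
    negative times, so that the operator acts on bounded continuous functions on the whole real
    line, a complete metric space.\<close>
  define P where "P = (\<lambda>z t. exp (- (2 * L * max t 0)) *\<^sub>R integral {0..max t 0} (\<lambda>s. F s (W z s)))"
  have B0: "B \<ge> 0" using order_trans[OF norm_ge_zero bd[of 0 0]] by simp
  have contW: "continuous_on UNIV (W z)" if "continuous_on UNIV z" for z
    unfolding W_def by (intro continuous_intros that)
  have m1: "(\<lambda>s. F s (W z s)) \<in> borel_measurable (lebesgue_on {a..b})"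
    if "continuous_on UNIV z" "0 \<le> a" for z a b
    by (rule measurable_restrict_mono[OF meas[OF contW[OF that(1)]]]) (use that(2) in auto)
  have bd1: "AE s in lebesgue_on {a..b}. norm (F s (W z s)) \<le> B" if "0 \<le> a" for a b z
    by (rule AE_I2) (use that bd in auto)
  have int1: "(\<lambda>s. F s (W z s)) integrable_on {a..b}" if "continuous_on UNIV z" "0 \<le> a" for z a b
    using bounded_measurable_absolutely_integrable[OF m1[OF that] bd1[OF that(2)]]
    by (rule set_lebesgue_integral_eq_integral)
  have nb: "norm (integral {a..b} (\<lambda>s. F s (W z s))) \<le> B * (b - a)"
    if "continuous_on UNIV z" "0 \<le> a" "a \<le> b" for z a b
    by (rule AE_norm_integral_le[OF m1[OF that(1,2)] that(3) bd1[OF that(2)]])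
  have contP: "continuous_on UNIV (P z)" if z: "continuous_on UNIV z" for z
  proof -
    have "continuous_on UNIV (\<lambda>t. integral {0..max t 0} (\<lambda>s. F s (W z s)))"
    proof -
      have *: "norm (integral {0..b} (\<lambda>s. F s (W z s)) - integral {0..a} (\<lambda>s. F s (W z s))) \<le> B * (b - a)"
        if "0 \<le> a" "a \<le> b" for a b
      proof -
        have "integral {0..a} (\<lambda>s. F s (W z s)) + integral {a..b} (\<lambda>s. F s (W z s))
            = integral {0..b} (\<lambda>s. F s (W z s))"
          by (rule Henstock_Kurzweil_Integration.integral_combine) (use that int1[OF z] in auto)
        then have "integral {0..b} (\<lambda>s. F s (W z s)) - integral {0..a} (\<lambda>s. F s (W z s))
            = integral {a..b} (\<lambda>s. F s (W z s))" by (metis add_diff_cancel_left')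
        then show ?thesis using nb[OF z that] by simp
      qed
      have "B-lipschitz_on UNIV (\<lambda>t. integral {0..max t 0} (\<lambda>s. F s (W z s)))"
      proof (rule lipschitz_onI)
        fix s t :: real
        have "dist (integral {0..max s 0} (\<lambda>s. F s (W z s))) (integral {0..max t 0} (\<lambda>s. F s (W z s)))
            \<le> B * \<bar>max s 0 - max t 0\<bar>"
          using *[of "max s 0" "max t 0"] *[of "max t 0" "max s 0"]
          by (cases "s \<le> t") (auto simp: dist_norm norm_minus_commute abs_if max_def split: if_splits)
        also have "\<dots> \<le> B * dist s t" using B0
          by (intro mult_left_mono) (auto simp: dist_real_def max_def)
        finally show "dist (integral {0..max s 0} (\<lambda>s. F s (W z s))) (integral {0..max t 0} (\<lambda>s. F s (W z s)))
            \<le> B * dist s t" .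
      qed (use B0 in auto)
      then show ?thesis by (rule lipschitz_on_continuous_on)
    qed
    then show ?thesis unfolding P_def by (intro continuous_intros) auto
  qed
  \<comment> \<open>The integral grows at most linearly, and \<tau> is at most
    \<open>exp (2 * L * \<tau>) / (2 * L)\<close>; the weight therefore keeps the image bounded for
    all times.\<close>
  have bddP: "norm (P z t) \<le> B / (2 * L)" if z: "continuous_on UNIV z" for z t
  proof -
    define \<tau> where "\<tau> = max t 0"
    have "norm (P z t) = exp (- (2 * L * \<tau>)) * norm (integral {0..\<tau>} (\<lambda>s. F s (W z s)))"
      by (simp add: P_def \<tau>_def)
    also have "\<dots> \<le> exp (- (2 * L * \<tau>)) * (B * \<tau>)"
      using nb[OF z, of 0 \<tau>] by (intro mult_left_mono) (auto simp: \<tau>_def)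
    also have "\<dots> \<le> exp (- (2 * L * \<tau>)) * (B * (exp (2 * L * \<tau>) / (2 * L)))"
    proof (intro mult_left_mono B0)
      have "2 * L * \<tau> \<le> exp (2 * L * \<tau>)" using exp_ge_add_one_self[of "2 * L * \<tau>"] by linarith
      then show "\<tau> \<le> exp (2 * L * \<tau>) / (2 * L)" using L by (simp add: field_simps)
    qed auto
    also have "\<dots> = B / (2 * L)" by (simp add: exp_minus field_simps)
    finally show ?thesis .
  qed
  have Pb: "P z \<in> bcontfun" if "continuous_on UNIV z" for z
    unfolding bcontfun_def using contP[OF that] bddP[OF that] by (auto simp: bounded_iff)
  define \<Psi> where "\<Psi> = (\<lambda>z::real \<Rightarrow>\<^sub>C 'b. Bcontfun (P (apply_bcontfun z)))"
  have app: "apply_bcontfun (\<Psi> z) = P (apply_bcontfun z)" for z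
    unfolding \<Psi>_def by (rule Bcontfun_inverse[OF Pb]) auto
  \<comment> \<open>Integrating \<open>L * exp (2 * L * s)\<close> up to \<tau> gives at most
    \<open>exp (2 * L * \<tau>) / 2\<close>, and the outer weight cancels the exponential: this is
    the factor 1/2.\<close>
  have contr: "dist (\<Psi> z1) (\<Psi> z2) \<le> 1/2 * dist z1 z2" for z1 z2
  proof (rule dist_bound)
    fix t :: real
    define \<tau> where "\<tau> = max t 0"
    define D where "D = dist z1 z2"
    have \<tau>0: "0 \<le> \<tau>" by (simp add: \<tau>_def)
    have c: "continuous_on UNIV (apply_bcontfun z)" for z :: "real \<Rightarrow>\<^sub>C 'b" by auto
    have I: "((\<lambda>s. L * D * exp (2 * L * s)) has_integral
        L * D * exp (2 * L * \<tau>) / (2 * L) - L * D * exp (2 * L * 0) / (2 * L)) {0..\<tau>}"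
      using \<tau>0 L
      by (intro fundamental_theorem_of_calculus)
        (auto intro!: derivative_eq_intros simp flip: has_real_derivative_iff_has_vector_derivative)
    have "norm (integral {0..\<tau>} (\<lambda>s. F s (W z1 s) - F s (W z2 s)))
        \<le> L * D * exp (2 * L * \<tau>) / (2 * L) - L * D * exp (2 * L * 0) / (2 * L)"
      unfolding integral_unique[OF I, symmetric]
    proof (rule integral_norm_bound_integral)
      show "(\<lambda>s. F s (W z1 s) - F s (W z2 s)) integrable_on {0..\<tau>}"
        by (intro integrable_diff int1 c) auto
      show "(\<lambda>s. L * D * exp (2 * L * s)) integrable_on {0..\<tau>}" using I by blast
      fix s assume s: "s \<in> {0..\<tau>}"
      have "norm (F s (W z1 s) - F s (W z2 s)) \<le> L * norm (W z1 s - W z2 s)"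
        using lip s by auto
      also have "norm (W z1 s - W z2 s) = exp (2 * L * s) * dist (z1 s) (z2 s)"
        by (simp add: W_def dist_norm scaleR_diff_right[symmetric])
      also have "L * \<dots> \<le> L * (exp (2 * L * s) * D)"
        using L by (intro mult_left_mono) (auto simp: D_def dist_bounded)
      finally show "norm (F s (W z1 s) - F s (W z2 s)) \<le> L * D * exp (2 * L * s)"
        by (simp add: mult_ac)
    qed
    also have "\<dots> \<le> D / 2 * exp (2 * L * \<tau>)" using L by (simp add: D_def field_simps)
    finally have le: "norm (integral {0..\<tau>} (\<lambda>s. F s (W z1 s) - F s (W z2 s))) \<le> D / 2 * exp (2 * L * \<tau>)" .
    have "dist (\<Psi> z1 t) (\<Psi> z2 t) = exp (- (2 * L * \<tau>)) * norm (integral {0..\<tau>} (\<lambda>s. F s (W z1 s) - F s (W z2 s)))"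
      by (subst Henstock_Kurzweil_Integration.integral_diff)
        (auto intro!: int1 simp: app P_def \<tau>_def dist_norm scaleR_diff_right[symmetric])
    also have "\<dots> \<le> exp (- (2 * L * \<tau>)) * (D / 2 * exp (2 * L * \<tau>))"
      by (intro mult_left_mono le) auto
    also have "\<dots> = 1/2 * D" by (simp add: exp_minus)
    finally show "dist (\<Psi> z1 t) (\<Psi> z2 t) \<le> 1/2 * dist z1 z2" by (simp add: D_def)
  qed
  obtain z where z: "\<Psi> z = z"
    using banach_fix_type[of "1/2" \<Psi>] contr by auto
  define y where "y = W z"
  have "continuous_on UNIV y" unfolding y_def by (rule contW) auto
  moreover have "y t = x + integral {0..t} (\<lambda>s. F s (y s))" if "t \<ge> 0" for t
  proof -
    have "z t = P z t" using app[of z] z by simp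
    then have "exp (2 * L * t) *\<^sub>R z t = integral {0..t} (\<lambda>s. F s (W z s))"
      using that by (simp add: P_def exp_minus max_absorb1)
    then show ?thesis by (simp add: y_def W_def)
  qed
  ultimately show thesis by (rule that)
qed

section \<open>Measurable selections\<close>

lemma compact_dense_sequence:
  fixes K :: "'a::metric_space set"
  assumes K: "compact K" "K \<noteq> {}"
  obtains c :: "nat \<Rightarrow> 'a" where "range c \<subseteq> K" "\<And>k e. k \<in> K \<Longrightarrow> e > 0 \<Longrightarrow> \<exists>j. dist (c j) k < e"
proof -
  have "\<exists>F. finite F \<and> F \<subseteq> K \<and> K \<subseteq> (\<Union>x\<in>F. ball x (1 / real (Suc n)))" for n
    using compactE_image[OF K(1), of K "\<lambda>x. ball x (1 / real (Suc n))"] by (metis (no_types, lifting)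
      UN_iff centre_in_ball of_nat_0_less_iff open_ball subsetI zero_less_Suc zero_less_divide_1_iff)
  then obtain F where F: "\<And>n. finite (F n)" "\<And>n. F n \<subseteq> K" "\<And>n. K \<subseteq> (\<Union>x\<in>F n. ball x (1 / real (Suc n)))"
    by metis
  define D where "D = (\<Union>n. F n)"
  have D: "countable D" "D \<subseteq> K" unfolding D_def using F by (auto intro: countable_finite)
  have "D \<noteq> {}" using F(3)[of 0] K(2) unfolding D_def by blast
  have r: "range (from_nat_into D) = D" by (rule range_from_nat_into[OF \<open>D \<noteq> {}\<close> D(1)])
  show thesis
  proof
    show "range (from_nat_into D) \<subseteq> K" using r D by auto
    fix k and e :: real assume k: "k \<in> K" and e: "e > 0"
    obtain n where n: "1 / real (Suc n) < e" using nat_approx_posE[OF e] by metis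
    obtain x where x: "x \<in> F n" "dist x k < 1 / real (Suc n)" using F(3)[of n] k by auto
    then have "x \<in> D" unfolding D_def by blast
    then have "x \<in> range (from_nat_into D)" by (simp only: r)
    then show "\<exists>j. dist (from_nat_into D j) k < e" using x n by (metis (no_types) order_less_trans rangeE)
  qed
qed

text \<open>The product of two Borel maps need not be Borel when a factor is not second countable;
  a relatively compact range is a sufficient substitute.\<close>

lemma borel_measurable_Pair_compact:
  fixes y :: "'s \<Rightarrow> 'b::{second_countable_topology, metric_space}" and \<alpha> :: "'s \<Rightarrow> 'a::metric_space"
  assumes y: "y \<in> borel_measurable M" and \<alpha>: "\<alpha> \<in> borel_measurable M"
    and K: "compact K" and r: "\<And>s. s \<in> space M \<Longrightarrow> \<alpha> s \<in> K"
  shows "(\<lambda>s. (y s, \<alpha> s)) \<in> borel_measurable M"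
proof (cases "K = {}")
  case True
  then have "space M = {}" using r by auto
  then show ?thesis by (intro measurableI) simp_all
next
  case False
  obtain c where c: "range c \<subseteq> K" "\<And>k e. k \<in> K \<Longrightarrow> e > 0 \<Longrightarrow> \<exists>j::nat. dist (c j) k < e"
    using compact_dense_sequence[OF K False] by metis
  \<comment> \<open>The functions \<open>c (J n s)\<close> take countably many values and converge
    to \<open>\<alpha> s\<close>. Pairing \<open>y\<close> with a constant is Borel, and countably
    many such pieces can be glued measurably.\<close>
  define J where "J = (\<lambda>n s. LEAST j. dist (c j) (\<alpha> s) < 1 / real (Suc n))"
  have Jm [measurable]: "J n \<in> measurable M (count_space UNIV)" for n
  proof -
    have [measurable]: "Measurable.pred M (\<lambda>s. dist (c j) (\<alpha> s) < 1 / real (Suc n))" for j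
    proof -
      have "(\<lambda>s. dist (c j) (\<alpha> s)) \<in> borel_measurable M"
        by (rule borel_measurable_continuous_on[OF _ \<alpha>]) (intro continuous_intros)
      then show ?thesis by measurable
    qed
    show ?thesis unfolding J_def by measurable
  qed
  show ?thesis
  proof (rule borel_measurable_LIMSEQ_metric)
    fix n
    show "(\<lambda>s. (y s, c (J n s))) \<in> borel_measurable M"
    proof (rule measurable_compose_countable[OF _ Jm])
      fix j show "(\<lambda>s. (y s, c j)) \<in> borel_measurable M"
        by (rule borel_measurable_continuous_on[OF _ y]) (intro continuous_intros)
    qed
  next
    fix s assume s: "s \<in> space M"
    have "dist (c (J n s)) (\<alpha> s) < 1 / real (Suc n)" for n
      unfolding J_def by (rule LeastI_ex) (use c(2)[OF r[OF s]] in auto)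
    then have "(\<lambda>n. dist (c (J n s)) (\<alpha> s)) \<longlonglongrightarrow> 0"
      by (intro real_tendsto_sandwich[OF _ _ tendsto_const LIMSEQ_Suc[OF lim_1_over_n]] always_eventually)
        (auto intro: less_imp_le)
    then have "(\<lambda>n. c (J n s)) \<longlonglongrightarrow> \<alpha> s" using tendsto_dist_iff by blast
    then show "(\<lambda>n. (y s, c (J n s))) \<longlonglongrightarrow> (y s, \<alpha> s)" by (intro tendsto_intros)
  qed
qed

text \<open>Kuratowski--Ryll-Nardzewski: successive approximations by functions with countably many
  values, the \<open>n\<close>-th one being within \<open>2\<^sup>-\<^sup>n\<close> of the section of \<open>G\<close>.\<close>

lemma measurable_selection:
  fixes G :: "('b::metric_space \<times> 'a::metric_space) set"
  assumes G: "compact G" "G \<noteq> {}"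
  obtains \<alpha> where "\<alpha> \<in> borel_measurable borel" "\<And>s. s \<in> fst ` G \<Longrightarrow> (s, \<alpha> s) \<in> G" "\<And>s. \<alpha> s \<in> snd ` G"
proof -
  define K where "K = snd ` G"
  have K: "compact K" "K \<noteq> {}" unfolding K_def using G
    by (auto intro!: compact_continuous_image continuous_intros)
  obtain c where c: "range c \<subseteq> K" "\<And>k e. k \<in> K \<Longrightarrow> e > 0 \<Longrightarrow> \<exists>j::nat. dist (c j) k < e"
    using compact_dense_sequence[OF K] by metis
  define r where "r = (\<lambda>n. (1/2::real) ^ n)"
  \<comment> \<open>Times at which the section of \<open>G\<close> comes within \<open>r n\<close>
    of \<open>c j\<close>. Being projections of compact sets these are closed, which is the source
    of all measurability below.\<close>
  define W where "W = (\<lambda>n j. fst ` (G \<inter> UNIV \<times> cball (c j) (r n)))"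
  have W_mem: "s \<in> W n j \<longleftrightarrow> (\<exists>a. (s, a) \<in> G \<and> dist (c j) a \<le> r n)" for s n j
    unfolding W_def by force
  have W: "W n j \<in> sets borel" for n j
  proof -
    have "closed (UNIV \<times> cball (c j) (r n) :: ('b \<times> 'a) set)" by (intro closed_Times) auto
    then have "compact (G \<inter> UNIV \<times> cball (c j) (r n))" using G(1) by (rule compact_Int_closed[rotated])
    then have "compact (W n j)" unfolding W_def
      by (intro compact_continuous_image continuous_intros) auto
    then show ?thesis by (intro borel_closed compact_imp_closed)
  qed
  \<comment> \<open>Least indices make the choice measurable. The distance condition ties each
    approximation to the previous one, so that they form a Cauchy sequence for every
    \<open>s\<close>.\<close>
  define J where "J = rec_nat (\<lambda>s. LEAST j. s \<in> W 0 j)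
     (\<lambda>n Jn s. LEAST j. s \<in> W (Suc n) j \<and> dist (c j) (c (Jn s)) \<le> r n + r (Suc n))"
  have J0: "J 0 = (\<lambda>s. LEAST j. s \<in> W 0 j)"
    and JS: "J (Suc n) = (\<lambda>s. LEAST j. s \<in> W (Suc n) j \<and> dist (c j) (c (J n s)) \<le> r n + r (Suc n))" for n
    by (auto simp: J_def)
  have Jm: "J n \<in> measurable borel (count_space UNIV)" for n
  proof (induction n)
    case 0
    have [measurable]: "Measurable.pred borel (\<lambda>s. s \<in> W 0 j)" for j
      by (simp add: W pred_def)
    show ?case unfolding J0 by measurable
  next
    case (Suc n)
    note Suc[measurable]
    have [measurable]: "Measurable.pred borel (\<lambda>s. s \<in> W (Suc n) j)" for j
      by (simp add: W pred_def)
    have [measurable]: "Measurable.pred borel (\<lambda>s. dist (c j) (c (J n s)) \<le> r n + r (Suc n))" for j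
      by (rule measurable_compose[OF Suc]) auto
    show ?case unfolding JS by measurable
  qed
  have inv: "s \<in> W n (J n s) \<and> (n > 0 \<longrightarrow> dist (c (J n s)) (c (J (n - 1) s)) \<le> r (n - 1) + r n)"
    if s: "s \<in> fst ` G" for s n
  proof (induction n)
    case 0
    obtain a where a: "(s, a) \<in> G" using s by auto
    then have "a \<in> K" by (force simp: K_def)
    from c(2)[OF this, of "r 0"] a have "\<exists>j. s \<in> W 0 j"
      unfolding W_mem r_def by (auto intro: less_imp_le)
    then show ?case unfolding J0 by (auto intro: LeastI_ex)
  next
    case (Suc n)
    then obtain a where a: "(s, a) \<in> G" "dist (c (J n s)) a \<le> r n" unfolding W_mem by auto
    then have "a \<in> K" by (force simp: K_def)
    moreover have "r (Suc n) > 0" by (simp add: r_def)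
    ultimately obtain j where j: "dist (c j) a < r (Suc n)" using c(2) by blast
    have "dist (c j) (c (J n s)) \<le> r n + r (Suc n)"
      using a(2) j dist_triangle[of "c j" "c (J n s)" a] by (simp add: dist_commute)
    then have "\<exists>j. s \<in> W (Suc n) j \<and> dist (c j) (c (J n s)) \<le> r n + r (Suc n)"
      using a j unfolding W_mem by (auto intro: less_imp_le)
    then show ?case unfolding JS using LeastI_ex by (metis (mono_tags, lifting) diff_Suc_1)
  qed
  have lim: "\<exists>a. (\<lambda>n. c (J n s)) \<longlonglongrightarrow> a \<and> (s, a) \<in> G" if s: "s \<in> fst ` G" for s
  proof -
    have step: "dist (c (J n s)) (c (J (Suc n) s)) \<le> 2 * r n" for n
    proof -
      have "r (Suc n) \<le> r n" by (simp add: r_def)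
      moreover have "dist (c (J n s)) (c (J (Suc n) s)) \<le> r n + r (Suc n)"
        using inv[OF s, of "Suc n"] by (simp add: dist_commute)
      ultimately show ?thesis by linarith
    qed
    have "Cauchy (\<lambda>n. c (J n s))"
    proof (rule metric_CauchyI)
      fix e :: real assume e: "e > 0"
      have "r \<longlonglongrightarrow> 0" unfolding r_def by (rule LIMSEQ_power_zero) simp
      then have "eventually (\<lambda>n. r n < e / 8) sequentially"
        using e by (intro order_tendstoD) auto
      then obtain n0 where n0: "r n0 < e / 8" unfolding eventually_sequentially by blast
      \<comment> \<open>The bound telescopes: since \<open>r\<close> halves at each step,
        \<open>2 * r n = 4 * r n - 4 * r (Suc n)\<close>.\<close>
      have tail: "dist (c (J n0 s)) (c (J (n0 + m) s)) \<le> 4 * r n0 - 4 * r (n0 + m)" for m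
      proof (induction m)
        case (Suc m)
        have "dist (c (J n0 s)) (c (J (n0 + Suc m) s)) \<le> dist (c (J n0 s)) (c (J (n0 + m) s)) + 2 * r (n0 + m)"
          using step[of "n0 + m"] dist_triangle[of "c (J n0 s)" "c (J (n0 + Suc m) s)" "c (J (n0 + m) s)"] by simp
        also have "\<dots> \<le> 4 * r n0 - 4 * r (n0 + Suc m)" using Suc by (simp add: r_def)
        finally show ?case .
      qed auto
      have "dist (c (J n0 s)) (c (J m s)) < e / 2" if "m \<ge> n0" for m
      proof -
        have "r m > 0" by (simp add: r_def)
        with tail[of "m - n0"] that n0 show ?thesis by auto
      qed
      then show "\<exists>M. \<forall>m\<ge>M. \<forall>n\<ge>M. dist (c (J m s)) (c (J n s)) < e"
        by (metis dist_commute dist_triangle_half_l)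
    qed
    moreover have "\<forall>n. c (J n s) \<in> K" using c(1) by auto
    ultimately obtain a where a: "(\<lambda>n. c (J n s)) \<longlonglongrightarrow> a"
      using completeE[OF compact_imp_complete[OF K(1)]] by metis
    \<comment> \<open>The approximations need not lie in the section themselves. Nearby points
      \<open>b n\<close> of the section have the same limit, and closedness of \<open>G\<close> puts
      that limit into the section.\<close>
    have "\<exists>b. (s, b) \<in> G \<and> dist (c (J n s)) b \<le> r n" for n
      using inv[OF s, of n] unfolding W_mem by auto
    then obtain b where b: "\<And>n. (s, b n) \<in> G" "\<And>n. dist (c (J n s)) (b n) \<le> r n" by metis
    have "(\<lambda>n. dist (b n) (c (J n s))) \<longlonglongrightarrow> 0"
    proof (rule real_tendsto_sandwich[OF _ _ tendsto_const])
      show "r \<longlonglongrightarrow> 0" unfolding r_def by (rule LIMSEQ_power_zero) simp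
    qed (use b(2) in \<open>auto simp: dist_commute\<close>)
    from tendsto_add[OF this tendsto_dist_iff[THEN iffD1, OF a]]
    have t: "(\<lambda>n. dist (b n) (c (J n s)) + dist (c (J n s)) a) \<longlonglongrightarrow> 0" by simp
    have "(\<lambda>n. dist (b n) a) \<longlonglongrightarrow> 0"
      by (rule real_tendsto_sandwich[OF _ _ tendsto_const t]) (auto intro!: always_eventually dist_triangle)
    then have "b \<longlonglongrightarrow> a" using tendsto_dist_iff by blast
    then have "(\<lambda>n. (s, b n)) \<longlonglongrightarrow> (s, a)" by (intro tendsto_intros)
    then have "(s, a) \<in> G"
      by (rule closed_sequentially[OF compact_imp_closed[OF G(1)] b(1)])
    with a show ?thesis by blast
  qed
  define \<alpha> where "\<alpha> = (\<lambda>s. if s \<in> fst ` G then lim (\<lambda>n. c (J n s)) else c 0)"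
  have \<alpha>G: "(s, \<alpha> s) \<in> G" and \<alpha>lim: "(\<lambda>n. c (J n s)) \<longlonglongrightarrow> \<alpha> s" if "s \<in> fst ` G" for s
    using lim[OF that] that by (auto simp: \<alpha>_def limI)
  have "compact (fst ` G)" by (intro compact_continuous_image continuous_intros G)
  then have fG: "fst ` G \<in> sets borel" by (intro borel_closed compact_imp_closed)
  have "\<alpha> \<in> borel_measurable borel"
  proof (rule borel_measurable_LIMSEQ_metric)
    fix n
    have "(\<lambda>s. c (J n s)) \<in> borel_measurable borel"
      by (rule measurable_compose[OF Jm]) auto
    then show "(\<lambda>s. if s \<in> fst ` G then c (J n s) else c 0) \<in> borel_measurable borel"
      by (rule measurable_If_set) (use fG in auto)
  next
    fix s :: 'b
    show "(\<lambda>n. if s \<in> fst ` G then c (J n s) else c 0) \<longlonglongrightarrow> \<alpha> s"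
      using \<alpha>lim[of s] by (cases "s \<in> fst ` G") (auto simp: \<alpha>_def)
  qed
  moreover have "\<alpha> s \<in> snd ` G" for s
  proof (cases "s \<in> fst ` G")
    case True from \<alpha>G[OF this] show ?thesis by force
  next
    case False then show ?thesis using c(1) by (auto simp: \<alpha>_def K_def)
  qed
  ultimately show thesis using \<alpha>G that by blast
qed

section \<open>Zeros of indefinite integrals\<close>

text \<open>The gaps to the right of two such points are disjoint, so choosing a rational number in
  each gap is strictly increasing, hence injective.\<close>

lemma countable_right_isolated:
  fixes Z :: "real set"
  shows "countable {t \<in> Z. \<exists>d>0. Z \<inter> {t<..<t+d} = {}}" (is "countable ?R")
proof -
  have "\<exists>q. \<exists>d>0. Z \<inter> {t<..<t+d} = {} \<and> q \<in> \<rat> \<and> t < q \<and> q < t + d" if "t \<in> ?R" for t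
  proof -
    obtain d where d: "d > 0" "Z \<inter> {t<..<t+d} = {}" using \<open>t \<in> ?R\<close> by blast
    then show ?thesis using Rats_dense_in_real[of t "t + d"] by auto
  qed
  then have "\<forall>t\<in>?R. \<exists>q. \<exists>d>0. Z \<inter> {t<..<t+d} = {} \<and> q \<in> \<rat> \<and> t < q \<and> q < t + d"
    by blast
  from bchoice[OF this] obtain q
    where q: "\<And>t. t \<in> ?R \<Longrightarrow> \<exists>d>0. Z \<inter> {t<..<t+d} = {} \<and> q t \<in> \<rat> \<and> t < q t \<and> q t < t + d"
    by blast
  have less: "q s < q t" if s: "s \<in> ?R" and t: "t \<in> ?R" and st: "s < t" for s t
  proof -
    obtain d where "Z \<inter> {s<..<s+d} = {}" "q s < s + d" using q[OF s] by blast
    moreover have "t < q t" "t \<in> Z" using q[OF t] t by auto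
    ultimately show ?thesis using st by (cases "t < s + d") auto
  qed
  have "inj_on q ?R"
  proof (rule inj_onI)
    fix s t assume "s \<in> ?R" "t \<in> ?R" "q s = q t"
    then show "s = t" using less[of s t] less[of t s] by (cases s t rule: linorder_cases) auto
  qed
  moreover have "q ` ?R \<subseteq> \<rat>" using q by blast
  ultimately show ?thesis by (meson countable_rat countable_image_inj_on countable_subset)
qed

text \<open>Almost every time is a point of right differentiability of the integral with derivative
  \<open>h t\<close>. If such a time of \<open>Z\<close> is also a limit of points of
  \<open>Z\<close> from the right, the difference quotients along those points vanish and force
  \<open>h t = 0\<close>; only countably many times of \<open>Z\<close> are not such limits.\<close>

lemma negligible_nonzero_on_zeros_of_integral:
  fixes h :: "real \<Rightarrow> 'b::euclidean_space"
  assumes h: "h integrable_on {0..T}"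
    and Z: "Z \<subseteq> {0..T}" "\<And>t. t \<in> Z \<Longrightarrow> integral {0..t} h = 0"
  shows "negligible {t \<in> Z. h t \<noteq> 0}"
proof -
  define h' where "h' = (\<lambda>t. if t \<in> {0..T} then h t else 0)"
  have "h' integrable_on cbox a b" for a b
    unfolding h'_def using h by (rule integrable_altD(1))
  from integrable_ccontinuous_explicit[OF this] obtain N where N: "negligible N"
    "\<And>x e. \<lbrakk>x \<notin> N; 0 < e\<rbrakk> \<Longrightarrow> \<exists>d>0. \<forall>r. 0 < r \<and> r < d \<longrightarrow>
        norm (integral {x..x+r} h' /\<^sub>R r - h' x) < e"
    by (auto simp: cbox_interval)
  define R where "R = {t \<in> Z. \<exists>d>0. Z \<inter> {t<..<t+d} = {}}"
  have "negligible (N \<union> R)"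
    using N(1) countable_right_isolated[of Z] unfolding R_def
    by (intro negligible_Un) (auto simp: negligible_iff_null_sets intro!: null_sets_completionI countable_imp_null_set_lborel)
  moreover have "{t \<in> Z. h t \<noteq> 0} \<subseteq> N \<union> R"
  proof (rule subsetI, rule ccontr)
    fix t assume t: "t \<in> {t \<in> Z. h t \<noteq> 0}" and "t \<notin> N \<union> R"
    then have tN: "t \<notin> N" and tR: "\<And>d. d > 0 \<Longrightarrow> Z \<inter> {t<..<t+d} \<noteq> {}" unfolding R_def by auto
    have "norm (h t) > 0" using t by auto
    from N(2)[OF tN this] obtain d where d: "d > 0" "\<And>r. 0 < r \<Longrightarrow> r < d \<Longrightarrow>
        norm (integral {t..t+r} h' /\<^sub>R r - h' t) < norm (h t)" by blast
    obtain s where s: "s \<in> Z" "t < s" "s < t + d" using tR[OF d(1)] by auto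
    have t0: "0 \<le> t" "s \<le> T" "t \<le> T" using t s Z(1) by auto
    have "integral {t..s} h' = integral {t..s} h"
      by (rule integral_cong) (use t0 in \<open>auto simp: h'_def\<close>)
    also have "\<dots> = 0"
    proof -
      have "integral {0..t} h + integral {t..s} h = integral {0..s} h"
        by (rule Henstock_Kurzweil_Integration.integral_combine)
          (use t0 s in \<open>auto intro: integrable_on_subinterval[OF h]\<close>)
      then show ?thesis using Z(2) s t by auto
    qed
    finally have "integral {t..t + (s - t)} h' = 0" by simp
    then have "norm (h' t) < norm (h t)" using d(2)[of "s - t"] s by (simp add: norm_minus_commute)
    then show False using t t0 by (simp add: h'_def)
  qed
  ultimately show ?thesis by (rule negligible_subset)
qed

text \<open>An endpoint in \<open>U\<close> could be added to the component without losing
  connectedness, contradicting maximality. This is what later places both ends of an excursion on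
  \<Gamma>.\<close>

lemma open_bounded_component_interval:
  fixes U :: "real set"
  assumes U: "open U" "bounded U" and q: "q \<in> U"
  obtains a b where "a < b" "connected_component_set U q = {a<..<b}" "a \<notin> U" "b \<notin> U"
proof -
  define C where "C = connected_component_set U q"
  have C: "open C" "connected C" "C \<subseteq> U" "q \<in> C" "bounded C"
    unfolding C_def using U q
    by (auto simp: open_connected_component connected_component_subset connected_component_refl
      intro: bounded_subset[OF U(2) connected_component_subset])
  have bb: "bdd_above C" "bdd_below C" using C(5) by (auto intro: bounded_imp_bdd_above bounded_imp_bdd_below)
  define a where "a = Inf C"
  define b where "b = Sup C"
  have Ceq: "C = {a<..<b}"
  proof
    show "C \<subseteq> {a<..<b}"
    proof
      fix x assume x: "x \<in> C"
      obtain e where e: "e > 0" "ball x e \<subseteq> C" using C(1) x openE by blast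
      have "x - e/2 \<in> C" "x + e/2 \<in> C" using e by (auto simp: dist_real_def intro!: subsetD[OF e(2)])
      then show "x \<in> {a<..<b}" using cInf_lower[OF _ bb(2)] cSup_upper[OF _ bb(1)] e(1)
        unfolding a_def b_def by (smt (verit) greaterThanLessThan_iff field_sum_of_halves)
    qed
    show "{a<..<b} \<subseteq> C"
    proof
      fix x assume x: "x \<in> {a<..<b}"
      obtain u where u: "u \<in> C" "u < x"
        using x C(4) cInf_lessD[of C x] unfolding a_def by auto
      obtain v where v: "v \<in> C" "x < v"
        using x C(4) less_cSupD[of C x] unfolding b_def by auto
      show "x \<in> C" using connectedD_interval[OF C(2) u(1) v(1)] u v by auto
    qed
  qed
  have "a < b" using C(4) Ceq by auto
  have "a \<notin> U"
  proof
    assume "a \<in> U"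
    then have "{a..<b} \<subseteq> U" using C(3) Ceq by (force simp: less_eq_real_def)
    then have "{a..<b} \<subseteq> C" unfolding C_def
      by (rule connected_component_maximal[rotated 2]) (use C(4) Ceq in auto)
    then show False using Ceq \<open>a < b\<close> by auto
  qed
  moreover have "b \<notin> U"
  proof
    assume "b \<in> U"
    then have "{a<..b} \<subseteq> U" using C(3) Ceq by (force simp: less_eq_real_def)
    then have "{a<..b} \<subseteq> C" unfolding C_def
      by (rule connected_component_maximal[rotated 2]) (use C(4) Ceq in auto)
    then show False using Ceq \<open>a < b\<close> by auto
  qed
  ultimately show thesis using that \<open>a < b\<close> Ceq unfolding C_def by blast
qed

text \<open>An open set has countably many components, each an interval with endpoints outside the
  set. Countable additivity of the Lebesgue integral then handles infinitely many excursions at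
  once.\<close>

lemma set_integral_open_eq_0:
  fixes k :: "real \<Rightarrow> 'b::euclidean_space"
  assumes U: "open U" "bounded U" and k: "k absolutely_integrable_on U"
    and z: "\<And>a b. a < b \<Longrightarrow> {a<..<b} \<subseteq> U \<Longrightarrow> a \<notin> U \<Longrightarrow> b \<notin> U \<Longrightarrow> integral {a..b} k = 0"
  shows "(LINT s:U|lebesgue. k s) = 0"
proof -
  obtain q :: "nat \<Rightarrow> real" where q: "range q = \<rat>" using countable_rat Rats_infinite
    by (metis bij_betw_def bij_betw_from_nat_into)
  \<comment> \<open>A component is listed only at the first rational number that it contains. This
    enumerates the components without repetition, by pairwise disjoint and possibly empty
    sets.\<close>
  define B where "B = (\<lambda>n. if q n \<in> U \<and> (\<forall>m<n. q m \<notin> connected_component_set U (q n))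
     then connected_component_set U (q n) else {})"
  have BU: "B n \<subseteq> U" for n unfolding B_def by (simp add: connected_component_subset)
  have disj: "B m \<inter> B n = {}" if "m < n" for m n
  proof (rule ccontr)
    assume "B m \<inter> B n \<noteq> {}"
    then obtain x where x: "x \<in> B m" "x \<in> B n" by blast
    then have "x \<in> connected_component_set U (q m)" "x \<in> connected_component_set U (q n)" and qm: "q m \<in> U"
      unfolding B_def by (auto split: if_splits)
    then have "connected_component_set U (q m) = connected_component_set U (q n)"
      by (metis connected_component_eq)
    then have "q m \<in> connected_component_set U (q n)"
      using qm by (metis connected_component_refl_eq mem_Collect_eq)
    then show False using x(2) that unfolding B_def by (auto split: if_splits)
  qed
  have un: "(\<Union>n. B n) = U"
  proof
    show "(\<Union>n. B n) \<subseteq> U" using BU by auto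
    show "U \<subseteq> (\<Union>n. B n)"
    proof
      fix x assume x: "x \<in> U"
      obtain a b where ab: "a < b" "connected_component_set U x = {a<..<b}"
        using open_bounded_component_interval[OF U x] by metis
      obtain r where r: "r \<in> \<rat>" "a < r" "r < b" using Rats_dense_in_real[OF ab(1)] by auto
      then obtain n0 where n0: "q n0 \<in> connected_component_set U x" using q ab(2)
        by (metis greaterThanLessThan_iff imageE)
      define n where "n = (LEAST n. q n \<in> connected_component_set U x)"
      have n: "q n \<in> connected_component_set U x" unfolding n_def using n0 by (rule LeastI)
      have min: "q m \<notin> connected_component_set U x" if "m < n" for m
        using that not_less_Least unfolding n_def by blast
      have eq: "connected_component_set U (q n) = connected_component_set U x"
        using n by (metis connected_component_eq)
      have "B n = connected_component_set U x"
        unfolding B_def using min eq n connected_component_subset[of U x] by auto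
      then show "x \<in> (\<Union>n. B n)" using x by (metis UN_iff UNIV_I connected_component_refl_eq mem_Collect_eq)
    qed
  qed
  have Bz: "(LINT s:B n|lebesgue. k s) = 0" and Bm: "B n \<in> sets lebesgue" for n
  proof -
    have "(LINT s:B n|lebesgue. k s) = 0 \<and> B n \<in> sets lebesgue"
    proof (cases "B n = {}")
      case False
      then have "q n \<in> U" "B n = connected_component_set U (q n)" unfolding B_def by (auto split: if_splits)
      then obtain a b where ab: "a < b" "B n = {a<..<b}" "a \<notin> U" "b \<notin> U"
        using open_bounded_component_interval[OF U] by metis
      have "k absolutely_integrable_on {a<..<b}"
        by (rule set_integrable_subset[OF k]) (use ab BU[of n] in auto)
      then have "(LINT s:B n|lebesgue. k s) = integral {a<..<b} k"
        unfolding ab(2) by (rule set_lebesgue_integral_eq_integral)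
      also have "\<dots> = integral {a..b} k" by (simp add: integral_open_interval_real)
      also have "\<dots> = 0" using z ab BU[of n] by auto
      finally show ?thesis using ab(2) by simp
    qed (simp add: set_lebesgue_integral_def)
    then show "(LINT s:B n|lebesgue. k s) = 0" "B n \<in> sets lebesgue" by auto
  qed
  have "(LINT s:(\<Union>n. B n)|lebesgue. k s) = (\<Sum>n. LINT s:B n|lebesgue. k s)"
  proof (rule lebesgue_integral_countable_add)
    show "B i \<inter> B j = {}" if "i \<noteq> j" for i j
      using disj[of i j] disj[of j i] that by (cases i j rule: linorder_cases) auto
    show "set_integrable lebesgue (\<Union>n. B n) k" using k un by simp
  qed (use Bm in auto)
  then show ?thesis using un Bz by simp
qed

section \<open>Convex sets\<close>

text \<open>A segment from a point with negative first coordinate to one with positive first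
  coordinate crosses the axis inside \<open>K\<close>, where \<open>H\<close> is an upper bound.
  Hence every slope from the left lies below every slope from the right, and the supremum of the
  left slopes separates. The point \<open>w\<close> keeps the supremum finite (a Slater condition),
  and the extra element 0 makes it non-negative.\<close>

lemma convex_multiplier_exists:
  fixes K :: "(real \<times> real) set"
  assumes K: "convex K" and H: "\<And>z. z \<in> K \<Longrightarrow> fst z \<ge> 0 \<Longrightarrow> snd z \<le> H"
    and w: "w \<in> K" "fst w > 0"
  obtains \<mu> where "\<mu> \<ge> 0" "\<And>z. z \<in> K \<Longrightarrow> snd z + \<mu> * fst z \<le> H"
proof -
  define S where "S = insert 0 ((\<lambda>z. (snd z - H) / (- fst z)) ` {z \<in> K. fst z < 0})"
  have up: "m \<le> (H - snd v) / fst v" if m: "m \<in> S" and v: "v \<in> K" "fst v > 0" for m v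
  proof (cases "m = 0")
    case True
    then show ?thesis using H[OF v(1)] v(2) by auto
  next
    case False
    then obtain z where z: "z \<in> K" "fst z < 0" "m = (snd z - H) / (- fst z)" using m unfolding S_def by auto
    \<comment> \<open>The weight for which the convex combination of \<open>z\<close> and
      \<open>v\<close> has first coordinate zero.\<close>
    define t where "t = fst v / (fst v - fst z)"
    have t: "0 \<le> t" "t \<le> 1" "1 - t = - fst z / (fst v - fst z)"
      unfolding t_def using v z by (auto simp: field_simps)
    have "t *\<^sub>R z + (1 - t) *\<^sub>R v \<in> K" using K z(1) v(1) t unfolding convex_alt
      by (metis add.commute)
    moreover have "fst (t *\<^sub>R z + (1 - t) *\<^sub>R v) = 0"
      unfolding t(3) using v z by (simp add: t_def field_simps)
    ultimately have "snd (t *\<^sub>R z + (1 - t) *\<^sub>R v) \<le> H" by (intro H) auto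
    then have "t * snd z + (1 - t) * snd v \<le> H" by simp
    moreover have "t * snd z + (1 - t) * snd v = (fst v * snd z + (- fst z) * snd v) / (fst v - fst z)"
      unfolding t(3) by (simp add: t_def add_divide_distrib diff_divide_distrib)
    ultimately have "fst v * snd z + (- fst z) * snd v \<le> H * (fst v - fst z)"
      using v z by (simp only: pos_divide_le_eq diff_gt_0_iff_gt)
    then show ?thesis unfolding z(3) using v z(2)
      by (simp add: divide_simps) (simp add: algebra_simps)
  qed
  have bdd: "bdd_above S" using up[OF _ w] by (auto simp: bdd_above_def)
  define \<mu> where "\<mu> = Sup S"
  have "\<mu> \<ge> 0" unfolding \<mu>_def by (rule cSup_upper[OF _ bdd]) (simp add: S_def)
  moreover have "snd z + \<mu> * fst z \<le> H" if z: "z \<in> K" for z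
  proof (cases "fst z" "0 :: real" rule: linorder_cases)
    case less
    then have "(snd z - H) / (- fst z) \<le> \<mu>" unfolding \<mu>_def
      by (intro cSup_upper[OF _ bdd]) (use z in \<open>auto simp: S_def\<close>)
    then have "snd z - H \<le> \<mu> * (- fst z)" using less by (simp only: pos_divide_le_eq neg_0_less_iff_less)
    then show ?thesis by simp
  next
    case equal then show ?thesis using H[OF z] by auto
  next
    case greater
    have "\<mu> \<le> (H - snd z) / fst z" unfolding \<mu>_def
      by (rule cSup_least) (use up[OF _ z greater] in \<open>auto simp: S_def\<close>)
    then show ?thesis using greater by (simp add: field_simps)
  qed
  ultimately show thesis by (rule that)
qed

text \<open>If \<open>u\<close> were missing, a hyperplane through its closest point in
  \<open>K\<close> would separate it from \<open>K\<close>. Going a further \<open>d / 2\<close>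
  beyond \<open>u\<close> still stays within norm \<open>d\<close>, but ends at distance more than
  \<open>d / 2\<close> from all of \<open>K\<close>. In this way the supply of small velocities
  survives a perturbation of the velocity set.\<close>

lemma ball_Int_subspace_subset_convex:
  fixes K :: "'b::euclidean_space set"
  assumes V: "subspace V" and K: "closed K" "convex K" "K \<subseteq> V" and d: "d > 0"
    and near: "\<And>u. u \<in> V \<Longrightarrow> norm u < d \<Longrightarrow> \<exists>k\<in>K. norm (k - u) \<le> d / 2"
  shows "ball 0 (d / 2) \<inter> V \<subseteq> K"
proof
  fix u assume "u \<in> ball 0 (d / 2) \<inter> V"
  then have u: "norm u < d / 2" "u \<in> V" by auto
  have ne: "K \<noteq> {}" using near[of 0] V d by (auto simp: subspace_0)
  show "u \<in> K"
  proof (rule ccontr)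
    assume uK: "u \<notin> K"
    define c where "c = closest_point K u"
    have c: "c \<in> K" unfolding c_def by (rule closest_point_in_set[OF K(1) ne])
    define n where "n = u - c"
    have n: "n \<in> V" "n \<noteq> 0" using u(2) c K(3) V uK unfolding n_def by (auto intro: subspace_diff)
    \<comment> \<open>The point at distance \<open>d / 2\<close> beyond \<open>u\<close>, in the
      direction away from its closest point \<open>c\<close>.\<close>
    define k0 where "k0 = u + (d / 2 / norm n) *\<^sub>R n"
    have "norm k0 \<le> norm u + d / 2" unfolding k0_def using norm_triangle_ineq[of u "(d / 2 / norm n) *\<^sub>R n"] n d by simp
    then have "norm k0 < d" using u(1) by simp
    moreover have "k0 \<in> V" unfolding k0_def using V u n by (intro subspace_add subspace_mul)
    ultimately obtain k where k: "k \<in> K" "norm (k - k0) \<le> d / 2" using near by blast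
    have "n \<bullet> (k - c) \<le> 0" using closest_point_dot[OF K(2,1) k(1), of u] by (simp add: n_def c_def)
    moreover have "n \<bullet> (k - c) = n \<bullet> n + n \<bullet> (k0 - u) + n \<bullet> (k - k0)"
      by (simp add: n_def inner_diff_right)
    moreover have "n \<bullet> (k0 - u) = d / 2 * norm n" using n(2)
      by (simp add: k0_def dot_square_norm power2_eq_square)
    moreover have "\<bar>n \<bullet> (k - k0)\<bar> \<le> norm n * (d / 2)"
      using Cauchy_Schwarz_ineq2[of n "k - k0"] k(2) by (meson mult_left_mono norm_ge_zero order_trans)
    moreover have "n \<bullet> n > 0" using n(2) by simp
    ultimately show False by (smt (verit) mult.commute)
  qed
qed

section \<open>Admissible arcs and trajectories\<close>

lemma AE_lebesgue_translation:
  fixes c :: real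
  assumes "AE t in lebesgue. Q t"
  shows "AE t in lebesgue. Q (t + c)"
proof -
  obtain X where X: "negligible X" "{t. \<not> Q t} \<subseteq> X"
    using assms unfolding eventually_ae_filter_negligible by blast
  have "{t. \<not> Q (t + c)} \<subseteq> (+) (- c) ` X"
  proof
    fix t assume "t \<in> {t. \<not> Q (t + c)}"
    then have "t + c \<in> X" using X(2) by auto
    then show "t \<in> (+) (- c) ` X" by (intro image_eqI[of _ _ "t + c"]) auto
  qed
  then show ?thesis using negligible_translation[OF X(1), of "- c"]
    unfolding eventually_ae_filter_negligible by blast
qed

lemma measurable_lebesgue_on_translation:
  fixes g :: "real \<Rightarrow> 'b::topological_space"
  assumes g: "g \<in> borel_measurable (lebesgue_on Y)" and XY: "\<And>t. t \<in> X \<Longrightarrow> t + c \<in> Y"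
  shows "(\<lambda>t. g (t + c)) \<in> borel_measurable (lebesgue_on X)"
proof (rule measurable_compose[OF _ g])
  have "(\<lambda>t. c + 1 * t) \<in> lebesgue \<rightarrow>\<^sub>M lebesgue"
    using lebesgue_affine_measurable[where c = "\<lambda>x::real. 1" and t = c] by simp
  then have "(\<lambda>t. t + c) \<in> lebesgue \<rightarrow>\<^sub>M lebesgue" by (simp add: add.commute)
  then show "(\<lambda>t. t + c) \<in> lebesgue_on X \<rightarrow>\<^sub>M lebesgue_on Y"
    by (intro measurable_restrict_space2 measurable_restrict_space1) (use XY in auto)
qed

lemma first_hit:
  fixes g :: "real \<Rightarrow> real"
  assumes g: "continuous_on {0..} g" and g0: "g 0 \<ge> 0"
  obtains "\<And>t. t \<ge> 0 \<Longrightarrow> g t > 0"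
  | \<sigma> where "\<sigma> \<ge> 0" "g \<sigma> = 0" "\<And>t. 0 \<le> t \<Longrightarrow> t < \<sigma> \<Longrightarrow> g t > 0"
proof (cases "\<exists>t\<ge>0. g t \<le> 0")
  case False
  then show ?thesis using that(1) by force
next
  case True
  then obtain t1 where t1: "t1 \<ge> 0" "g t1 \<le> 0" by blast
  define Q where "Q = {0..t1} \<inter> g -` {..0}"
  have "closed Q" unfolding Q_def
    by (rule continuous_closed_preimage[OF continuous_on_subset[OF g]]) auto
  moreover have "t1 \<in> Q" using t1 by (simp add: Q_def)
  moreover have bb: "bdd_below Q" unfolding Q_def by auto
  ultimately have \<sigma>: "Inf Q \<in> Q" using closed_contains_Inf by blast
  have lower: "Inf Q \<le> s" if "s \<in> Q" for s using cInf_lower[OF that bb] .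
  have \<sigma>0: "Inf Q \<ge> 0" "Inf Q \<le> t1" "g (Inf Q) \<le> 0" using \<sigma> by (auto simp: Q_def)
  have pos: "g t > 0" if "0 \<le> t" "t < Inf Q" for t
    using lower[of t] that \<sigma>0 by (force simp: Q_def)
  obtain s where s: "0 \<le> s" "s \<le> Inf Q" "g s = 0"
    using IVT2'[of g "Inf Q" 0 0] \<sigma>0 g0 continuous_on_subset[OF g, of "{0..Inf Q}"] by auto
  then have "g (Inf Q) = 0" using pos[of s] by (cases "s = Inf Q") auto
  with pos \<sigma>0 show ?thesis using that(2) by blast
qed

lemma AE_integral_ge:
  fixes h :: "real \<Rightarrow> real"
  assumes h: "h absolutely_integrable_on {a..b}" and ab: "a \<le> b"
    and ae: "AE s in lebesgue. s \<in> {a..b} \<longrightarrow> m \<le> h s"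
  shows "m * (b - a) \<le> integral {a..b} h"
proof -
  have "m * (b - a) = (LINT s:{a..b}|lebesgue. m)" using ab by (simp add: set_integral_const)
  also have "\<dots> \<le> (LINT s:{a..b}|lebesgue. h s)"
    by (rule set_integral_mono_AE) (use h ae in \<open>auto simp: absolutely_integrable_on_def integrable_const_ivl\<close>)
  also have "\<dots> = integral {a..b} h" by (rule set_lebesgue_integral_eq_integral(2)[OF h])
  finally show ?thesis .
qed

lemma derivative_nonneg_at_left_endpoint:
  fixes g :: "real \<Rightarrow> real"
  assumes g: "(g has_real_derivative d) (at 0 within {0..t1})" and t1: "t1 > 0"
    and ge: "eventually (\<lambda>t. g 0 \<le> g t) (at 0 within {0..t1})"
  shows "d \<ge> 0"
proof (rule tendsto_lowerbound)
  show "((\<lambda>t. (g t - g 0) / (t - 0)) \<longlongrightarrow> d) (at 0 within {0..t1})"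
    using g by (simp add: has_field_derivative_iff)
  have "eventually (\<lambda>t. t \<in> {0..t1}) (at 0 within {0..t1})" by (simp add: eventually_at_filter)
  with ge show "\<forall>\<^sub>F t in at 0 within {0..t1}. 0 \<le> (g t - g 0) / (t - 0)"
    by eventually_elim auto
  show "at 0 within {0..t1} \<noteq> bot" using t1 by (simp add: at_within_Icc_at_right)
qed

text \<open>The constants that the hypotheses assert to exist become parameters, uniform over the
  branches. The bounds \<open>Mf\<close> and \<open>Ml\<close> are taken positive, so that
  tolerances such as \<open>\<epsilon> / Mf\<close> make sense.\<close>

locale junction_control =
  fixes N :: nat
    and e :: "nat \<Rightarrow> real ^ 3"
    and A :: "nat \<Rightarrow> 'a::metric_space set"
    and f :: "nat \<Rightarrow> real ^ 3 \<Rightarrow> 'a \<Rightarrow> real ^ 3"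
    and l :: "nat \<Rightarrow> real ^ 3 \<Rightarrow> 'a \<Rightarrow> real"
    and lam Mf L Ml \<delta> :: real and \<omega> :: "real \<Rightarrow> real"
  assumes junction: "junction N e" and lam: "lam > 0"
    and A_ne: "\<And>i. i \<in> {1..N} \<Longrightarrow> A i \<noteq> {}"
    and A_compact: "\<And>i. i \<in> {1..N} \<Longrightarrow> compact (A i)"
    and A_disj: "\<And>i j. i \<in> {1..N} \<Longrightarrow> j \<in> {1..N} \<Longrightarrow> i \<noteq> j \<Longrightarrow> A i \<inter> A j = {}"
    and f_plane: "\<And>i x a. i \<in> {1..N} \<Longrightarrow> x \<in> halfplane e i \<Longrightarrow> a \<in> A i \<Longrightarrow> f i x a \<in> plane e i"
    and f_cont: "\<And>i. i \<in> {1..N} \<Longrightarrow> continuous_on (halfplane e i \<times> A i) (\<lambda>(x, a). f i x a)"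
    and f_bd: "\<And>i x a. i \<in> {1..N} \<Longrightarrow> x \<in> halfplane e i \<Longrightarrow> a \<in> A i \<Longrightarrow> norm (f i x a) \<le> Mf"
    and Mf: "Mf > 0" and L: "L > 0"
    and f_lip: "\<And>i x y a. i \<in> {1..N} \<Longrightarrow> x \<in> halfplane e i \<Longrightarrow> y \<in> halfplane e i \<Longrightarrow> a \<in> A i
      \<Longrightarrow> norm (f i x a - f i y a) \<le> L * norm (x - y)"
    and l_cont: "\<And>i. i \<in> {1..N} \<Longrightarrow> continuous_on (halfplane e i \<times> A i) (\<lambda>(x, a). l i x a)"
    and l_bd: "\<And>i x a. i \<in> {1..N} \<Longrightarrow> x \<in> halfplane e i \<Longrightarrow> a \<in> A i \<Longrightarrow> \<bar>l i x a\<bar> \<le> Ml"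
    and Ml: "Ml > 0"
    and omega: "modulus_of_continuity \<omega>"
    and l_mod: "\<And>i x y a. i \<in> {1..N} \<Longrightarrow> x \<in> halfplane e i \<Longrightarrow> y \<in> halfplane e i \<Longrightarrow> a \<in> A i
      \<Longrightarrow> \<bar>l i x a - l i y a\<bar> \<le> \<omega> (norm (x - y))"
    and FL_convex: "\<And>i x. i \<in> {1..N} \<Longrightarrow> x \<in> halfplane e i \<Longrightarrow> convex (FL A f l i x)"
    and delta: "\<delta> > 0"
    and ball_subset: "\<And>i x. i \<in> {1..N} \<Longrightarrow> x \<in> interface e \<Longrightarrow> ball 0 \<delta> \<inter> plane e i \<subseteq> f i x ` A i"
begin

section \<open>Coordinates on the half-planes, and the set of admissible pairs\<close>

abbreviation "P \<equiv> halfplane e"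
abbreviation "\<Gamma> \<equiv> interface e"
abbreviation "S \<equiv> network N e"

lemma N_gt_1: "N > 1"
  using junction by (simp add: junction_def)

lemma inner_e [simp]:
  assumes "i \<in> {1..N}"
  shows "e i \<bullet> e i = 1" "e i \<bullet> e 0 = 0" "e 0 \<bullet> e i = 0" "norm (e i) = 1"
  using junction assms by (auto simp: junction_def dot_square_norm inner_commute)

lemma inner_e0 [simp]: "e 0 \<bullet> e 0 = 1" "norm (e 0) = 1"
  using junction by (auto simp: junction_def dot_square_norm)

lemma interface_iff: "x \<in> \<Gamma> \<longleftrightarrow> x = (x \<bullet> e 0) *\<^sub>R e 0"
proof
  assume "x \<in> \<Gamma>"
  then obtain k where "x = k *\<^sub>R e 0" unfolding interface_def by (auto simp: span_singleton)
  then show "x = (x \<bullet> e 0) *\<^sub>R e 0" by simp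
next
  assume "x = (x \<bullet> e 0) *\<^sub>R e 0"
  then show "x \<in> \<Gamma>" unfolding interface_def span_singleton by (metis rangeI)
qed

lemma plane_iff:
  assumes i: "i \<in> {1..N}"
  shows "x \<in> plane e i \<longleftrightarrow> x = (x \<bullet> e 0) *\<^sub>R e 0 + (x \<bullet> e i) *\<^sub>R e i"
proof
  assume "x \<in> plane e i"
  then obtain k m where "x - k *\<^sub>R e 0 = m *\<^sub>R e i" unfolding plane_def
    by (auto simp: span_insert[of "e 0"] span_singleton)
  then have "x = k *\<^sub>R e 0 + m *\<^sub>R e i" by (metis diff_add_cancel add.commute)
  then show "x = (x \<bullet> e 0) *\<^sub>R e 0 + (x \<bullet> e i) *\<^sub>R e i" using i by (simp add: inner_add_left)
next
  assume "x = (x \<bullet> e 0) *\<^sub>R e 0 + (x \<bullet> e i) *\<^sub>R e i"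
  then show "x \<in> plane e i" unfolding plane_def
    by (metis span_add span_base span_scale insertI1 insertI2)
qed

lemma halfplane_iff:
  assumes i: "i \<in> {1..N}"
  shows "x \<in> P i \<longleftrightarrow> x = (x \<bullet> e 0) *\<^sub>R e 0 + (x \<bullet> e i) *\<^sub>R e i \<and> x \<bullet> e i \<ge> 0"
proof
  assume "x \<in> P i"
  then obtain k m where "x = k *\<^sub>R e 0 + m *\<^sub>R e i" "m \<ge> 0" unfolding halfplane_def by auto
  then show "x = (x \<bullet> e 0) *\<^sub>R e 0 + (x \<bullet> e i) *\<^sub>R e i \<and> x \<bullet> e i \<ge> 0" using i by (simp add: inner_add_left)
next
  assume "x = (x \<bullet> e 0) *\<^sub>R e 0 + (x \<bullet> e i) *\<^sub>R e i \<and> x \<bullet> e i \<ge> 0"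
  then show "x \<in> P i" unfolding halfplane_def by blast
qed

lemma halfplane_iff_plane: "i \<in> {1..N} \<Longrightarrow> x \<in> P i \<longleftrightarrow> x \<in> plane e i \<and> x \<bullet> e i \<ge> 0"
  by (simp add: halfplane_iff plane_iff)

lemma subspace_plane [simp]: "subspace (plane e i)"
  unfolding plane_def by (rule subspace_span)

lemma interface_subset_halfplane:
  assumes i: "i \<in> {1..N}" and x: "x \<in> \<Gamma>"
  shows "x \<in> P i" "x \<bullet> e i = 0"
proof -
  obtain k where k: "x = k *\<^sub>R e 0" using x unfolding interface_iff by blast
  then show "x \<bullet> e i = 0" using i by simp
  show "x \<in> P i" using i unfolding halfplane_iff[OF i] k by simp
qed

lemma interface_iff_halfplane:
  assumes i: "i \<in> {1..N}" and x: "x \<in> P i"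
  shows "x \<in> \<Gamma> \<longleftrightarrow> x \<bullet> e i = 0"
  using x interface_subset_halfplane(2)[OF i] unfolding halfplane_iff[OF i] interface_iff by auto

text \<open>The normal parts along \<open>e i\<close> and \<open>e j\<close> coincide, so they have
  the same length; as the unit vectors differ, that length is zero.\<close>

lemma halfplane_Int:
  assumes i: "i \<in> {1..N}" and j: "j \<in> {1..N}" and ij: "i \<noteq> j" and x: "x \<in> P i" "x \<in> P j"
  shows "x \<in> \<Gamma>"
proof -
  define a where "a = x \<bullet> e i"
  define b where "b = x \<bullet> e j"
  have ab: "a \<ge> 0" "b \<ge> 0" "x = (x \<bullet> e 0) *\<^sub>R e 0 + a *\<^sub>R e i" "x = (x \<bullet> e 0) *\<^sub>R e 0 + b *\<^sub>R e j"
    using x unfolding halfplane_iff[OF i] halfplane_iff[OF j] a_def b_def by auto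
  then have eq: "a *\<^sub>R e i = b *\<^sub>R e j" by (metis add_left_imp_eq)
  then have "norm (a *\<^sub>R e i) = norm (b *\<^sub>R e j)" by simp
  then have "a = b" using ab(1,2) i j by simp
  moreover have "e i \<noteq> e j" using junction i j ij by (auto simp: junction_def inj_on_def)
  ultimately have "a = 0" using eq by auto
  then show ?thesis using interface_iff_halfplane[OF i x(1)] by (simp add: a_def)
qed

lemma closed_halfplane:
  assumes i: "i \<in> {1..N}"
  shows "closed (P i)"
proof -
  have "P i = {x. x = (x \<bullet> e 0) *\<^sub>R e 0 + (x \<bullet> e i) *\<^sub>R e i} \<inter> {x. 0 \<le> x \<bullet> e i}"
    using halfplane_iff[OF i] by auto
  then show ?thesis
    by (auto intro!: closed_Int closed_Collect_eq closed_Collect_le continuous_intros)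
qed

lemma convex_halfplane: "convex (P i)"
proof (rule convexI)
  fix x y and u v :: real
  assume x: "x \<in> P i" and y: "y \<in> P i" and uv: "0 \<le> u" "0 \<le> v" "u + v = 1"
  obtain a b where a: "x = a *\<^sub>R e 0 + b *\<^sub>R e i" "b \<ge> 0" using x unfolding halfplane_def by auto
  obtain c d where c: "y = c *\<^sub>R e 0 + d *\<^sub>R e i" "d \<ge> 0" using y unfolding halfplane_def by auto
  have "u *\<^sub>R x + v *\<^sub>R y = (u * a + v * c) *\<^sub>R e 0 + (u * b + v * d) *\<^sub>R e i"
    unfolding a c by (simp add: algebra_simps)
  then show "u *\<^sub>R x + v *\<^sub>R y \<in> P i" unfolding halfplane_def using a(2) c(2) uv by fastforce
qed

lemma halfplane_ne: "P i \<noteq> {}"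
  unfolding halfplane_def by auto

lemma closed_interface: "closed \<Gamma>"
  unfolding interface_def by (rule closed_subspace[OF subspace_span])

lemma network_iff: "x \<in> S \<longleftrightarrow> (\<exists>i\<in>{1..N}. x \<in> P i)"
  by (auto simp: network_def)

text \<open>Points of \<Gamma> belong to every half-plane, so both cases of the definition merge
  into one: state and control share an index. The set is therefore a finite union of closed
  products.\<close>

lemma M_set_iff: "(x, a) \<in> M_set N e A \<longleftrightarrow> (\<exists>i\<in>{1..N}. x \<in> P i \<and> a \<in> A i)"
proof
  assume M: "(x, a) \<in> M_set N e A"
  show "\<exists>i\<in>{1..N}. x \<in> P i \<and> a \<in> A i"
  proof (cases "x \<in> \<Gamma>")
    case True
    then show ?thesis using M interface_subset_halfplane(1) unfolding M_set_def by auto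
  next
    case False
    then show ?thesis using M unfolding M_set_def network_def by blast
  qed
next
  assume "\<exists>i\<in>{1..N}. x \<in> P i \<and> a \<in> A i"
  then show "(x, a) \<in> M_set N e A"
    using halfplane_Int unfolding M_set_def network_def by blast
qed

lemma active_index_eq:
  assumes i: "i \<in> {1..N}" and x: "x \<in> P i" and a: "a \<in> A i"
  shows "active_index N e A x a = i"
  unfolding active_index_def
proof (rule the_equality)
  show "i \<in> {1..N} \<and> (x \<in> P i - \<Gamma> \<or> x \<in> \<Gamma> \<and> a \<in> A i)" using i x a by auto
  fix j assume "j \<in> {1..N} \<and> (x \<in> P j - \<Gamma> \<or> x \<in> \<Gamma> \<and> a \<in> A j)"
  then show "j = i" using halfplane_Int[OF i _ _ x] A_disj[OF i, of j] a by blast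
qed

abbreviation "D y \<alpha> s \<equiv> dynamics N e A f (y s) (\<alpha> s)"
abbreviation "R y \<alpha> s \<equiv> running_cost N e A l (y s) (\<alpha> s)"

lemma dynamics_eq: "i \<in> {1..N} \<Longrightarrow> x \<in> P i \<Longrightarrow> a \<in> A i \<Longrightarrow> dynamics N e A f x a = f i x a"
  by (simp add: dynamics_def active_index_eq)

lemma running_cost_eq: "i \<in> {1..N} \<Longrightarrow> x \<in> P i \<Longrightarrow> a \<in> A i \<Longrightarrow> running_cost N e A l x a = l i x a"
  by (simp add: running_cost_def active_index_eq)

lemma M_set_eq: "M_set N e A = (\<Union>i\<in>{1..N}. P i \<times> A i)"
  using M_set_iff by auto

lemma closed_M_set: "closed (M_set N e A)"
  unfolding M_set_eq
  using closed_halfplane compact_imp_closed[OF A_compact] by (intro closed_UN ballI closed_Times) blast+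

text \<open>The control alone determines the branch, also on \<Gamma>. The closed pieces
  \<open>P i \<times> A i\<close> are thus pairwise disjoint, and no discontinuity arises where
  half-planes meet.\<close>

lemma continuous_dynamics: "continuous_on (M_set N e A) (\<lambda>(x, a). dynamics N e A f x a)"
  unfolding M_set_eq
proof (rule continuous_on_closed_Union)
  fix i assume i: "i \<in> {1..N}"
  show "closed (P i \<times> A i)"
    by (intro closed_Times closed_halfplane compact_imp_closed A_compact i)
  show "continuous_on (P i \<times> A i) (\<lambda>(x, a). dynamics N e A f x a)"
    by (rule continuous_on_eq[OF f_cont[OF i]]) (auto simp: dynamics_eq[OF i])
qed auto

lemma continuous_running_cost: "continuous_on (M_set N e A) (\<lambda>(x, a). running_cost N e A l x a)"
  unfolding M_set_eq
proof (rule continuous_on_closed_Union)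
  fix i assume i: "i \<in> {1..N}"
  show "closed (P i \<times> A i)"
    by (intro closed_Times closed_halfplane compact_imp_closed A_compact i)
  show "continuous_on (P i \<times> A i) (\<lambda>(x, a). running_cost N e A l x a)"
    by (rule continuous_on_eq[OF l_cont[OF i]]) (auto simp: running_cost_eq[OF i])
qed auto

lemma dynamics_bound: "(x, a) \<in> M_set N e A \<Longrightarrow> norm (dynamics N e A f x a) \<le> Mf"
  using f_bd dynamics_eq unfolding M_set_iff by fastforce

lemma running_cost_bound: "(x, a) \<in> M_set N e A \<Longrightarrow> \<bar>running_cost N e A l x a\<bar> \<le> Ml"
  using l_bd running_cost_eq unfolding M_set_iff by fastforce

text \<open>A common form for arcs (\<open>X = {0..T}\<close>) and for trajectories (\<open>X = {0..}\<close>).\<close>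

definition admissible :: "real set \<Rightarrow> real ^ 3 \<Rightarrow> (real \<Rightarrow> real ^ 3) \<Rightarrow> (real \<Rightarrow> 'a) \<Rightarrow> bool" where
  "admissible X x y \<alpha> \<longleftrightarrow> (\<lambda>t. (y t, \<alpha> t)) \<in> borel_measurable (lebesgue_on X) \<and>
     (AE t in lebesgue. t \<in> X \<longrightarrow> (y t, \<alpha> t) \<in> M_set N e A) \<and>
     (\<forall>t\<in>X. y t \<in> S \<and> y t = x + integral {0..t} (D y \<alpha>))"

definition J :: "real \<Rightarrow> (real \<Rightarrow> real ^ 3) \<Rightarrow> (real \<Rightarrow> 'a) \<Rightarrow> real" where
  "J T y \<alpha> = integral {0..T} (\<lambda>s. R y \<alpha> s * exp (- lam * s))"

lemma admissibleD:
  assumes "admissible X x y \<alpha>"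
  shows "(\<lambda>t. (y t, \<alpha> t)) \<in> borel_measurable (lebesgue_on X)"
    and "AE t in lebesgue. t \<in> X \<longrightarrow> (y t, \<alpha> t) \<in> M_set N e A"
    and "\<And>t. t \<in> X \<Longrightarrow> y t \<in> S"
    and "\<And>t. t \<in> X \<Longrightarrow> y t = x + integral {0..t} (D y \<alpha>)"
  using assms unfolding admissible_def by blast+

lemma admissible_mono:
  assumes "admissible Y x y \<alpha>" "X \<subseteq> Y"
  shows "admissible X x y \<alpha>"
proof -
  have "(\<lambda>t. (y t, \<alpha> t)) \<in> borel_measurable (lebesgue_on X)"
    using assms measurable_restrict_mono unfolding admissible_def by blast
  moreover have "AE t in lebesgue. t \<in> X \<longrightarrow> (y t, \<alpha> t) \<in> M_set N e A"
    using assms unfolding admissible_def by (auto elim!: AE_mp)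
  ultimately show ?thesis using assms unfolding admissible_def by blast
qed

lemma admissible_AE:
  assumes "admissible X x y \<alpha>" "X \<in> sets lebesgue"
  shows "AE t in lebesgue_on X. (y t, \<alpha> t) \<in> M_set N e A"
  using admissibleD(2)[OF assms(1)] assms(2) by (simp add: AE_restrict_space_iff)

lemma admissible_measurable:
  assumes a: "admissible X x y \<alpha>" and X: "X \<in> sets lebesgue"
  shows "D y \<alpha> \<in> borel_measurable (lebesgue_on X)" "R y \<alpha> \<in> borel_measurable (lebesgue_on X)"
proof -
  have m: "(\<lambda>t. (y t, \<alpha> t)) \<in> borel_measurable (lebesgue_on X)" using a by (simp add: admissible_def)
  show "D y \<alpha> \<in> borel_measurable (lebesgue_on X)"
    using measurable_comp_continuous_AE[OF continuous_dynamics closed_M_set m X admissible_AE[OF a X]] by simp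
  show "R y \<alpha> \<in> borel_measurable (lebesgue_on X)"
    using measurable_comp_continuous_AE[OF continuous_running_cost closed_M_set m X admissible_AE[OF a X]] by simp
qed

lemma admissible_bound:
  assumes a: "admissible X x y \<alpha>" and X: "X \<in> sets lebesgue"
  shows "AE t in lebesgue_on X. norm (D y \<alpha> t) \<le> Mf" "AE t in lebesgue_on X. \<bar>R y \<alpha> t\<bar> \<le> Ml"
  using admissible_AE[OF a X] dynamics_bound running_cost_bound by (auto elim!: AE_mp)

lemma admissible_integrable:
  assumes "admissible X x y \<alpha>" "{a..b} \<subseteq> X"
  shows "D y \<alpha> absolutely_integrable_on {a..b}" "R y \<alpha> absolutely_integrable_on {a..b}"
proof -
  have a: "admissible {a..b} x y \<alpha>" using admissible_mono assms by blast
  have s: "{a..b} \<in> sets lebesgue" by simp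
  show "D y \<alpha> absolutely_integrable_on {a..b}"
    by (rule bounded_measurable_absolutely_integrable admissible_measurable[OF a s] admissible_bound[OF a s])+
  show "R y \<alpha> absolutely_integrable_on {a..b}"
    by (rule bounded_measurable_absolutely_integrable admissible_measurable[OF a s]
        admissible_bound(2)[OF a s, folded real_norm_def])+
qed

lemma admissible_increment:
  assumes a: "admissible X x y \<alpha>" and X: "{0..t} \<subseteq> X" and s: "0 \<le> s" "s \<le> t"
  shows "y t - y s = integral {s..t} (D y \<alpha>)" "norm (y t - y s) \<le> Mf * (t - s)"
proof -
  have i: "D y \<alpha> integrable_on {0..t}"
    by (rule set_lebesgue_integral_eq_integral(1)[OF admissible_integrable(1)[OF a X]])
  have "integral {0..s} (D y \<alpha>) + integral {s..t} (D y \<alpha>) = integral {0..t} (D y \<alpha>)"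
    by (rule Henstock_Kurzweil_Integration.integral_combine) (use s i in auto)
  moreover have "y t = x + integral {0..t} (D y \<alpha>)" "y s = x + integral {0..s} (D y \<alpha>)"
    using X s by (auto intro!: admissibleD(4)[OF a])
  ultimately show eq: "y t - y s = integral {s..t} (D y \<alpha>)" by (simp add: algebra_simps)
  have a': "admissible {s..t} x y \<alpha>" by (rule admissible_mono[OF a]) (use X s in auto)
  show "norm (y t - y s) \<le> Mf * (t - s)" unfolding eq
    by (intro AE_norm_integral_le admissible_measurable(1)[OF a'] admissible_bound(1)[OF a']) (use s in auto)
qed

lemma admissible_lipschitz:
  assumes a: "admissible X x y \<alpha>" and X: "\<And>t. t \<in> X \<Longrightarrow> {0..t} \<subseteq> X" "X \<subseteq> {0..}"
  shows "Mf-lipschitz_on X y"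
proof (rule lipschitz_onI)
  fix s t assume st: "s \<in> X" "t \<in> X"
  show "dist (y s) (y t) \<le> Mf * dist s t"
    using admissible_increment(2)[OF a X(1)[OF st(1)], of t] admissible_increment(2)[OF a X(1)[OF st(2)], of s] st X(2)
    by (cases "s \<le> t") (auto simp: dist_norm norm_minus_commute abs_if split: if_splits)
qed (use Mf in simp)

lemma admissible_0: "admissible X x y \<alpha> \<Longrightarrow> 0 \<in> X \<Longrightarrow> y 0 = x"
  by (auto simp: admissible_def)

text \<open>The Lipschitz property follows from the bound \<open>Mf\<close>, and local boundedness
  from compactness of the control sets. The rest is the agreement of Lebesgue and gauge integrals
  for bounded measurable integrands.\<close>

lemma trajectories_iff: "(y, \<alpha>) \<in> trajectories N e A f x \<longleftrightarrow> admissible {0..} x y \<alpha>"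
proof
  assume t: "(y, \<alpha>) \<in> trajectories N e A f x"
  then have m: "(\<lambda>t. (y t, \<alpha> t)) \<in> borel_measurable (lebesgue_on {0..})"
    and ae: "AE t in lebesgue. t \<in> {0..} \<longrightarrow> (y t, \<alpha> t) \<in> M_set N e A"
    by (auto simp: trajectories_def Linf_loc_def AE_restrict_space_iff)
  have "D y \<alpha> absolutely_integrable_on {0..t}" for t
  proof (rule bounded_measurable_absolutely_integrable)
    have m': "(\<lambda>t. (y t, \<alpha> t)) \<in> borel_measurable (lebesgue_on {0..t})"
      by (rule measurable_restrict_mono[OF m]) auto
    have ae': "AE s in lebesgue_on {0..t}. (y s, \<alpha> s) \<in> M_set N e A"
      using ae by (auto simp: AE_restrict_space_iff elim!: AE_mp)
    show "D y \<alpha> \<in> borel_measurable (lebesgue_on {0..t})"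
      using measurable_comp_continuous_AE[OF continuous_dynamics closed_M_set m' _ ae'] by simp
    show "AE s in lebesgue_on {0..t}. norm (D y \<alpha> s) \<le> Mf"
      using ae' dynamics_bound by (auto elim!: AE_mp)
  qed
  then have "(LINT s:{0..t}|lebesgue. D y \<alpha> s) = integral {0..t} (D y \<alpha>)" for t
    by (rule set_lebesgue_integral_eq_integral)
  then show "admissible {0..} x y \<alpha>"
    unfolding admissible_def using m ae t by (auto simp: trajectories_def)
next
  assume a: "admissible {0..} x y \<alpha>"
  have "(LINT s:{0..t}|lebesgue. D y \<alpha> s) = integral {0..t} (D y \<alpha>)" for t
    by (rule set_lebesgue_integral_eq_integral[OF admissible_integrable(1)[OF a]]) auto
  then have 1: "\<forall>t\<ge>0. y t = x + (LINT s:{0..t}|lebesgue. D y \<alpha> s)" "\<forall>t\<ge>0. y t \<in> S"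
    using admissibleD(3,4)[OF a] by auto
  have lip: "Mf-lipschitz_on {0..} y" by (rule admissible_lipschitz[OF a]) auto
  have "\<exists>z C. AE t in lebesgue_on {0..T}. dist z (y t, \<alpha> t) \<le> C" if T: "T > 0" for T
  proof -
    have "bounded (y ` {0..T})"
      by (intro compact_imp_bounded compact_continuous_image continuous_on_subset[OF lipschitz_on_continuous_on[OF lip]]) auto
    moreover have "bounded (\<Union>i\<in>{1..N}. A i)"
      by (intro bounded_UN ballI compact_imp_bounded A_compact) auto
    ultimately have "bounded (y ` {0..T} \<times> (\<Union>i\<in>{1..N}. A i))" by (rule bounded_Times)
    then obtain z C where C: "\<And>p. p \<in> y ` {0..T} \<times> (\<Union>i\<in>{1..N}. A i) \<Longrightarrow> dist z p \<le> C"
      unfolding bounded_def by blast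
    have "AE t in lebesgue_on {0..T}. (y t, \<alpha> t) \<in> M_set N e A"
      by (rule admissible_AE[OF admissible_mono[OF a]]) auto
    then have "AE t in lebesgue_on {0..T}. t \<in> {0..T} \<and> (y t, \<alpha> t) \<in> M_set N e A"
      using AE_space by eventually_elim simp
    then have "AE t in lebesgue_on {0..T}. dist z (y t, \<alpha> t) \<le> C"
      by eventually_elim (intro C, auto simp: M_set_eq)
    then show ?thesis by blast
  qed
  then have "(\<lambda>t. (y t, \<alpha> t)) \<in> Linf_loc (M_set N e A)"
    using admissibleD(1)[OF a] admissible_AE[OF a] by (auto simp: Linf_loc_def)
  then show "(y, \<alpha>) \<in> trajectories N e A f x"
    using 1 lip by (auto simp: trajectories_def)
qed

section \<open>Shifting and concatenating trajectories\<close>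

lemma admissible_shift:
  assumes a: "admissible {0..} x y \<alpha>" and T: "0 \<le> T"
  shows "admissible {0..} (y T) (\<lambda>t. y (t + T)) (\<lambda>t. \<alpha> (t + T))"
  unfolding admissible_def
proof (intro conjI ballI)
  have "(\<lambda>t. (y t, \<alpha> t)) \<in> borel_measurable (lebesgue_on {0..})" using a by (simp add: admissible_def)
  then show "(\<lambda>t. (y (t + T), \<alpha> (t + T))) \<in> borel_measurable (lebesgue_on {0..})"
    by (rule measurable_lebesgue_on_translation) (use T in auto)
  have "AE t in lebesgue. t + T \<in> {0..} \<longrightarrow> (y (t + T), \<alpha> (t + T)) \<in> M_set N e A"
    by (rule AE_lebesgue_translation) (rule admissibleD(2)[OF a])
  then show "AE t in lebesgue. t \<in> {0..} \<longrightarrow> (y (t + T), \<alpha> (t + T)) \<in> M_set N e A"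
    by eventually_elim (use T in auto)
  fix t :: real assume t: "t \<in> {0..}"
  then show "y (t + T) \<in> S" using T by (auto intro!: admissibleD(3)[OF a])
  have "D y \<alpha> integrable_on {T..t + T}"
    by (rule set_lebesgue_integral_eq_integral(1)[OF admissible_integrable(1)[OF a]]) (use T in auto)
  from integrable_integral[OF this]
  have "(D y \<alpha> has_integral integral {T..t + T} (D y \<alpha>)) {0 + T..t + T}" by simp
  then have "((D y \<alpha> \<circ> (+) T) has_integral integral {T..t + T} (D y \<alpha>)) {0..t}"
    by (simp only: has_integral_shift_Icc_real)
  then have "integral {0..t} (D (\<lambda>t. y (t + T)) (\<lambda>t. \<alpha> (t + T))) = integral {T..t + T} (D y \<alpha>)"
    by (intro integral_unique) (simp add: o_def add.commute)
  also have "\<dots> = y (t + T) - y T"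
    by (rule admissible_increment(1)[OF a, symmetric]) (use T t in auto)
  finally show "y (t + T) = y T + integral {0..t} (D (\<lambda>t. y (t + T)) (\<lambda>t. \<alpha> (t + T)))" by simp
qed

lemma admissible_concat:
  assumes a: "admissible {0..T} x y \<alpha>" and T: "0 \<le> T" and b: "admissible {0..} (y T) z \<beta>"
  shows "admissible {0..} x (\<lambda>t. if t < T then y t else z (t - T)) (\<lambda>t. if t < T then \<alpha> t else \<beta> (t - T))"
    (is "admissible _ x ?y ?\<alpha>")
  unfolding admissible_def
proof (intro conjI ballI)
  show "(\<lambda>t. (?y t, ?\<alpha> t)) \<in> borel_measurable (lebesgue_on {0..})"
  proof (rule measurable_piecewise_restrict[of "{{0..<T}, {T..}}"])
    have sub: "\<Omega> \<subseteq> {0..}" "\<Omega> \<in> sets lebesgue" if "\<Omega> \<in> {{0..<T}, {T..}}" for \<Omega>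
      using that T by auto
    show "\<Omega> \<inter> space (lebesgue_on {0..}) \<in> sets (lebesgue_on {0..})" if "\<Omega> \<in> {{0..<T}, {T..}}" for \<Omega>
      using sub[OF that] by (simp add: sets_restrict_space_iff Int_absorb2)
    show "(\<lambda>t. (?y t, ?\<alpha> t)) \<in> borel_measurable (restrict_space (lebesgue_on {0..}) \<Omega>)"
      if "\<Omega> \<in> {{0..<T}, {T..}}" for \<Omega>
    proof -
      have r: "restrict_space (lebesgue_on {0..}) \<Omega> = lebesgue_on \<Omega>"
        using sub[OF that] by (simp add: restrict_restrict_space Int_absorb1)
      consider "\<Omega> = {0..<T}" | "\<Omega> = {T..}" using \<open>\<Omega> \<in> {{0..<T}, {T..}}\<close> by blast
      then show ?thesis
      proof cases
        case 1
        have "(\<lambda>t. (y t, \<alpha> t)) \<in> borel_measurable (lebesgue_on {0..<T})"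
          by (rule admissibleD(1)[OF admissible_mono[OF a]]) auto
        moreover have "(\<lambda>t. (?y t, ?\<alpha> t)) \<in> borel_measurable (lebesgue_on {0..<T}) \<longleftrightarrow>
            (\<lambda>t. (y t, \<alpha> t)) \<in> borel_measurable (lebesgue_on {0..<T})"
          by (rule measurable_cong) simp
        ultimately show ?thesis using r 1 by simp
      next
        case 2
        have "(\<lambda>t. (z t, \<beta> t)) \<in> borel_measurable (lebesgue_on {0..})"
          using b by (auto simp: admissible_def)
        then have "(\<lambda>t. (z (t + (- T)), \<beta> (t + (- T)))) \<in> borel_measurable (lebesgue_on {T..})"
          by (rule measurable_lebesgue_on_translation) auto
        moreover have "(\<lambda>t. (?y t, ?\<alpha> t)) \<in> borel_measurable (lebesgue_on {T..}) \<longleftrightarrow>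
            (\<lambda>t. (z (t + (- T)), \<beta> (t + (- T)))) \<in> borel_measurable (lebesgue_on {T..})"
          by (rule measurable_cong) simp
        ultimately show ?thesis using r 2 by simp
      qed
    qed
  qed auto
  have "AE t in lebesgue. t \<in> {0..T} \<longrightarrow> (y t, \<alpha> t) \<in> M_set N e A" by (rule admissibleD(2)[OF a])
  moreover have "AE t in lebesgue. t + (- T) \<in> {0..} \<longrightarrow> (z (t + (- T)), \<beta> (t + (- T))) \<in> M_set N e A"
    by (rule AE_lebesgue_translation) (rule admissibleD(2)[OF b])
  ultimately show "AE t in lebesgue. t \<in> {0..} \<longrightarrow> (?y t, ?\<alpha> t) \<in> M_set N e A"
    by eventually_elim auto
  fix t :: real assume t: "t \<in> {0..}"
  have I1: "integral {0..s} (D ?y ?\<alpha>) = integral {0..s} (D y \<alpha>)" if "s \<le> T" for s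
    by (rule integral_spike[of "{T}"]) (use that in auto)
  show "?y t \<in> S" using t admissibleD(3)[OF a, of t] admissibleD(3)[OF b, of "t - T"] by auto
  show "?y t = x + integral {0..t} (D ?y ?\<alpha>)"
  proof (cases "t < T")
    case True
    then show ?thesis using I1[of t] admissibleD(4)[OF a, of t] t by auto
  next
    case False
    have "D z \<beta> integrable_on {0..t - T}"
      by (rule set_lebesgue_integral_eq_integral(1)[OF admissible_integrable(1)[OF b]]) auto
    then have "(D z \<beta> has_integral integral {0..t - T} (D z \<beta>)) {0..t - T}" by blast
    then have "((D ?y ?\<alpha> \<circ> (+) T) has_integral integral {0..t - T} (D z \<beta>)) {0..t - T}"
      by (rule has_integral_eq[rotated]) auto
    then have i2: "(D ?y ?\<alpha> has_integral integral {0..t - T} (D z \<beta>)) {T..t}"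
      unfolding has_integral_shift_Icc_real by simp
    have "D y \<alpha> integrable_on {0..T}"
      by (rule set_lebesgue_integral_eq_integral(1)[OF admissible_integrable(1)[OF a]]) auto
    then have "(D y \<alpha> has_integral integral {0..T} (D y \<alpha>)) {0..T}" by blast
    then have i1: "(D ?y ?\<alpha> has_integral integral {0..T} (D y \<alpha>)) {0..T}"
      by (rule has_integral_spike[of "{T}", rotated 2]) auto
    have "integral {0..t} (D ?y ?\<alpha>) = integral {0..T} (D y \<alpha>) + integral {0..t - T} (D z \<beta>)"
      by (rule integral_unique[OF has_integral_combine[OF _ _ i1 i2]]) (use T False in auto)
    moreover have "z (t - T) = y T + integral {0..t - T} (D z \<beta>)" "y T = x + integral {0..T} (D y \<alpha>)"
      using T False by (auto intro!: admissibleD(4)[OF a] admissibleD(4)[OF b])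
    ultimately show ?thesis using False by (simp add: algebra_simps)
  qed
qed


section \<open>The value function and dynamic programming\<close>

lemma discount_integrable: "(\<lambda>t. exp (- lam * t)) absolutely_integrable_on {0..}"
  and discount_integral: "(LINT t:{0..}|lebesgue. exp (- lam * t)) = 1 / lam"
proof -
  have h: "((\<lambda>t. exp (- lam * t)) has_integral exp (- lam * 0) / lam) {0..}"
    using has_integral_exp_minus_to_infinity[OF lam, of 0] by simp
  then show 1: "(\<lambda>t. exp (- lam * t)) absolutely_integrable_on {0..}"
    by (intro nonnegative_absolutely_integrable_1) auto
  show "(LINT t:{0..}|lebesgue. exp (- lam * t)) = 1 / lam"
    using set_lebesgue_integral_eq_integral(2)[OF 1] integral_unique[OF h] by simp
qed

lemma cost_integrand_integrable:
  assumes a: "admissible {0..} x y \<alpha>"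
  shows "(\<lambda>t. R y \<alpha> t * exp (- lam * t)) absolutely_integrable_on {0..}"
proof -
  have "integrable (lebesgue_on {0..}) (\<lambda>t. R y \<alpha> t * exp (- lam * t))"
  proof (rule Bochner_Integration.integrable_bound)
    show "integrable (lebesgue_on {0..}) (\<lambda>t. Ml * exp (- lam * t))"
      using discount_integrable by (simp add: integrable_restrict_space set_integrable_def)
    show "(\<lambda>t. R y \<alpha> t * exp (- lam * t)) \<in> borel_measurable (lebesgue_on {0..})"
      by (intro borel_measurable_times admissible_measurable(2)[OF a]
          continuous_imp_measurable_on_sets_lebesgue continuous_intros) auto
    show "AE t in lebesgue_on {0..}. norm (R y \<alpha> t * exp (- lam * t)) \<le> norm (Ml * exp (- lam * t))"
      using admissible_bound(2)[OF a] Ml by (auto simp: abs_mult elim!: AE_mp)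
  qed
  then show ?thesis by (simp add: integrable_restrict_space set_integrable_def)
qed

lemma cost_bound:
  assumes a: "admissible {0..} x y \<alpha>"
  shows "\<bar>cost N e A l lam (y, \<alpha>)\<bar> \<le> Ml / lam"
proof -
  have "\<bar>cost N e A l lam (y, \<alpha>)\<bar> \<le> (LINT t:{0..}|lebesgue. norm (R y \<alpha> t * exp (- lam * t)))"
    using set_integral_norm_bound[OF cost_integrand_integrable[OF a]] by (simp add: cost_def)
  also have "\<dots> \<le> (LINT t:{0..}|lebesgue. Ml * exp (- lam * t))"
  proof (rule set_integral_mono_AE)
    show "set_integrable lebesgue {0..} (\<lambda>t. norm (R y \<alpha> t * exp (- lam * t)))"
      by (rule set_integrable_norm[OF cost_integrand_integrable[OF a]])
    show "set_integrable lebesgue {0..} (\<lambda>t. Ml * exp (- lam * t))"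
      using discount_integrable by (rule set_integrable_mult_right)
    have "AE t in lebesgue. t \<in> {0..} \<longrightarrow> \<bar>R y \<alpha> t\<bar> \<le> Ml"
      using admissible_bound(2)[OF a] by (simp add: AE_restrict_space_iff)
    then show "AE t\<in>{0..} in lebesgue. norm (R y \<alpha> t * exp (- lam * t)) \<le> Ml * exp (- lam * t)"
      by eventually_elim (auto simp: abs_mult)
  qed
  also have "\<dots> = Ml / lam" using discount_integral by simp
  finally show ?thesis .
qed

lemma discounted_integrable:
  assumes a: "admissible {0..T} x y \<alpha>"
  shows "(\<lambda>t. R y \<alpha> t * exp (- lam * t)) absolutely_integrable_on {0..T}"
    and "(\<lambda>t. R y \<alpha> t * exp (- lam * t)) \<in> borel_measurable (lebesgue_on {0..T})"
    and "AE t in lebesgue_on {0..T}. norm (R y \<alpha> t * exp (- lam * t)) \<le> Ml"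
proof -
  have sT: "{0..T} \<in> sets lebesgue" by simp
  show m: "(\<lambda>t. R y \<alpha> t * exp (- lam * t)) \<in> borel_measurable (lebesgue_on {0..T})"
    by (intro borel_measurable_times admissible_measurable(2)[OF a]
        continuous_imp_measurable_on_sets_lebesgue continuous_intros) auto
  have "AE t in lebesgue_on {0..T}. \<bar>R y \<alpha> t\<bar> \<le> Ml \<and> t \<in> {0..T}"
    using admissible_bound(2)[OF a sT] AE_space by eventually_elim simp
  then show b: "AE t in lebesgue_on {0..T}. norm (R y \<alpha> t * exp (- lam * t)) \<le> Ml"
  proof eventually_elim
    case (elim t)
    then have "\<bar>R y \<alpha> t\<bar> * exp (- lam * t) \<le> Ml * 1" using lam by (intro mult_mono) auto
    then show ?case by (simp add: abs_mult)
  qed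
  show "(\<lambda>t. R y \<alpha> t * exp (- lam * t)) absolutely_integrable_on {0..T}"
    by (rule bounded_measurable_absolutely_integrable[OF m b])
qed

lemma J_bound:
  assumes a: "admissible {0..T} x y \<alpha>" and T: "0 \<le> T"
  shows "\<bar>J T y \<alpha>\<bar> \<le> Ml * T"
  using AE_norm_integral_le[OF discounted_integrable(2)[OF a] T discounted_integrable(3)[OF a]]
  by (simp add: J_def)

lemma cost_split:
  assumes a: "admissible {0..} x y \<alpha>" and T: "0 \<le> T"
  shows "cost N e A l lam (y, \<alpha>)
    = J T y \<alpha> + exp (- lam * T) * cost N e A l lam (\<lambda>t. y (t + T), \<lambda>t. \<alpha> (t + T))"
proof -
  let ?g = "\<lambda>t. R y \<alpha> t * exp (- lam * t)"
  have g: "?g absolutely_integrable_on {0..}" by (rule cost_integrand_integrable[OF a])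
  have gT: "?g absolutely_integrable_on {T..}" by (rule set_integrable_subset[OF g]) (use T in auto)
  have g0: "?g absolutely_integrable_on {0..T}" by (rule set_integrable_subset[OF g]) (use T in auto)
  have "(?g has_integral (J T y \<alpha> + (LINT t:{T..}|lebesgue. ?g t))) ({0..T} \<union> {T..})"
  proof (rule has_integral_Un)
    show "(?g has_integral J T y \<alpha>) {0..T}" unfolding J_def
      by (rule integrable_integral[OF set_lebesgue_integral_eq_integral(1)[OF g0]])
    show "(?g has_integral (LINT t:{T..}|lebesgue. ?g t)) {T..}" by (rule has_integral_set_lebesgue[OF gT])
    have "{0..T} \<inter> {T..} \<subseteq> {T}" by auto
    then show "negligible ({0..T} \<inter> {T..})" by (rule negligible_subset[OF negligible_sing])
  qed
  moreover have "{0..T} \<union> {T..} = {0..}" using T by auto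
  ultimately have 1: "cost N e A l lam (y, \<alpha>) = J T y \<alpha> + (LINT t:{T..}|lebesgue. ?g t)"
    using integral_unique set_lebesgue_integral_eq_integral(2)[OF g] by (simp add: cost_def)
  have "(LINT t:{T..}|lebesgue. ?g t) = (LINT t|lebesgue. indicator {T..} (T + 1 * t) *\<^sub>R ?g (T + 1 * t))"
    unfolding set_lebesgue_integral_def
    using lebesgue_integral_real_affine[of 1 "\<lambda>t. indicator {T..} t *\<^sub>R ?g t" T] by simp
  also have "\<dots> = (LINT t|lebesgue. indicator {0..} t *\<^sub>R
      (exp (- lam * T) * (R (\<lambda>t. y (t + T)) (\<lambda>t. \<alpha> (t + T)) t * exp (- lam * t))))"
  proof (rule Bochner_Integration.integral_cong)
    fix t :: real
    have "exp (- lam * (T + 1 * t)) = exp (- lam * T) * exp (- lam * t)"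
      by (simp add: exp_add[symmetric] algebra_simps)
    then show "indicator {T..} (T + 1 * t) *\<^sub>R ?g (T + 1 * t) = indicator {0..} t *\<^sub>R
      (exp (- lam * T) * (R (\<lambda>t. y (t + T)) (\<lambda>t. \<alpha> (t + T)) t * exp (- lam * t)))"
      by (simp only:) (auto simp: indicator_def add.commute)
  qed simp
  also have "\<dots> = exp (- lam * T) * cost N e A l lam (\<lambda>t. y (t + T), \<lambda>t. \<alpha> (t + T))"
    unfolding cost_def prod.case set_lebesgue_integral_def[symmetric] by (rule set_integral_mult_right)
  finally show ?thesis using 1 by simp
qed

lemma cost_concat:
  assumes a: "admissible {0..T} x y \<alpha>" and T: "0 \<le> T" and b: "admissible {0..} (y T) z \<beta>"
  shows "cost N e A l lam (\<lambda>t. if t < T then y t else z (t - T), \<lambda>t. if t < T then \<alpha> t else \<beta> (t - T))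
    = J T y \<alpha> + exp (- lam * T) * cost N e A l lam (z, \<beta>)"
proof -
  let ?y = "\<lambda>t. if t < T then y t else z (t - T)" and ?\<alpha> = "\<lambda>t. if t < T then \<alpha> t else \<beta> (t - T)"
  have "J T ?y ?\<alpha> = J T y \<alpha>" unfolding J_def by (rule integral_spike[of "{T}"]) auto
  moreover have "cost N e A l lam (\<lambda>t. ?y (t + T), \<lambda>t. ?\<alpha> (t + T)) = cost N e A l lam (z, \<beta>)"
    unfolding cost_def prod.case by (rule set_lebesgue_integral_cong) auto
  ultimately show ?thesis using cost_split[OF admissible_concat[OF a T b] T] by simp
qed

section \<open>Dynamics driven inside a single half-plane\<close>

lemma halfplane_pair_measurable:
  fixes y :: "real \<Rightarrow> real ^ 3"
  assumes i: "i \<in> {1..N}" and y: "continuous_on X y" and X: "X \<in> sets lebesgue"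
    and \<alpha>: "\<alpha> \<in> borel_measurable (lebesgue_on X)" "\<And>t. t \<in> X \<Longrightarrow> \<alpha> t \<in> A i"
  shows "(\<lambda>t. (y t, \<alpha> t)) \<in> borel_measurable (lebesgue_on X)"
  by (rule borel_measurable_Pair_compact[OF _ \<alpha>(1) A_compact[OF i]])
    (use \<alpha>(2) continuous_imp_measurable_on_sets_lebesgue[OF y X] in auto)

text \<open>Projection onto the closed convex set \<open>P i\<close> does not increase distances, so
  the projected field is bounded and Lipschitz on all of space. Its solution obeys the original
  dynamics as long as it remains in \<open>P i\<close>, but it may leave it.\<close>

lemma halfplane_ode:
  fixes \<alpha> :: "real \<Rightarrow> 'a"
  assumes i: "i \<in> {1..N}" and x: "x \<in> P i"
    and \<alpha>: "\<alpha> \<in> borel_measurable (lebesgue_on {0..})" "\<And>t. t \<ge> 0 \<Longrightarrow> \<alpha> t \<in> A i"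
  shows "\<exists>y. continuous_on UNIV y \<and> (\<forall>t\<ge>0. y t \<in> plane e i) \<and>
    (\<forall>t\<ge>0. y t = x + integral {0..t} (\<lambda>s. f i (closest_point (P i) (y s)) (\<alpha> s)))"
proof -
  define \<pi> where "\<pi> = closest_point (P i)"
  have \<pi>: "\<pi> z \<in> P i" for z
    unfolding \<pi>_def by (rule closest_point_in_set[OF closed_halfplane[OF i] halfplane_ne])
  have \<pi>lip: "norm (\<pi> z - \<pi> w) \<le> norm (z - w)" for z w
    using closest_point_lipschitz[OF convex_halfplane closed_halfplane[OF i] halfplane_ne, of z w]
    by (simp add: \<pi>_def dist_norm)
  have \<pi>cont: "continuous_on UNIV \<pi>"
    unfolding \<pi>_def by (rule continuous_on_closest_point[OF convex_halfplane closed_halfplane[OF i] halfplane_ne])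
  define F where "F = (\<lambda>t z. f i (\<pi> z) (\<alpha> t))"
  have lip: "norm (F t z - F t w) \<le> L * norm (z - w)" if "t \<ge> 0" for t z w
  proof -
    have "norm (F t z - F t w) \<le> L * norm (\<pi> z - \<pi> w)"
      unfolding F_def by (rule f_lip[OF i \<pi> \<pi> \<alpha>(2)[OF that]])
    also have "\<dots> \<le> L * norm (z - w)" using \<pi>lip L by (intro mult_left_mono) auto
    finally show ?thesis .
  qed
  have bd: "norm (F t z) \<le> Mf" if "t \<ge> 0" for t z
    unfolding F_def by (rule f_bd[OF i \<pi> \<alpha>(2)[OF that]])
  have meas: "(\<lambda>t. F t (y t)) \<in> borel_measurable (lebesgue_on {0..})" if y: "continuous_on UNIV y" for y
  proof -
    have "continuous_on {0..} (\<lambda>t. \<pi> (y t))"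
      by (intro continuous_on_compose2[OF \<pi>cont] continuous_on_subset[OF y]) auto
    then have "(\<lambda>t. (\<pi> (y t), \<alpha> t)) \<in> borel_measurable (lebesgue_on {0..})"
      by (rule halfplane_pair_measurable[OF i _ _ \<alpha>(1)]) (use \<alpha>(2) in auto)
    note m = this
    have "(\<lambda>t. case (\<pi> (y t), \<alpha> t) of (x, a) \<Rightarrow> f i x a) \<in> borel_measurable (lebesgue_on {0..})"
      by (rule measurable_comp_continuous_AE[OF f_cont[OF i] _ m])
        (use \<pi> \<alpha>(2) closed_halfplane[OF i] compact_imp_closed[OF A_compact[OF i]] in \<open>auto intro!: closed_Times AE_I2\<close>)
    then show ?thesis by (simp add: F_def)
  qed
  have int: "(\<lambda>s. F s (y s)) integrable_on {0..t}" if y: "continuous_on UNIV y" for y t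
  proof (rule set_lebesgue_integral_eq_integral(1)[OF bounded_measurable_absolutely_integrable])
    show "(\<lambda>s. F s (y s)) \<in> borel_measurable (lebesgue_on {0..t})"
      by (rule measurable_restrict_mono[OF meas[OF y]]) auto
    show "AE s in lebesgue_on {0..t}. norm (F s (y s)) \<le> Mf" by (rule AE_I2) (auto intro: bd)
  qed
  obtain y where y: "continuous_on UNIV y" "\<And>t. t \<ge> 0 \<Longrightarrow> y t = x + integral {0..t} (\<lambda>s. F s (y s))"
    using caratheodory_ode_exists[of L F Mf x] L lip bd meas by blast
  have "y t \<in> plane e i" if t: "t \<ge> 0" for t
  proof -
    \<comment> \<open>The component orthogonal to the plane. It is linear, commutes with the
      integral and annihilates every admissible velocity.\<close>
    define Q where "Q = (\<lambda>w::real^3. w - (w \<bullet> e 0) *\<^sub>R e 0 - (w \<bullet> e i) *\<^sub>R e i)"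
    have bl: "bounded_linear Q" unfolding Q_def
      by (intro bounded_linear_sub bounded_linear_ident bounded_linear_scaleR_left[THEN bounded_linear_compose]
          bounded_linear_inner_left)
    have Qpl: "w \<in> plane e i \<longleftrightarrow> Q w = 0" for w
      unfolding plane_iff[OF i] Q_def by (auto simp: algebra_simps)
    have "Q (integral {0..t} (\<lambda>s. F s (y s))) = integral {0..t} (Q \<circ> (\<lambda>s. F s (y s)))"
      by (rule integral_linear[OF int[OF y(1)] bl, symmetric])
    also have "\<dots> = integral {0..t} (\<lambda>s. 0)"
      by (rule integral_cong) (use f_plane[OF i \<pi> \<alpha>(2)] Qpl in \<open>auto simp: F_def\<close>)
    finally have "integral {0..t} (\<lambda>s. F s (y s)) \<in> plane e i" using Qpl by simp
    moreover have "x \<in> plane e i" using x halfplane_iff_plane[OF i] by simp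
    ultimately show ?thesis using y(2)[OF t] by (simp add: subspace_add)
  qed
  with y show ?thesis unfolding F_def \<pi>_def by blast
qed

lemma admissible_halfplane:
  assumes i: "i \<in> {1..N}" and X: "\<And>t. t \<in> X \<Longrightarrow> {0..t} \<subseteq> X" "X \<in> sets lebesgue"
    and y: "continuous_on X y" "\<And>t. t \<in> X \<Longrightarrow> y t \<in> P i"
    and \<alpha>: "\<alpha> \<in> borel_measurable (lebesgue_on X)" "\<And>t. t \<in> X \<Longrightarrow> \<alpha> t \<in> A i"
    and eq: "\<And>t. t \<in> X \<Longrightarrow> y t = x + integral {0..t} (\<lambda>s. f i (y s) (\<alpha> s))"
  shows "admissible X x y \<alpha>"
  unfolding admissible_def
proof (intro conjI ballI)
  show "(\<lambda>t. (y t, \<alpha> t)) \<in> borel_measurable (lebesgue_on X)"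
    by (rule halfplane_pair_measurable[OF i y(1) X(2) \<alpha>])
  show "AE t in lebesgue. t \<in> X \<longrightarrow> (y t, \<alpha> t) \<in> M_set N e A"
    by (rule AE_I2) (use i y(2) \<alpha>(2) M_set_iff in blast)
  fix t assume t: "t \<in> X"
  show "y t \<in> S" using y(2)[OF t] i network_iff by blast
  have "integral {0..t} (D y \<alpha>) = integral {0..t} (\<lambda>s. f i (y s) (\<alpha> s))"
    by (rule integral_cong) (use X(1)[OF t] y(2) \<alpha>(2) in \<open>auto intro!: dynamics_eq[OF i]\<close>)
  then show "y t = x + integral {0..t} (D y \<alpha>)" using eq[OF t] by simp
qed

text \<open>Zero lies in the ball of velocities given by [H3], so some constant control keeps the
  state at rest.\<close>

lemma stay_on_interface:
  assumes z: "z \<in> \<Gamma>"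
  obtains \<alpha> where "admissible {0..} z (\<lambda>_. z) \<alpha>"
proof -
  have i: "1 \<in> {1..N}" using N_gt_1 by simp
  have "(0::real^3) \<in> ball 0 \<delta> \<inter> plane e 1" using delta by (auto intro: subspace_0)
  then obtain a where a: "a \<in> A 1" "f 1 z a = 0" using ball_subset[OF i z] by force
  have "admissible {0..} z (\<lambda>_. z) (\<lambda>_. a)"
    by (rule admissible_halfplane[OF i]) (use a interface_subset_halfplane(1)[OF i z] in auto)
  then show thesis by (rule that)
qed

text \<open>A constant control is run until its solution first reaches \<Gamma>, if ever; from there
  the state can rest.\<close>

lemma trajectory_exists:
  assumes x: "x \<in> S"
  shows "\<exists>y \<alpha>. admissible {0..} x y \<alpha>"
proof -
  obtain i where i: "i \<in> {1..N}" "x \<in> P i" using x network_iff by blast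
  obtain a where a: "a \<in> A i" using A_ne[OF i(1)] by blast
  have m: "(\<lambda>_::real. a) \<in> borel_measurable (lebesgue_on {0..})" by simp
  have aA: "\<And>t::real. 0 \<le> t \<Longrightarrow> a \<in> A i" using a .
  obtain y :: "real \<Rightarrow> real ^ 3" where y: "continuous_on UNIV y" "\<And>t. t \<ge> 0 \<Longrightarrow> y t \<in> plane e i"
    "\<And>t. t \<ge> 0 \<Longrightarrow> y t = x + integral {0..t} (\<lambda>s. f i (closest_point (P i) (y s)) a)"
    using halfplane_ode[OF i m aA] by blast
  have adm: "admissible X x y (\<lambda>_. a)"
    if "\<And>t. t \<in> X \<Longrightarrow> {0..t} \<subseteq> X" "X \<in> sets lebesgue" "\<And>t. t \<in> X \<Longrightarrow> t \<ge> 0 \<and> y t \<bullet> e i \<ge> 0" for X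
  proof (rule admissible_halfplane[OF i(1) that(1,2)])
    have PX: "y t \<in> P i" if "t \<in> X" for t
      using \<open>\<And>t. t \<in> X \<Longrightarrow> t \<ge> 0 \<and> y t \<bullet> e i \<ge> 0\<close>[OF that] y(2) halfplane_iff_plane[OF i(1)] by auto
    then show "\<And>t. t \<in> X \<Longrightarrow> y t \<in> P i" .
    fix t assume t: "t \<in> X"
    have "integral {0..t} (\<lambda>s. f i (closest_point (P i) (y s)) a) = integral {0..t} (\<lambda>s. f i (y s) a)"
      by (rule integral_cong) (use PX that(1)[OF t] in \<open>auto simp: closest_point_self\<close>)
    then show "y t = x + integral {0..t} (\<lambda>s. f i (y s) a)" using y(3) that(3)[OF t] by simp
  qed (use a y(1) in \<open>auto intro: continuous_on_subset\<close>)
  have y0: "y 0 = x" using y(3)[of 0] by simp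
  have "continuous_on {0..} (\<lambda>t. y t \<bullet> e i)" by (intro continuous_intros continuous_on_subset[OF y(1)]) auto
  moreover have "y 0 \<bullet> e i \<ge> 0" using y0 i halfplane_iff_plane by auto
  ultimately show ?thesis
  proof (cases rule: first_hit)
    case 1
    then have "admissible {0..} x y (\<lambda>_. a)" by (intro adm) (auto simp: less_imp_le)
    then show ?thesis by blast
  next
    case (2 \<sigma>)
    have nn: "y t \<bullet> e i \<ge> 0" if "t \<in> {0..\<sigma>}" for t
      using 2(2) 2(3)[of t] that by (cases "t = \<sigma>") (auto simp: less_imp_le)
    then have ad: "admissible {0..\<sigma>} x y (\<lambda>_. a)" by (intro adm) auto
    have "y \<sigma> \<in> P i" using y(2)[OF 2(1)] 2(2) halfplane_iff_plane[OF i(1)] by simp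
    then have "y \<sigma> \<in> \<Gamma>" using interface_iff_halfplane[OF i(1)] 2(2) by simp
    from stay_on_interface[OF this] obtain \<beta> where "admissible {0..} (y \<sigma>) (\<lambda>_. y \<sigma>) \<beta>" .
    from admissible_concat[OF ad 2(1) this] show ?thesis by blast
  qed
qed

text \<open>A real infimum, convenient for estimates. It agrees with the extended real value
  function on \<open>S\<close>, where the costs form a non-empty bounded set.\<close>

definition v :: "real ^ 3 \<Rightarrow> real" where
  "v x = Inf (cost N e A l lam ` trajectories N e A f x)"

lemma cost_set_bounds:
  assumes x: "x \<in> S"
  shows "trajectories N e A f x \<noteq> {}"
    and "\<And>c. c \<in> cost N e A l lam ` trajectories N e A f x \<Longrightarrow> \<bar>c\<bar> \<le> Ml / lam"
    and "bdd_below (cost N e A l lam ` trajectories N e A f x)"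
proof -
  show "trajectories N e A f x \<noteq> {}"
    using trajectory_exists[OF x] by (auto simp flip: trajectories_iff)
  show b: "\<And>c. c \<in> cost N e A l lam ` trajectories N e A f x \<Longrightarrow> \<bar>c\<bar> \<le> Ml / lam"
    using cost_bound by (auto simp: trajectories_iff)
  show "bdd_below (cost N e A l lam ` trajectories N e A f x)"
    using b by (intro bdd_belowI[of _ "- (Ml / lam)"]) (fastforce simp: abs_le_iff)
qed

lemma value_function_eq:
  assumes x: "x \<in> S"
  shows "value_function N e A f l lam x = ereal (v x)"
  unfolding value_function_def v_def
  using ereal_Inf'[OF cost_set_bounds(3)[OF x]] cost_set_bounds(1)[OF x] by (simp add: image_comp o_def)

lemma v_bound:
  assumes x: "x \<in> S"
  shows "\<bar>v x\<bar> \<le> Ml / lam"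
proof -
  have "v x \<le> Ml / lam" unfolding v_def
    using cost_set_bounds[OF x] by (metis abs_le_iff cInf_lower2 empty_iff image_is_empty ex_in_conv)
  moreover have "- (Ml / lam) \<le> v x" unfolding v_def
    by (rule cInf_greatest) (use cost_set_bounds[OF x] in \<open>auto simp: abs_le_iff, fastforce\<close>)
  ultimately show ?thesis by (simp add: abs_le_iff)
qed

lemma v_le_cost: "admissible {0..} x y \<alpha> \<Longrightarrow> v x \<le> cost N e A l lam (y, \<alpha>)"
  unfolding v_def
  by (rule cInf_lower)
    (use cost_set_bounds(3)[of x] admissibleD(3)[of "{0..}" x y \<alpha> 0] admissible_0[of "{0..}" x y \<alpha>]
      in \<open>auto simp: trajectories_iff\<close>)

lemma v_near_optimal:
  assumes x: "x \<in> S" and \<epsilon>: "\<epsilon> > 0"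
  obtains y \<alpha> where "admissible {0..} x y \<alpha>" "cost N e A l lam (y, \<alpha>) < v x + \<epsilon>"
proof -
  have "\<exists>c\<in>cost N e A l lam ` trajectories N e A f x. c < v x + \<epsilon>"
    by (rule cInf_lessD) (use cost_set_bounds(1)[OF x] \<epsilon> in \<open>auto simp: v_def\<close>)
  then show thesis using that by (auto simp: trajectories_iff)
qed

lemma dynamic_programming_le:
  assumes a: "admissible {0..T} x y \<alpha>" and T: "0 \<le> T"
  shows "v x \<le> J T y \<alpha> + exp (- lam * T) * v (y T)"
proof (rule field_le_epsilon)
  fix \<epsilon> :: real assume \<epsilon>: "\<epsilon> > 0"
  have "y T \<in> S" using admissibleD(3)[OF a, of T] T by simp
  then obtain z \<beta> where z: "admissible {0..} (y T) z \<beta>" "cost N e A l lam (z, \<beta>) < v (y T) + \<epsilon>"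
    using v_near_optimal \<epsilon> by blast
  have "v x \<le> J T y \<alpha> + exp (- lam * T) * cost N e A l lam (z, \<beta>)"
    using v_le_cost[OF admissible_concat[OF a T z(1)]] cost_concat[OF a T z(1)] by simp
  also have "\<dots> \<le> J T y \<alpha> + exp (- lam * T) * (v (y T) + \<epsilon>)" using z(2) by simp
  also have "\<dots> = J T y \<alpha> + exp (- lam * T) * v (y T) + exp (- lam * T) * \<epsilon>" by (simp add: algebra_simps)
  also have "exp (- lam * T) * \<epsilon> \<le> \<epsilon>" using lam T \<epsilon> by (simp add: mult_le_cancel_right1)
  finally show "v x \<le> J T y \<alpha> + exp (- lam * T) * v (y T) + \<epsilon>" by simp
qed

text \<open>One trajectory serves all times \<open>T\<close>: any trajectory whose cost is within
  \<epsilon> of the infimum will do. The order of the quantifiers matters when the stopping time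
  depends on the trajectory.\<close>

lemma dynamic_programming_ge:
  assumes x: "x \<in> S" and \<epsilon>: "\<epsilon> > 0"
  obtains y \<alpha> where "admissible {0..} x y \<alpha>"
    "\<forall>T\<ge>0. J T y \<alpha> + exp (- lam * T) * v (y T) \<le> v x + \<epsilon>"
proof -
  obtain y \<alpha> where a: "admissible {0..} x y \<alpha>" "cost N e A l lam (y, \<alpha>) < v x + \<epsilon>"
    by (rule v_near_optimal[OF x \<epsilon>])
  have "J T y \<alpha> + exp (- lam * T) * v (y T) \<le> v x + \<epsilon>" if T: "T \<ge> 0" for T
  proof -
    have "exp (- lam * T) * v (y T)
        \<le> exp (- lam * T) * cost N e A l lam (\<lambda>t. y (t + T), \<lambda>t. \<alpha> (t + T))"
      by (intro mult_left_mono v_le_cost[OF admissible_shift[OF a(1) T]]) auto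
    then show ?thesis using cost_split[OF a(1) T] a(2) by linarith
  qed
  with a(1) show thesis by (intro that) auto
qed


section \<open>Continuity of the value function\<close>

lemma modulus_mono: "0 \<le> r \<Longrightarrow> r \<le> s \<Longrightarrow> \<omega> r \<le> \<omega> s"
  using omega by (auto simp: modulus_of_continuity_def mono_on_def)

lemma modulus_nonneg: "0 \<le> r \<Longrightarrow> 0 \<le> \<omega> r"
  using modulus_mono[of 0 r] omega by (simp add: modulus_of_continuity_def)

section \<open>Controllability near the interface\<close>

lemma f_continuous:
  assumes i: "i \<in> {1..N}" and x: "x \<in> P i"
  shows "continuous_on (A i) (f i x)" "continuous_on (A i) (l i x)"
proof -
  have c: "continuous_on (A i) (\<lambda>a. (x, a))" by (intro continuous_intros)
  show "continuous_on (A i) (f i x)"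
    using continuous_on_compose2[OF f_cont[OF i] c] x by auto
  show "continuous_on (A i) (l i x)"
    using continuous_on_compose2[OF l_cont[OF i] c] x by auto
qed

text \<open>Moving from \<open>a\<close> to \<open>w\<close> displaces each velocity by at most
  \<open>\<delta> / 2\<close>, and the velocity set at \<open>w\<close> is the projection of the
  convex set \<open>FL\<close>; half the radius is therefore preserved.\<close>

lemma ball_subset_near_interface:
  assumes i: "i \<in> {1..N}" and a: "a \<in> \<Gamma>" and w: "w \<in> P i" and d: "L * norm (w - a) \<le> \<delta> / 2"
  shows "ball 0 (\<delta> / 2) \<inter> plane e i \<subseteq> f i w ` A i"
proof (rule ball_Int_subspace_subset_convex[OF subspace_plane])
  have "compact (f i w ` A i)"
    by (rule compact_continuous_image[OF f_continuous(1)[OF i w] A_compact[OF i]])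
  then show "closed (f i w ` A i)" by (rule compact_imp_closed)
  have "f i w ` A i = fst ` FL A f l i w" by (simp add: FL_def image_image)
  then show "convex (f i w ` A i)" using convex_linear_image[OF linear_fst FL_convex[OF i w]] by simp
  show "f i w ` A i \<subseteq> plane e i" using f_plane[OF i w] by auto
  fix u assume u: "u \<in> plane e i" "norm u < \<delta>"
  then have "u \<in> ball 0 \<delta> \<inter> plane e i" by simp
  then obtain c where c: "c \<in> A i" "u = f i a c" using ball_subset[OF i a] by blast
  have "norm (f i w c - u) \<le> \<delta> / 2"
    using f_lip[OF i w interface_subset_halfplane(1)[OF i a] c(1)] d c(2) by simp
  then show "\<exists>k\<in>f i w ` A i. norm (k - u) \<le> \<delta> / 2" using c(1) by blast
qed (rule delta)

text \<open>The whole segment stays in \<open>P i\<close> and within the region around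
  \<open>a\<close> where all velocities of norm below \<open>\<delta> / 2\<close> are available.
  Constant speed \<open>\<delta> / 4\<close> is thus realisable at each time, and a measurable
  selection turns the pointwise controls into an admissible one.\<close>

lemma segment_admissible:
  assumes i: "i \<in> {1..N}" and a: "a \<in> \<Gamma>" and b: "b \<in> P i" "c \<in> P i"
    and d: "L * norm (b - a) \<le> \<delta> / 2" "L * norm (c - a) \<le> \<delta> / 2"
  obtains y \<alpha> where "admissible {0..norm (c - b) / (\<delta> / 4)} b y \<alpha>" "y (norm (c - b) / (\<delta> / 4)) = c"
proof -
  \<comment> \<open>For \<open>b = c\<close> division by zero yields \<open>u = 0\<close> and
    \<open>T = 0\<close>, so the degenerate segment fits the same formulas.\<close>
  define T where "T = norm (c - b) / (\<delta> / 4)"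
  define u where "u = (\<delta> / 4 / norm (c - b)) *\<^sub>R (c - b)"
  define y where "y = (\<lambda>t. b + t *\<^sub>R u)"
  have T0: "T \<ge> 0" unfolding T_def using delta by simp
  have yT: "y T = c" unfolding y_def T_def u_def using delta by (cases "c = b") auto
  have bp: "b \<in> plane e i" "c \<in> plane e i" using b halfplane_iff_plane[OF i] by auto
  have "norm u \<le> \<delta> / 4" unfolding u_def using delta by (cases "c = b") auto
  then have u: "u \<in> ball 0 (\<delta> / 2) \<inter> plane e i"
    using delta bp by (auto simp: u_def intro!: subspace_mul subspace_diff)
  have seg: "y t \<in> P i \<and> L * norm (y t - a) \<le> \<delta> / 2" if t: "t \<in> {0..T}" for t
  proof -
    obtain s where s: "0 \<le> s" "s \<le> 1" "t = s * T"
    proof (cases "T = 0")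
      case True then show thesis using t that[of 0] by auto
    next
      case False then show thesis using t T0 by (intro that[of "t / T"]) (auto simp: field_simps)
    qed
    have ys: "y t = (1 - s) *\<^sub>R b + s *\<^sub>R c"
    proof -
      have "T *\<^sub>R u = c - b" using yT by (simp add: y_def algebra_simps)
      then have "y t = b + s *\<^sub>R (c - b)" unfolding y_def s(3) by (metis scaleR_scaleR)
      then show ?thesis by (simp add: algebra_simps)
    qed
    have "y t \<in> P i" unfolding ys using convex_halfplane[of i] b s by (auto simp: convex_alt)
    moreover have "b \<in> cball a (\<delta> / 2 / L)" "c \<in> cball a (\<delta> / 2 / L)"
      using d L by (auto simp: dist_norm norm_minus_commute field_simps)
    then have "y t \<in> cball a (\<delta> / 2 / L)" unfolding ys using convex_cball[of a "\<delta> / 2 / L"] s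
      by (auto simp: convex_alt simp del: mem_cball)
    then have "L * norm (y t - a) \<le> \<delta> / 2" using L by (auto simp: dist_norm norm_minus_commute field_simps)
    ultimately show ?thesis by simp
  qed
  have cA: "compact (A i)" by (rule A_compact[OF i])
  \<comment> \<open>The compact set of pairs of a time and a control that produces the velocity
    \<open>u\<close> at that time.\<close>
  define G where "G = ({0..T} \<times> A i) \<inter> (\<lambda>(t, a). f i (y t) a) -` {u}"
  have yc: "continuous_on X y" for X unfolding y_def by (intro continuous_intros)
  have "continuous_on ({0..T} \<times> A i) (\<lambda>p. (y (fst p), snd p))"
    by (intro continuous_intros continuous_on_compose2[OF yc[of UNIV]]) auto
  moreover have "(\<lambda>p. (y (fst p), snd p)) ` ({0..T} \<times> A i) \<subseteq> P i \<times> A i" using seg by force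
  ultimately have "continuous_on ({0..T} \<times> A i) (\<lambda>p. case (y (fst p), snd p) of (x, a) \<Rightarrow> f i x a)"
    by (rule continuous_on_compose2[OF f_cont[OF i]])
  then have "continuous_on ({0..T} \<times> A i) (\<lambda>(t, a). f i (y t) a)" by (simp add: case_prod_beta)
  then have "closed G" unfolding G_def
    by (rule continuous_closed_preimage) (auto intro!: closed_Times compact_imp_closed[OF cA])
  moreover have "compact ({0..T} \<times> A i)" by (intro compact_Times cA) auto
  ultimately have "compact ({0..T} \<times> A i \<inter> G)" by (intro compact_Int_closed)
  moreover have "{0..T} \<times> A i \<inter> G = G" unfolding G_def by blast
  ultimately have G: "compact G" by simp
  have ex: "\<exists>a. (t, a) \<in> G" if t: "t \<in> {0..T}" for t
  proof -
    have "u \<in> f i (y t) ` A i" using ball_subset_near_interface[OF i a] seg[OF t] u by blast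
    then show ?thesis using t unfolding G_def by auto
  qed
  then have "G \<noteq> {}" using T0 by (metis atLeastAtMost_iff empty_iff order_refl)
  from measurable_selection[OF G this] obtain \<alpha> where \<alpha>: "\<alpha> \<in> borel_measurable borel"
    "\<And>s. s \<in> fst ` G \<Longrightarrow> (s, \<alpha> s) \<in> G" by metis
  have sel: "\<alpha> t \<in> A i \<and> f i (y t) (\<alpha> t) = u" if t: "t \<in> {0..T}" for t
  proof -
    have "t \<in> fst ` G" using ex[OF t] by force
    from \<alpha>(2)[OF this] show ?thesis unfolding G_def by auto
  qed
  have "admissible {0..T} b y \<alpha>"
  proof (rule admissible_halfplane[OF i])
    show "continuous_on {0..T} y" by (rule yc)
    have "\<alpha> \<in> borel_measurable lebesgue" using \<alpha>(1) by (simp add: measurable_completion)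
    then show "\<alpha> \<in> borel_measurable (lebesgue_on {0..T})" by (rule measurable_restrict_space1)
    fix t assume t: "t \<in> {0..T}"
    have "integral {0..t} (\<lambda>s. f i (y s) (\<alpha> s)) = integral {0..t} (\<lambda>s. u)"
      by (rule integral_cong) (use sel t in auto)
    then show "y t = b + integral {0..t} (\<lambda>s. f i (y s) (\<alpha> s))" using t by (simp add: y_def)
  qed (use seg sel in auto)
  then show thesis using yT unfolding T_def by (rule that)
qed

text \<open>One term \<open>Ml * T\<close> bounds the running cost of the arc. The other bounds the
  loss from discounting \<open>v (y T)\<close>, since the factor differs from 1 by at most
  \<open>lam * T\<close> and \<open>v\<close> is bounded by \<open>Ml / lam\<close>.\<close>

lemma v_le_reach:
  assumes a: "admissible {0..T} x y \<alpha>" and T: "0 \<le> T"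
  shows "v x \<le> v (y T) + 2 * Ml * T"
proof -
  define q where "q = exp (- lam * T)"
  have q: "q \<le> 1" "1 - q \<le> lam * T" unfolding q_def using lam T exp_ge_add_one_self[of "- lam * T"] by auto
  have yS: "y T \<in> S" using admissibleD(3)[OF a, of T] T by simp
  have "(1 - q) * (- v (y T)) \<le> (1 - q) * (Ml / lam)"
    using v_bound[OF yS] q by (intro mult_left_mono) auto
  also have "\<dots> \<le> lam * T * (Ml / lam)"
    using q(2) lam Ml by (intro mult_right_mono) auto
  also have "\<dots> = Ml * T" using lam by simp
  finally have "q * v (y T) \<le> v (y T) + Ml * T" by (simp add: algebra_simps)
  moreover have "v x \<le> J T y \<alpha> + q * v (y T)" unfolding q_def by (rule dynamic_programming_le[OF a T])
  moreover have "J T y \<alpha> \<le> Ml * T" using J_bound[OF a T] by simp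
  ultimately show ?thesis by simp
qed

text \<open>The constant is the rate \<open>2 * Ml\<close> per unit time divided by the speed
  \<open>\<delta> / 4\<close>; travelling the segment both ways gives the absolute value.\<close>

lemma v_near_interface:
  assumes i: "i \<in> {1..N}" and a: "a \<in> \<Gamma>" and b: "b \<in> P i" and d: "L * norm (a - b) \<le> \<delta> / 2"
  shows "\<bar>v a - v b\<bar> \<le> 8 * Ml / \<delta> * norm (a - b)"
proof -
  have a': "a \<in> P i" "L * norm (a - a) \<le> \<delta> / 2" "L * norm (b - a) \<le> \<delta> / 2"
    using interface_subset_halfplane[OF i a] delta d by (auto simp: norm_minus_commute)
  obtain y \<alpha> where y: "admissible {0..norm (b - a) / (\<delta> / 4)} a y \<alpha>" "y (norm (b - a) / (\<delta> / 4)) = b"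
    by (rule segment_admissible[OF i a a'(1) b a'(2,3)])
  obtain z \<beta> where z: "admissible {0..norm (a - b) / (\<delta> / 4)} b z \<beta>" "z (norm (a - b) / (\<delta> / 4)) = a"
    by (rule segment_admissible[OF i a b a'(1) a'(3,2)])
  have "v a \<le> v b + 2 * Ml * (norm (b - a) / (\<delta> / 4))" using v_le_reach[OF y(1)] y(2) delta by simp
  moreover have "v b \<le> v a + 2 * Ml * (norm (a - b) / (\<delta> / 4))" using v_le_reach[OF z(1)] z(2) delta by simp
  ultimately show ?thesis by (simp add: abs_le_iff norm_minus_commute[of b a] mult_ac)
qed

text \<open>While \<open>y\<close> stays in \<open>P i\<close> and off \<Gamma>, its control lies in
  \<open>A i\<close> at almost every time and can also drive a curve \<open>w\<close> from
  \<open>x\<close>; Gronwall compares the two. Stopping when either curve meets \<Gamma> produces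
  the final alternative, in which the estimate near \<Gamma> applies.\<close>

lemma follow_control:
  assumes i: "i \<in> {1..N}" and x: "x \<in> P i" and z: "z \<in> P i" and T: "0 \<le> T"
    and y: "admissible {0..} z y \<alpha>"
  shows "\<exists>\<sigma> w \<beta>. 0 \<le> \<sigma> \<and> \<sigma> \<le> T \<and> admissible {0..\<sigma>} x w \<beta> \<and> w \<sigma> \<in> P i \<and> y \<sigma> \<in> P i \<and>
    norm (w \<sigma> - y \<sigma>) \<le> 2 * norm (x - z) * exp (2 * L * T) \<and>
    J \<sigma> w \<beta> \<le> J \<sigma> y \<alpha> + T * \<omega> (2 * norm (x - z) * exp (2 * L * T)) \<and>
    (\<sigma> = T \<or> y \<sigma> \<in> \<Gamma> \<or> w \<sigma> \<in> \<Gamma>)"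
proof -
  obtain a0 where a0: "a0 \<in> A i" using A_ne[OF i] by blast
  \<comment> \<open>The default \<open>a0\<close> makes the control admissible for
    \<open>P i\<close> at all times. Before the stopping time it replaces \<alpha> only on a null
    set.\<close>
  define \<beta> where "\<beta> = (\<lambda>s. if \<alpha> s \<in> A i then \<alpha> s else a0)"
  have \<alpha>m: "\<alpha> \<in> borel_measurable (lebesgue_on {0..})"
    using borel_measurable_continuous_on[OF _ admissibleD(1)[OF y], of snd] by (simp add: continuous_on_snd)
  have \<beta>m: "\<beta> \<in> borel_measurable (lebesgue_on {0..})"
    unfolding \<beta>_def
  proof (rule measurable_If[OF \<alpha>m])
    have "A i \<in> sets borel" using compact_imp_closed[OF A_compact[OF i]] by (rule borel_closed)
    from measurable_sets[OF \<alpha>m this]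
    show "{s \<in> space (lebesgue_on {0..}). \<alpha> s \<in> A i} \<in> sets (lebesgue_on {0..})"
      by (simp add: vimage_def Int_def conj_commute)
  qed simp
  have \<beta>A: "\<beta> s \<in> A i" for s using a0 by (simp add: \<beta>_def)
  obtain w :: "real \<Rightarrow> real ^ 3" where w: "continuous_on UNIV w" "\<And>t. t \<ge> 0 \<Longrightarrow> w t \<in> plane e i"
    "\<And>t. t \<ge> 0 \<Longrightarrow> w t = x + integral {0..t} (\<lambda>s. f i (closest_point (P i) (w s)) (\<beta> s))"
    using halfplane_ode[OF i x \<beta>m \<beta>A] by blast
  have yc: "continuous_on {0..} y"
    by (rule lipschitz_on_continuous_on[OF admissible_lipschitz[OF y]]) auto
  \<comment> \<open>The union of the other half-planes. Since \<open>N > 1\<close> it contains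
    \<Gamma>, so leaving the part of \<open>P i\<close> off \<Gamma> amounts to hitting a closed
    set.\<close>
  define U where "U = (\<Union>j\<in>{1..N} - {i}. P j)"
  have U: "closed U" unfolding U_def by (intro closed_UN closed_halfplane ballI) auto
  have \<Gamma>U: "\<Gamma> \<subseteq> U"
  proof -
    obtain j where j: "j \<in> {1..N} - {i}"
    proof (cases "i = 1")
      case True then show thesis using that[of 2] N_gt_1 by auto
    next
      case False then show thesis using that[of 1] N_gt_1 by auto
    qed
    then show ?thesis unfolding U_def using interface_subset_halfplane(1)[of j] by auto
  qed
  \<comment> \<open>The stopping events, with the horizon \<open>T\<close> added so that there is
    always one; closedness makes the first event attained.\<close>
  define Q where "Q = {0..T} \<inter> y -` U \<union> {0..T} \<inter> (\<lambda>t. w t \<bullet> e i) -` {..0} \<union> {T}"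
  have "closed Q" unfolding Q_def
    by (intro closed_Un continuous_closed_preimage U continuous_intros
        continuous_on_subset[OF yc] continuous_on_subset[OF w(1)]) auto
  moreover have Q: "Q \<subseteq> {0..T}" "T \<in> Q" using T unfolding Q_def by auto
  moreover have bb: "bdd_below Q" using Q(1) by (rule bdd_below_mono[rotated]) auto
  ultimately have \<sigma>Q: "Inf Q \<in> Q" using closed_contains_Inf by blast
  define \<sigma> where "\<sigma> = Inf Q"
  have \<sigma>: "0 \<le> \<sigma>" "\<sigma> \<le> T" using \<sigma>Q Q(1) unfolding \<sigma>_def by auto
  have before: "y t \<in> P i - \<Gamma>" "w t \<in> P i" if t: "0 \<le> t" "t < \<sigma>" for t
  proof -
    have "t \<notin> Q" using cInf_lower[OF _ bb, of t] t by (auto simp: \<sigma>_def)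
    then have n: "y t \<notin> U" "w t \<bullet> e i > 0" using t \<sigma> by (auto simp: Q_def)
    have "y t \<in> S" using admissibleD(3)[OF y, of t] t by simp
    then show "y t \<in> P i - \<Gamma>" using n \<Gamma>U unfolding U_def network_iff by auto
    show "w t \<in> P i" using n w(2)[OF t(1)] halfplane_iff_plane[OF i] by simp
  qed
  have w0: "w 0 = x" using w(3)[of 0] by simp
  \<comment> \<open>Before \<sigma> membership is known; at \<sigma> it follows by closedness of
    \<open>P i\<close>, or from the initial points if \<sigma> is zero.\<close>
  have inP: "y t \<in> P i" "w t \<in> P i" if t: "t \<in> {0..\<sigma>}" for t
  proof -
    have "g t \<in> P i" if g: "continuous_on {0..\<sigma>} g" "g 0 \<in> P i" "\<And>t. 0 \<le> t \<Longrightarrow> t < \<sigma> \<Longrightarrow> g t \<in> P i"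
      for g :: "real \<Rightarrow> real ^ 3"
    proof (cases "t < \<sigma>")
      case True then show ?thesis using g(3) t by auto
    next
      case False
      then have ts: "t = \<sigma>" using t by auto
      show ?thesis
      proof (cases "\<sigma> = 0")
        case True then show ?thesis using g(2) ts by simp
      next
        case False
        then have cl: "closure {0..<\<sigma>} = {0..\<sigma>}" using \<sigma> by (intro closure_atLeastLessThan) auto
        have "g ` closure {0..<\<sigma>} \<subseteq> P i"
          by (rule image_closure_subset) (use g closed_halfplane[OF i] cl in auto)
        then show ?thesis using cl ts \<sigma> by auto
      qed
    qed note * = this
    show "y t \<in> P i"
      by (rule *) (use before(1) z admissible_0[OF y] in \<open>auto intro: continuous_on_subset[OF yc]\<close>)
    show "w t \<in> P i"
      by (rule *) (use before(2) x w0 in \<open>auto intro: continuous_on_subset[OF w(1)]\<close>)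
  qed
  have "AE s in lebesgue. s \<in> {0..} \<longrightarrow> (y s, \<alpha> s) \<in> M_set N e A" by (rule admissibleD(2)[OF y])
  then obtain X where X: "negligible X" "\<And>s. s \<notin> X \<Longrightarrow> s \<ge> 0 \<Longrightarrow> (y s, \<alpha> s) \<in> M_set N e A"
    unfolding eventually_ae_filter_negligible by auto
  have \<alpha>\<beta>: "\<beta> s = \<alpha> s" if s: "s \<in> {0..<\<sigma>} - X" for s
  proof -
    obtain j where j: "j \<in> {1..N}" "y s \<in> P j" "\<alpha> s \<in> A j" using X(2)[of s] s unfolding M_set_iff by auto
    have "j = i" using halfplane_Int[OF i j(1) _ _ j(2)] before(1)[of s] s by auto
    then show ?thesis using j by (simp add: \<beta>_def)
  qed
  have X': "negligible (insert \<sigma> X)" using X(1) by (simp add: negligible_insert)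
  have y\<beta>: "admissible {0..\<sigma>} z y \<beta>"
  proof (rule admissible_halfplane[OF i])
    show "continuous_on {0..\<sigma>} y" by (rule continuous_on_subset[OF yc]) auto
    show "\<beta> \<in> borel_measurable (lebesgue_on {0..\<sigma>})" by (rule measurable_restrict_mono[OF \<beta>m]) auto
    fix t assume t: "t \<in> {0..\<sigma>}"
    have "integral {0..t} (\<lambda>s. f i (y s) (\<beta> s)) = integral {0..t} (D y \<alpha>)"
    proof (rule integral_spike[OF X'])
      fix s assume s: "s \<in> {0..t} - insert \<sigma> X"
      then have "\<beta> s = \<alpha> s" using t by (intro \<alpha>\<beta>) auto
      then show "D y \<alpha> s = f i (y s) (\<beta> s)"
        using dynamics_eq[OF i inP(1)[of s] \<beta>A[of s]] s t by auto
    qed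
    then show "y t = z + integral {0..t} (\<lambda>s. f i (y s) (\<beta> s))"
      using admissibleD(4)[OF y, of t] t by simp
  qed (use inP \<beta>A in auto)
  have wadm: "admissible {0..\<sigma>} x w \<beta>"
  proof (rule admissible_halfplane[OF i])
    show "continuous_on {0..\<sigma>} w" by (rule continuous_on_subset[OF w(1)]) auto
    show "\<beta> \<in> borel_measurable (lebesgue_on {0..\<sigma>})" by (rule measurable_restrict_mono[OF \<beta>m]) auto
    fix t assume t: "t \<in> {0..\<sigma>}"
    have "integral {0..t} (\<lambda>s. f i (closest_point (P i) (w s)) (\<beta> s)) = integral {0..t} (\<lambda>s. f i (w s) (\<beta> s))"
      by (rule integral_cong) (use inP t in \<open>auto simp: closest_point_self\<close>)
    then show "w t = x + integral {0..t} (\<lambda>s. f i (w s) (\<beta> s))" using w(3)[of t] t by simp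
  qed (use inP \<beta>A in auto)
  define B where "B = 2 * norm (x - z) * exp (2 * L * T)"
  have near: "norm (w t - y t) \<le> B" if t: "t \<in> {0..\<sigma>}" for t
  proof -
    have "norm (w t - y t) \<le> 2 * norm (x - z) * exp (2 * L * t)"
    proof (rule gronwall_weighted[OF _ L _ _ t])
      show cu: "continuous_on {0..\<sigma>} (\<lambda>t. norm (w t - y t))"
        by (intro continuous_intros continuous_on_subset[OF w(1)] continuous_on_subset[OF yc]) auto
      fix t assume t: "t \<in> {0..\<sigma>}"
      have iw: "D w \<beta> integrable_on {0..t}"
        by (rule set_lebesgue_integral_eq_integral(1)[OF admissible_integrable(1)[OF wadm]]) (use t in auto)
      have iy: "D y \<beta> integrable_on {0..t}"
        by (rule set_lebesgue_integral_eq_integral(1)[OF admissible_integrable(1)[OF y\<beta>]]) (use t in auto)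
      have eq: "w t - y t = (x - z) + integral {0..t} (\<lambda>s. D w \<beta> s - D y \<beta> s)"
        using admissibleD(4)[OF wadm t] admissibleD(4)[OF y\<beta> t]
        by (simp only: Henstock_Kurzweil_Integration.integral_diff[OF iw iy]) simp
      have "norm (w t - y t) \<le> norm (x - z) + norm (integral {0..t} (\<lambda>s. D w \<beta> s - D y \<beta> s))"
        unfolding eq by (rule norm_triangle_ineq)
      also have "norm (integral {0..t} (\<lambda>s. D w \<beta> s - D y \<beta> s)) \<le> integral {0..t} (\<lambda>s. L * norm (w s - y s))"
      proof (rule integral_norm_bound_integral)
        show "(\<lambda>s. D w \<beta> s - D y \<beta> s) integrable_on {0..t}" by (rule integrable_diff[OF iw iy])
        show "(\<lambda>s. L * norm (w s - y s)) integrable_on {0..t}"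
          by (intro integrable_continuous_real continuous_intros continuous_on_subset[OF w(1)] continuous_on_subset[OF yc]) auto
        fix s assume s: "s \<in> {0..t}"
        then have ip: "w s \<in> P i" "y s \<in> P i" using inP t by auto
        show "norm (D w \<beta> s - D y \<beta> s) \<le> L * norm (w s - y s)"
          using f_lip[OF i ip \<beta>A[of s]] by (simp add: dynamics_eq[OF i] ip \<beta>A)
      qed
      also have "\<dots> = L * integral {0..t} (\<lambda>s. norm (w s - y s))" by simp
      finally show "norm (w t - y t) \<le> norm (x - z) + L * integral {0..t} (\<lambda>s. norm (w s - y s))" by simp
    qed simp
    also have "\<dots> \<le> B" unfolding B_def using t \<sigma> L by (intro mult_left_mono) auto
    finally show ?thesis .
  qed
  have B0: "B \<ge> 0" by (simp add: B_def)
  have J\<beta>: "J \<sigma> y \<alpha> = J \<sigma> y \<beta>"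
    unfolding J_def by (rule integral_spike[OF X']) (use \<alpha>\<beta> in auto)
  have \<omega>0: "\<omega> B \<ge> 0" using modulus_nonneg[OF B0] .
  have "norm (J \<sigma> w \<beta> - J \<sigma> y \<beta>) \<le> \<omega> B * (\<sigma> - 0)"
  proof -
    have iw: "(\<lambda>s. R w \<beta> s * exp (- lam * s)) integrable_on {0..\<sigma>}"
      by (rule set_lebesgue_integral_eq_integral(1)[OF discounted_integrable(1)[OF wadm]])
    have iy: "(\<lambda>s. R y \<beta> s * exp (- lam * s)) integrable_on {0..\<sigma>}"
      by (rule set_lebesgue_integral_eq_integral(1)[OF discounted_integrable(1)[OF y\<beta>]])
    have "norm (R w \<beta> s * exp (- lam * s) - R y \<beta> s * exp (- lam * s)) \<le> \<omega> B" if s: "s \<in> {0..\<sigma>}" for s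
    proof -
      have ip: "w s \<in> P i" "y s \<in> P i" using inP s by auto
      have "\<bar>R w \<beta> s - R y \<beta> s\<bar> \<le> \<omega> (norm (w s - y s))"
        using l_mod[OF i ip \<beta>A[of s]] by (simp add: running_cost_eq[OF i] ip \<beta>A)
      also have "\<dots> \<le> \<omega> B"
        by (rule modulus_mono[OF norm_ge_zero near[OF s]])
      finally have 1: "\<bar>R w \<beta> s - R y \<beta> s\<bar> \<le> \<omega> B" .
      have "norm (R w \<beta> s * exp (- lam * s) - R y \<beta> s * exp (- lam * s)) = \<bar>R w \<beta> s - R y \<beta> s\<bar> * exp (- lam * s)"
        by (simp add: left_diff_distrib[symmetric] abs_mult)
      also have "\<dots> \<le> \<omega> B * 1" using 1 s lam \<omega>0 by (intro mult_mono) auto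
      finally show ?thesis by simp
    qed
    then have "norm (integral {0..\<sigma>} (\<lambda>s. R w \<beta> s * exp (- lam * s) - R y \<beta> s * exp (- lam * s)))
        \<le> integral {0..\<sigma>} (\<lambda>s. \<omega> B)"
      by (intro integral_norm_bound_integral integrable_diff iw iy) auto
    also have "\<dots> = \<omega> B * (\<sigma> - 0)" using \<sigma> by (simp add: mult.commute)
    finally show ?thesis
      unfolding J_def Henstock_Kurzweil_Integration.integral_diff[OF iw iy] .
  qed
  also have "\<omega> B * (\<sigma> - 0) \<le> T * \<omega> B" using \<sigma> \<omega>0 by (simp add: mult.commute mult_right_mono)
  finally have "J \<sigma> w \<beta> \<le> J \<sigma> y \<alpha> + T * \<omega> B" unfolding J\<beta> by simp
  moreover have "\<sigma> = T \<or> y \<sigma> \<in> \<Gamma> \<or> w \<sigma> \<in> \<Gamma>"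
  proof -
    have ip: "y \<sigma> \<in> P i" "w \<sigma> \<in> P i" using inP[of \<sigma>] \<sigma> by auto
    consider "\<sigma> = T" | "y \<sigma> \<in> U" | "w \<sigma> \<bullet> e i \<le> 0" using \<sigma>Q unfolding Q_def \<sigma>_def by auto
    then show ?thesis
    proof cases
      case 2
      then obtain j where "j \<in> {1..N}" "j \<noteq> i" "y \<sigma> \<in> P j" unfolding U_def by blast
      then show ?thesis using halfplane_Int[OF i _ _ ip(1)] by blast
    next
      case 3
      then have "w \<sigma> \<bullet> e i = 0" using ip(2) halfplane_iff[OF i] by auto
      then show ?thesis using interface_iff_halfplane[OF i ip(2)] by simp
    qed simp
  qed
  ultimately show ?thesis using \<sigma> wadm inP[of \<sigma>] near[of \<sigma>] unfolding B_def
    by (intro exI[of _ \<sigma>] exI[of _ w] exI[of _ \<beta>]) auto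
qed

text \<open>Three errors of size \<open>\<epsilon> / 4\<close> occur: near-optimality of
  \<open>y\<close>, the difference of running costs, and the difference of the values at the
  stopping time. The last is small by discounting if \<sigma> is the horizon, and by the estimate
  near \<Gamma> otherwise.\<close>

lemma v_uniformly_continuous_halfplane:
  assumes i: "i \<in> {1..N}"
  shows "uniformly_continuous_on (P i) v"
proof -
  have main: "\<exists>d>0. \<forall>x\<in>P i. \<forall>z\<in>P i. norm (x - z) < d \<longrightarrow> v x - v z < \<epsilon>" if \<epsilon>: "\<epsilon> > 0" for \<epsilon>
  proof -
    \<comment> \<open>The horizon \<open>T\<close> is fixed first, from \<epsilon> alone; the
      admissible separation \<open>h\<close> of the two curves depends on it.\<close>
    have "((\<lambda>T. exp (- lam * T) * (2 * (Ml / lam))) \<longlongrightarrow> 0 * (2 * (Ml / lam))) at_top"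
      by (intro tendsto_mult tendsto_const filterlim_compose[OF exp_at_bot]
          filterlim_tendsto_neg_mult_at_bot[OF tendsto_const] filterlim_ident) (use lam in auto)
    then have "eventually (\<lambda>T. exp (- lam * T) * (2 * (Ml / lam)) < \<epsilon> / 4) at_top"
      using \<epsilon> by (intro order_tendstoD(2)) auto
    then have "eventually (\<lambda>T. exp (- lam * T) * (2 * (Ml / lam)) < \<epsilon> / 4 \<and> T \<ge> 0) at_top"
      using eventually_ge_at_top[of "0::real"] by eventually_elim simp
    then obtain T where T: "exp (- lam * T) * (2 * (Ml / lam)) < \<epsilon> / 4" "T \<ge> 0"
      using eventually_happens[of _ "at_top :: real filter"] by (auto simp: trivial_limit_at_top_linorder)
    have "((\<lambda>h. T * \<omega> h) \<longlongrightarrow> T * 0) (at_right 0)"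
      by (intro tendsto_intros) (use omega in \<open>simp add: modulus_of_continuity_def\<close>)
    then have e1: "eventually (\<lambda>h. T * \<omega> h < \<epsilon> / 4) (at_right 0)" using \<epsilon> by (intro order_tendstoD(2)) auto
    have "((\<lambda>h. 8 * Ml / \<delta> * h) \<longlongrightarrow> 8 * Ml / \<delta> * 0) (at_right 0)" by (intro tendsto_intros)
    then have e2: "eventually (\<lambda>h. 8 * Ml / \<delta> * h < \<epsilon> / 4) (at_right 0)" using \<epsilon> by (intro order_tendstoD(2)) auto
    have "((\<lambda>h. L * h) \<longlongrightarrow> L * 0) (at_right 0)" by (intro tendsto_intros)
    then have e3: "eventually (\<lambda>h. L * h < \<delta> / 2) (at_right 0)" using delta by (intro order_tendstoD(2)) auto
    have e4: "eventually (\<lambda>h::real. h > 0) (at_right 0)" by (rule eventually_at_right_less)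
    have "eventually (\<lambda>h. T * \<omega> h < \<epsilon> / 4 \<and> 8 * Ml / \<delta> * h < \<epsilon> / 4 \<and> L * h < \<delta> / 2 \<and> h > 0) (at_right 0)"
      using e1 e2 e3 e4 by eventually_elim simp
    then obtain h where h: "T * \<omega> h < \<epsilon> / 4" "8 * Ml / \<delta> * h < \<epsilon> / 4" "L * h < \<delta> / 2" "h > 0"
      using eventually_happens[of _ "at_right (0::real)"] by auto
    \<comment> \<open>Chosen so that the Gronwall bound
      \<open>2 * norm (x - z) * exp (2 * L * T)\<close> is at most \<open>h\<close>.\<close>
    define d where "d = h / (2 * exp (2 * L * T))"
    have d: "d > 0" using h by (simp add: d_def)
    have "v x - v z < \<epsilon>" if xz: "x \<in> P i" "z \<in> P i" "norm (x - z) < d" for x z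
    proof -
      have zS: "z \<in> S" using xz i network_iff by blast
      have "\<epsilon> / 4 > 0" using \<epsilon> by simp
      from dynamic_programming_ge[OF zS this] obtain y \<alpha> where y: "admissible {0..} z y \<alpha>"
        "\<forall>T\<ge>0. J T y \<alpha> + exp (- lam * T) * v (y T) \<le> v z + \<epsilon> / 4" by metis
      define B where "B = 2 * norm (x - z) * exp (2 * L * T)"
      have B: "0 \<le> B" "B \<le> h" using xz(3) by (auto simp: B_def d_def field_simps)
      obtain \<sigma> w \<beta> where \<sigma>: "0 \<le> \<sigma>" "\<sigma> \<le> T" and w: "admissible {0..\<sigma>} x w \<beta>" "w \<sigma> \<in> P i" "y \<sigma> \<in> P i"
        "norm (w \<sigma> - y \<sigma>) \<le> B" "J \<sigma> w \<beta> \<le> J \<sigma> y \<alpha> + T * \<omega> B" and c: "\<sigma> = T \<or> y \<sigma> \<in> \<Gamma> \<or> w \<sigma> \<in> \<Gamma>"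
        using follow_control[OF i xz(1,2) T(2) y(1)] unfolding B_def by blast
      define q where "q = exp (- lam * \<sigma>)"
      have q: "0 < q" "q \<le> 1" unfolding q_def using lam \<sigma> by auto
      have "v x \<le> J \<sigma> w \<beta> + q * v (w \<sigma>)" unfolding q_def by (rule dynamic_programming_le[OF w(1) \<sigma>(1)])
      moreover have "J \<sigma> y \<alpha> + q * v (y \<sigma>) \<le> v z + \<epsilon> / 4" using y(2) \<sigma>(1) unfolding q_def by blast
      moreover have "T * \<omega> B < \<epsilon> / 4"
      proof -
        have "\<omega> B \<le> \<omega> h" using B by (intro modulus_mono)
        then show ?thesis using h(1) T(2) mult_left_mono[of "\<omega> B" "\<omega> h" T] by linarith
      qed
      moreover have "q * (v (w \<sigma>) - v (y \<sigma>)) < \<epsilon> / 4"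
      proof (cases "\<sigma> = T")
        case True
        have "w \<sigma> \<in> S" "y \<sigma> \<in> S" using w(2,3) i network_iff by blast+
        then have "v (w \<sigma>) - v (y \<sigma>) \<le> 2 * (Ml / lam)" using v_bound[of "w \<sigma>"] v_bound[of "y \<sigma>"] by linarith
        then have "q * (v (w \<sigma>) - v (y \<sigma>)) \<le> q * (2 * (Ml / lam))" using q by (intro mult_left_mono) auto
        moreover have "q * (2 * (Ml / lam)) < \<epsilon> / 4" using T(1) unfolding q_def True .
        ultimately show ?thesis by linarith
      next
        case False
        have n: "norm (w \<sigma> - y \<sigma>) \<le> h" using w(4) B by linarith
        then have Ln: "L * norm (w \<sigma> - y \<sigma>) \<le> \<delta> / 2"
          using h(3) L mult_left_mono[of "norm (w \<sigma> - y \<sigma>)" h L] by linarith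
        have "\<bar>v (w \<sigma>) - v (y \<sigma>)\<bar> \<le> 8 * Ml / \<delta> * norm (w \<sigma> - y \<sigma>)"
          using c False v_near_interface[OF i, of "w \<sigma>" "y \<sigma>"] v_near_interface[OF i, of "y \<sigma>" "w \<sigma>"] Ln w(2,3)
          by (auto simp: norm_minus_commute abs_minus_commute)
        also have "\<dots> \<le> 8 * Ml / \<delta> * h" using n Ml delta by (intro mult_left_mono) auto
        finally have 1: "\<bar>v (w \<sigma>) - v (y \<sigma>)\<bar> < \<epsilon> / 4" using h(2) by linarith
        have "q * (v (w \<sigma>) - v (y \<sigma>)) \<le> q * \<bar>v (w \<sigma>) - v (y \<sigma>)\<bar>" using q by (intro mult_left_mono) auto
        also have "\<dots> \<le> 1 * \<bar>v (w \<sigma>) - v (y \<sigma>)\<bar>" using q by (intro mult_right_mono) auto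
        finally have "q * (v (w \<sigma>) - v (y \<sigma>)) \<le> \<bar>v (w \<sigma>) - v (y \<sigma>)\<bar>" by simp
        then show ?thesis using 1 by (rule order_le_less_trans)
      qed
      moreover have "q * (v (w \<sigma>) - v (y \<sigma>)) = q * v (w \<sigma>) - q * v (y \<sigma>)" by (simp add: algebra_simps)
      ultimately show ?thesis using w(5) \<epsilon> by linarith
    qed
    then show ?thesis using d by blast
  qed
  show ?thesis unfolding uniformly_continuous_on_def
  proof (intro allI impI)
    fix \<epsilon> :: real assume "\<epsilon> > 0"
    from main[OF this] obtain d where d: "d > 0"
      "\<And>x z. x \<in> P i \<Longrightarrow> z \<in> P i \<Longrightarrow> norm (x - z) < d \<Longrightarrow> v x - v z < \<epsilon>" by blast
    then show "\<exists>d>0. \<forall>x\<in>P i. \<forall>x'\<in>P i. dist x' x < d \<longrightarrow> dist (v x') (v x) < \<epsilon>"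
      by (intro exI[of _ d]) (auto simp: dist_norm dist_real_def abs_if norm_minus_commute)
  qed
qed

lemma v_continuous: "continuous_on S v"
  unfolding network_def
  by (rule continuous_on_closed_Union)
    (use closed_halfplane uniformly_continuous_imp_continuous[OF v_uniformly_continuous_halfplane] in blast)+


section \<open>Test functions and Hamiltonians\<close>

lemma halfplane_translate:
  assumes "x \<in> P i"
  shows "x + r *\<^sub>R e 0 \<in> P i" and "r \<ge> 0 \<Longrightarrow> x + r *\<^sub>R e i \<in> P i"
proof -
  obtain a b where x: "x = a *\<^sub>R e 0 + b *\<^sub>R e i" "b \<ge> 0" using assms unfolding halfplane_def by auto
  have "x + r *\<^sub>R e 0 = (a + r) *\<^sub>R e 0 + b *\<^sub>R e i" "x + r *\<^sub>R e i = a *\<^sub>R e 0 + (b + r) *\<^sub>R e i"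
    unfolding x(1) by (simp_all add: algebra_simps)
  with x(2) show "x + r *\<^sub>R e 0 \<in> P i" "r \<ge> 0 \<Longrightarrow> x + r *\<^sub>R e i \<in> P i"
    unfolding halfplane_def by (metis (mono_tags, lifting) mem_Collect_eq,
        metis (mono_tags, lifting) add_nonneg_nonneg mem_Collect_eq)
qed

lemma ray_derivative:
  assumes \<phi>: "(\<phi> has_derivative (\<lambda>h. p \<bullet> h)) (at (x + s *\<^sub>R d) within P i)"
    and X: "\<And>r. r \<in> X \<Longrightarrow> x + r *\<^sub>R d \<in> P i"
  shows "((\<lambda>r. \<phi> (x + r *\<^sub>R d)) has_real_derivative p \<bullet> d) (at s within X)"
proof -
  have 1: "((\<lambda>r. x + r *\<^sub>R d) has_derivative (\<lambda>h. h *\<^sub>R d)) (at s within X)"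
    by (auto intro!: derivative_eq_intros)
  have "(\<phi> has_derivative (\<lambda>h. p \<bullet> h)) (at (x + s *\<^sub>R d) within (\<lambda>r. x + r *\<^sub>R d) ` X)"
    by (rule has_derivative_subset[OF \<phi>]) (use X in auto)
  from has_derivative_in_compose[OF 1 this]
  show ?thesis by (simp add: has_field_derivative_def mult.commute[of _ "p \<bullet> d"])
qed

text \<open>From every point of the closed half-plane the rays in the directions \<open>e 0\<close>
  and \<open>e i\<close> stay inside. One-sided derivatives along them determine both coordinates of
  the gradient, even on \<Gamma>.\<close>

lemma plane_gradient_unique:
  assumes i: "i \<in> {1..N}" and x: "x \<in> P i"
    and p: "has_plane_gradient e i \<phi> x p" and q: "has_plane_gradient e i \<phi> x q"
  shows "p = q"
proof -
  have pq: "p \<in> plane e i" "q \<in> plane e i"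
    and dp: "(\<phi> has_derivative (\<lambda>h. p \<bullet> h)) (at x within P i)"
    and dq: "(\<phi> has_derivative (\<lambda>h. q \<bullet> h)) (at x within P i)"
    using p q by (auto simp: has_plane_gradient_def)
  have "p \<bullet> d = q \<bullet> d" if d: "\<And>r. r \<in> {0..1} \<Longrightarrow> x + r *\<^sub>R d \<in> P i" for d
  proof -
    have "((\<lambda>r. \<phi> (x + r *\<^sub>R d)) has_vector_derivative p \<bullet> d) (at 0 within {0..1})"
      "((\<lambda>r. \<phi> (x + r *\<^sub>R d)) has_vector_derivative q \<bullet> d) (at 0 within {0..1})"
      using ray_derivative[of \<phi> p x 0 d i "{0..1}"] ray_derivative[of \<phi> q x 0 d i "{0..1}"] dp dq d
      by (auto simp flip: has_real_derivative_iff_has_vector_derivative)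
    then show ?thesis
      by (rule vector_derivative_unique_within[rotated]) (simp add: at_within_Icc_at_right)
  qed note * = this
  have "p \<bullet> e 0 = q \<bullet> e 0"
    by (rule *) (rule halfplane_translate(1)[OF x])
  moreover have "p \<bullet> e i = q \<bullet> e i"
    by (rule *) (rule halfplane_translate(2)[OF x], simp)
  ultimately show ?thesis using pq unfolding plane_iff[OF i] by metis
qed

lemma halfplane_approx:
  assumes i: "i \<in> {1..N}" and x: "x \<in> P i"
  defines "z \<equiv> \<lambda>n. x + (1 / real (Suc n)) *\<^sub>R e i"
  shows "\<And>n. z n \<in> P i - \<Gamma>" "z \<longlonglongrightarrow> x"
proof -
  fix n
  have "x \<bullet> e i \<ge> 0" using x halfplane_iff_plane[OF i] by simp
  then have "z n \<bullet> e i > 0" using inner_e(1)[OF i] by (simp add: z_def inner_add_left add_nonneg_pos)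
  moreover have "z n \<in> P i" unfolding z_def by (rule halfplane_translate(2)[OF x]) simp
  ultimately have zi: "z n \<in> P i \<and> z n \<bullet> e i > 0" by simp
  then show "z n \<in> P i - \<Gamma>" using interface_iff_halfplane[OF i] by auto
next
  have "(\<lambda>n. x + (1 / real (Suc n)) *\<^sub>R e i) \<longlonglongrightarrow> x + 0 *\<^sub>R e i"
    by (intro tendsto_intros LIMSEQ_Suc[OF lim_1_over_n])
  then show "z \<longlonglongrightarrow> x" by (simp add: z_def)
qed

lemma has_plane_gradient_interior:
  assumes i: "i \<in> {1..N}" and \<phi>: "C1_on_halfplane e i \<phi>" and x: "x \<in> P i - \<Gamma>"
  shows "has_plane_gradient e i \<phi> x (gradient e i \<phi> x)"
proof -
  obtain p where p: "has_plane_gradient e i \<phi> x p" using \<phi> x by (auto simp: C1_on_halfplane_def)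
  then have "(THE p. has_plane_gradient e i \<phi> x p) = p"
    using plane_gradient_unique[OF i] x by (intro the_equality) auto
  then show ?thesis using p x by (simp add: gradient_def)
qed

text \<open>On \<Gamma> the gradient is defined only as a limit. That it is a true derivative there
  follows from the mean value theorem on segments issuing from \<open>x\<close>, together with
  continuity of the gradient up to \<Gamma>.\<close>

lemma has_plane_gradient_gradient:
  assumes i: "i \<in> {1..N}" and \<phi>: "C1_on_halfplane e i \<phi>" and x: "x \<in> P i"
  shows "has_plane_gradient e i \<phi> x (gradient e i \<phi> x)"
proof (cases "x \<in> \<Gamma>")
  case False
  then show ?thesis using has_plane_gradient_interior[OF i \<phi>] x by simp
next
  case True
  define g where "g = gradient e i \<phi> x"
  have gc: "continuous_on (P i) (gradient e i \<phi>)" and \<phi>c: "continuous_on (P i) \<phi>"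
    using \<phi> by (auto simp: C1_on_halfplane_def)
  note int = has_plane_gradient_interior[OF i \<phi>]
  have "g \<in> plane e i"
  proof (rule closed_sequentially[OF closed_subspace[OF subspace_plane]])
    fix n show "gradient e i \<phi> (x + (1 / real (Suc n)) *\<^sub>R e i) \<in> plane e i"
      using int[OF halfplane_approx(1)[OF i x]] by (auto simp: has_plane_gradient_def)
    show "(\<lambda>n. gradient e i \<phi> (x + (1 / real (Suc n)) *\<^sub>R e i)) \<longlonglongrightarrow> g"
      unfolding g_def using halfplane_approx[OF i x]
      by (intro continuous_on_tendsto_compose[OF gc _ x]) auto
  qed
  moreover have "(\<phi> has_derivative (\<lambda>h. g \<bullet> h)) (at x within P i)"
    unfolding has_derivative_within_alt
  proof (intro conjI allI impI)
    show "bounded_linear ((\<bullet>) g)" by (rule bounded_linear_inner_right)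
    fix \<epsilon> :: real assume \<epsilon>: "\<epsilon> > 0"
    obtain d where d: "d > 0" "\<And>z. z \<in> P i \<Longrightarrow> norm (z - x) < d \<Longrightarrow> norm (gradient e i \<phi> z - g) < \<epsilon>"
      using gc x \<epsilon> unfolding continuous_on_iff g_def dist_norm by blast
    \<comment> \<open>With the endpoint \<open>y\<close> off \<Gamma>, the open segment also avoids
      \<Gamma>, so interior gradients exist along it.\<close>
    have main: "norm (\<phi> y - \<phi> x - g \<bullet> (y - x)) \<le> \<epsilon> * norm (y - x)" if y: "y \<in> P i - \<Gamma>" "norm (y - x) < d" for y
    proof -
      define G where "G = (\<lambda>s. \<phi> (x + s *\<^sub>R (y - x)))"
      have xe: "x \<bullet> e i = 0" using True interface_subset_halfplane[OF i] by simp
      have seg: "x + s *\<^sub>R (y - x) \<in> P i" if "s \<in> {0..1}" for s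
      proof -
        have "x + s *\<^sub>R (y - x) = (1 - s) *\<^sub>R x + s *\<^sub>R y" by (simp add: algebra_simps)
        then show ?thesis using convex_halfplane[of i] x y(1) that by (auto simp: convex_alt)
      qed
      have seg': "x + s *\<^sub>R (y - x) \<in> P i - \<Gamma>" if "s \<in> {0<..<1}" for s
      proof -
        have "y \<bullet> e i > 0" using y(1) interface_iff_halfplane[OF i] halfplane_iff[OF i] by force
        then have "(x + s *\<^sub>R (y - x)) \<bullet> e i \<noteq> 0" using that xe by (simp add: inner_add_left inner_diff_left)
        then show ?thesis using seg[of s] that interface_subset_halfplane(2)[OF i] by auto
      qed
      have "continuous_on {0..1} G" unfolding G_def
        by (rule continuous_on_compose2[OF \<phi>c]) (auto intro!: continuous_intros seg)
      moreover have "(G has_derivative (\<lambda>h. (gradient e i \<phi> (x + s *\<^sub>R (y - x)) \<bullet> (y - x)) * h)) (at s)"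
        if s: "0 < s" "s < 1" for s
      proof -
        have "(G has_real_derivative gradient e i \<phi> (x + s *\<^sub>R (y - x)) \<bullet> (y - x)) (at s within {0<..<1})"
          unfolding G_def
          by (rule ray_derivative[where i = i]) (use int[OF seg'[of s]] s seg in \<open>auto simp: has_plane_gradient_def\<close>)
        then show ?thesis using s
          by (simp add: at_within_open[of s "{0<..<1}"] has_field_derivative_def)
      qed
      ultimately obtain s where s: "0 < s" "s < 1"
        "G 1 - G 0 = (gradient e i \<phi> (x + s *\<^sub>R (y - x)) \<bullet> (y - x)) * (1 - 0)"
        using mvt[of 0 1 G "\<lambda>s h. (gradient e i \<phi> (x + s *\<^sub>R (y - x)) \<bullet> (y - x)) * h"] by auto
      define z where "z = x + s *\<^sub>R (y - x)"
      have "norm (z - x) \<le> norm (y - x)" using s by (simp add: z_def mult_left_le_one_le)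
      then have gz: "norm (gradient e i \<phi> z - g) < \<epsilon>" using d(2)[of z] seg[of s] s y(2) by (auto simp: z_def)
      have "\<phi> y - \<phi> x - g \<bullet> (y - x) = (gradient e i \<phi> z - g) \<bullet> (y - x)"
        using s(3) by (simp add: G_def z_def inner_diff_left)
      also have "norm \<dots> \<le> norm (gradient e i \<phi> z - g) * norm (y - x)"
        by (simp add: Cauchy_Schwarz_ineq2)
      also have "\<dots> \<le> \<epsilon> * norm (y - x)" using gz by (intro mult_right_mono) auto
      finally show ?thesis .
    qed
    show "\<exists>d>0. \<forall>y\<in>P i. norm (y - x) < d \<longrightarrow> norm (\<phi> y - \<phi> x - g \<bullet> (y - x)) \<le> \<epsilon> * norm (y - x)"
    proof (intro exI[of _ d] conjI ballI impI d(1))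
      fix y assume y: "y \<in> P i" "norm (y - x) < d"
      \<comment> \<open>If \<open>y\<close> itself lies on \<Gamma>, the estimate is obtained as a
        limit of estimates at points pushed off \<Gamma> along \<open>e i\<close>.\<close>
      define z where "z = (\<lambda>n. y + (1 / real (Suc n)) *\<^sub>R e i)"
      have z: "\<And>n. z n \<in> P i - \<Gamma>" "z \<longlonglongrightarrow> y" using halfplane_approx[OF i y(1)] by (auto simp: z_def)
      have "(\<lambda>n. \<phi> (z n)) \<longlonglongrightarrow> \<phi> y"
        using z by (intro continuous_on_tendsto_compose[OF \<phi>c _ y(1)]) auto
      then have l: "(\<lambda>n. norm (\<phi> (z n) - \<phi> x - g \<bullet> (z n - x))) \<longlonglongrightarrow> norm (\<phi> y - \<phi> x - g \<bullet> (y - x))"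
        by (intro tendsto_intros z)
      have r: "(\<lambda>n. \<epsilon> * norm (z n - x)) \<longlonglongrightarrow> \<epsilon> * norm (y - x)" by (intro tendsto_intros z)
      have "(\<lambda>n. norm (z n - x)) \<longlonglongrightarrow> norm (y - x)" by (intro tendsto_intros z)
      then have "eventually (\<lambda>n. norm (z n - x) < d) sequentially" using y(2) by (rule order_tendstoD)
      then have "eventually (\<lambda>n. norm (\<phi> (z n) - \<phi> x - g \<bullet> (z n - x)) \<le> \<epsilon> * norm (z n - x)) sequentially"
        by eventually_elim (use main z(1) in auto)
      then show "norm (\<phi> y - \<phi> x - g \<bullet> (y - x)) \<le> \<epsilon> * norm (y - x)"
        by (rule tendsto_le[OF sequentially_bot r l])
    qed
  qed
  ultimately show ?thesis by (simp add: has_plane_gradient_def g_def)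
qed

text \<open>The line through \<open>x\<close> along \<open>e 0\<close> lies in all half-planes, so
  both numbers are the derivative of the same function of one variable.\<close>

lemma gradient_tangential_eq:
  assumes i: "i \<in> {1..N}" and j: "j \<in> {1..N}" and \<phi>: "\<phi> \<in> test_functions N e" and x: "x \<in> \<Gamma>"
  shows "gradient e i \<phi> x \<bullet> e 0 = gradient e j \<phi> x \<bullet> e 0"
proof -
  have *: "((\<lambda>r. \<phi> (x + r *\<^sub>R e 0)) has_real_derivative gradient e k \<phi> x \<bullet> e 0) (at 0)"
    if k: "k \<in> {1..N}" for k
  proof (rule ray_derivative[of _ _ _ _ _ k UNIV])
    have "C1_on_halfplane e k \<phi>" using \<phi> k by (auto simp: test_functions_def)
    then show "(\<phi> has_derivative (\<lambda>h. gradient e k \<phi> x \<bullet> h)) (at (x + 0 *\<^sub>R e 0) within P k)"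
      using has_plane_gradient_gradient[OF k _ interface_subset_halfplane(1)[OF k x]]
      by (simp add: has_plane_gradient_def)
    fix r
    have "x + r *\<^sub>R e 0 \<in> \<Gamma>" using x by (simp add: interface_def span_add span_scale span_base)
    then show "x + r *\<^sub>R e 0 \<in> P k" by (rule interface_subset_halfplane(1)[OF k])
  qed
  show ?thesis by (rule DERIV_unique[OF *[OF i] *[OF j]])
qed

section \<open>Bounds, feasible controls and multipliers for the Hamiltonians\<close>

lemma hamiltonian_bound:
  assumes i: "i \<in> {1..N}" and x: "x \<in> P i" and a: "a \<in> A i"
  shows "- (p \<bullet> f i x a) - l i x a \<le> norm p * Mf + Ml"
proof -
  have "\<bar>p \<bullet> f i x a\<bar> \<le> norm p * Mf"
    using Cauchy_Schwarz_ineq2[of p "f i x a"] mult_left_mono[OF f_bd[OF i x a], of "norm p"] by simp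
  then show ?thesis using l_bd[OF i x a] by linarith
qed

lemma Ham_upper:
  assumes i: "i \<in> {1..N}" and x: "x \<in> P i" and a: "a \<in> A i"
  shows "- (p \<bullet> f i x a) - l i x a \<le> Ham A f l i x p"
  unfolding Ham_def
  by (rule cSUP_upper[OF a]) (use hamiltonian_bound[OF i x] in \<open>auto simp: bdd_above_def\<close>)

lemma Ham_plus_upper:
  assumes i: "i \<in> {1..N}" and x: "x \<in> P i" and a: "a \<in> A i" "f i x a \<bullet> e i \<ge> 0"
  shows "- (p \<bullet> f i x a) - l i x a \<le> Ham_plus e A f l i x p"
  unfolding Ham_plus_def
  by (rule cSUP_upper) (use a hamiltonian_bound[OF i x] in \<open>auto simp: bdd_above_def\<close>)

text \<open>The velocity \<open>(\<delta> / 2) *\<^sub>R e i\<close> is available by [H3]. Such a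
  control makes the supremum in \<open>Ham_plus\<close> non-empty and serves as the strictly
  feasible point for the multiplier.\<close>

lemma inward_control:
  assumes i: "i \<in> {1..N}" and x: "x \<in> \<Gamma>"
  obtains a where "a \<in> A i" "f i x a \<bullet> e i > 0"
proof -
  have "(\<delta> / 2) *\<^sub>R e i \<in> ball 0 \<delta> \<inter> plane e i"
    using delta inner_e(4)[OF i] by (simp add: plane_def span_scale span_base)
  then obtain a where a: "a \<in> A i" "(\<delta> / 2) *\<^sub>R e i = f i x a" using ball_subset[OF i x] by blast
  then have "f i x a \<bullet> e i = \<delta> / 2" using i by (metis inner_e(1) inner_scaleR_left mult.right_neutral)
  then show thesis using that[OF a(1)] delta by simp
qed

lemma FL_convex_combination:
  assumes i: "i \<in> {1..N}" and x: "x \<in> P i" and a: "a \<in> A i" "b \<in> A i" and t: "0 \<le> t" "t \<le> 1"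
  obtains c where "c \<in> A i" "f i x c = (1 - t) *\<^sub>R f i x a + t *\<^sub>R f i x b" "l i x c = (1 - t) * l i x a + t * l i x b"
proof -
  have "(1 - t) *\<^sub>R (f i x a, l i x a) + t *\<^sub>R (f i x b, l i x b) \<in> FL A f l i x"
    using FL_convex[OF i x] a t unfolding convex_alt by (auto simp: FL_def)
  then obtain c where "c \<in> A i" "(1 - t) *\<^sub>R (f i x a, l i x a) + t *\<^sub>R (f i x b, l i x b) = (f i x c, l i x c)"
    unfolding FL_def by auto
  then show thesis by (intro that[of c]) auto
qed

text \<open>The multiplier \<open>\<mu>\<close> belongs to the state constraint \<open>f \<bullet> e\<^sub>i \<ge> 0\<close> in the definition of
  \<open>H\<^sub>i\<^sup>+\<close>; strict feasibility comes from [H3].\<close>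

lemma Ham_plus_multiplier:
  assumes i: "i \<in> {1..N}" and x: "x \<in> \<Gamma>"
  obtains \<mu> where "\<mu> \<ge> 0"
    "\<forall>a\<in>A i. - (p \<bullet> f i x a) - l i x a + \<mu> * (f i x a \<bullet> e i) \<le> Ham_plus e A f l i x p"
proof -
  have xP: "x \<in> P i" by (rule interface_subset_halfplane(1)[OF i x])
  define K where "K = (\<lambda>a. (f i x a \<bullet> e i, - (p \<bullet> f i x a) - l i x a)) ` A i"
  have "linear (\<lambda>(w, r::real). (w \<bullet> e i, - (p \<bullet> w) - r))"
    by (rule linearI) (auto simp: inner_add_left inner_add_right algebra_simps)
  from convex_linear_image[OF this FL_convex[OF i xP]] have "convex K"
    by (simp add: K_def FL_def image_image)
  moreover obtain b where "b \<in> A i" "f i x b \<bullet> e i > 0" by (rule inward_control[OF i x])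
  moreover have "snd z \<le> Ham_plus e A f l i x p" if "z \<in> K" "fst z \<ge> 0" for z
    using that Ham_plus_upper[OF i xP] unfolding K_def by auto
  ultimately obtain \<mu> where \<mu>: "\<mu> \<ge> 0" "\<And>z. z \<in> K \<Longrightarrow> snd z + \<mu> * fst z \<le> Ham_plus e A f l i x p"
    using convex_multiplier_exists[of K "Ham_plus e A f l i x p" "(f i x b \<bullet> e i, - (p \<bullet> f i x b) - l i x b)"]
    by (auto simp: K_def)
  then show thesis by (intro that[of \<mu>]) (auto simp: K_def)
qed

section \<open>Viscosity inequalities\<close>

text \<open>With the constant control \<open>a\<close> the curve stays in \<open>P i\<close> for a
  short time, and dynamic programming gives an inequality that is an equality at time 0;
  differentiating at the left endpoint yields the claim.\<close>

lemma subsolution_inequality: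
  assumes i: "i \<in> {1..N}" and x: "x \<in> P i" and a: "a \<in> A i"
    and inw: "x \<notin> \<Gamma> \<or> f i x a \<bullet> e i > 0"
    and p: "has_plane_gradient e i \<phi> x p" and mx: "local_max_on S (\<lambda>z. v z - \<phi> z) x"
  shows "lam * v x - p \<bullet> f i x a - l i x a \<le> 0"
proof -
  have m: "(\<lambda>_::real. a) \<in> borel_measurable (lebesgue_on {0..})" by simp
  have aA: "\<And>t::real. 0 \<le> t \<Longrightarrow> a \<in> A i" using a .
  obtain y :: "real \<Rightarrow> real ^ 3" where y: "continuous_on UNIV y" "\<And>t. t \<ge> 0 \<Longrightarrow> y t \<in> plane e i"
    "\<And>t. t \<ge> 0 \<Longrightarrow> y t = x + integral {0..t} (\<lambda>s. f i (closest_point (P i) (y s)) a)"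
    using halfplane_ode[OF i x m aA] by blast
  have y0: "y 0 = x" using y(3)[of 0] by simp
  define F where "F = (\<lambda>s. f i (closest_point (P i) (y s)) a)"
  have cp: "closest_point (P i) z \<in> P i" for z
    by (rule closest_point_in_set[OF closed_halfplane[OF i] halfplane_ne])
  have "continuous_on UNIV (\<lambda>s. (closest_point (P i) (y s), a))"
    by (intro continuous_intros continuous_on_compose2[OF continuous_on_closest_point[OF convex_halfplane closed_halfplane[OF i] halfplane_ne, of UNIV] y(1)]) auto
  from continuous_on_compose2[OF f_cont[OF i] this] have Fc: "continuous_on UNIV F"
    using cp a by (auto simp: F_def)
  have F0: "F 0 = f i x a" by (simp add: F_def y0 closest_point_self[OF x])
  \<comment> \<open>Off \<Gamma> the normal coordinate stays positive by continuity. On \<Gamma> it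
    starts at zero, but the normal velocity stays positive for a while.\<close>
  have "\<exists>t1>0. \<forall>t\<in>{0..t1}. y t \<bullet> e i \<ge> 0"
  proof (cases "x \<in> \<Gamma>")
    case False
    have xe: "x \<bullet> e i > 0" using False x interface_iff_halfplane[OF i x] halfplane_iff[OF i] by force
    have "((\<lambda>t. y t \<bullet> e i) \<longlongrightarrow> y 0 \<bullet> e i) (at 0)"
      by (intro tendsto_intros) (use y(1) in \<open>auto simp: continuous_on_def\<close>)
    then have "eventually (\<lambda>t. 0 < y t \<bullet> e i) (at 0)" using xe y0 by (intro order_tendstoD) auto
    then obtain d where d: "d > 0" "\<And>t. t \<noteq> 0 \<Longrightarrow> dist t 0 < d \<Longrightarrow> 0 < y t \<bullet> e i"
      unfolding eventually_at by auto
    have "y t \<bullet> e i \<ge> 0" if "t \<in> {0..d/2}" for t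
      using d(2)[of t] that xe y0 d(1) by (cases "t = 0") (auto simp: less_imp_le)
    then show ?thesis using d(1) by (intro exI[of _ "d/2"]) auto
  next
    case True
    then have fe: "f i x a \<bullet> e i > 0" using inw by simp
    have "((\<lambda>t. F t \<bullet> e i) \<longlongrightarrow> F 0 \<bullet> e i) (at 0)"
      by (intro tendsto_intros) (use Fc in \<open>auto simp: continuous_on_def\<close>)
    then have "eventually (\<lambda>t. 0 < F t \<bullet> e i) (at 0)" using fe F0 by (intro order_tendstoD) auto
    then obtain d where d: "d > 0" "\<And>t. t \<noteq> 0 \<Longrightarrow> dist t 0 < d \<Longrightarrow> 0 < F t \<bullet> e i"
      unfolding eventually_at by auto
    have "y t \<bullet> e i \<ge> 0" if t: "t \<in> {0..d/2}" for t
    proof -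
      have Fi: "F integrable_on {0..t}"
        by (rule integrable_continuous_real[OF continuous_on_subset[OF Fc]]) auto
      have "integral {0..t} F \<bullet> e i = integral {0..t} (\<lambda>s. F s \<bullet> e i)"
        using integral_linear[OF Fi bounded_linear_inner_left[of "e i"]] by (simp add: o_def)
      also have "\<dots> \<ge> 0"
      proof (rule integral_nonneg)
        show "(\<lambda>s. F s \<bullet> e i) integrable_on {0..t}"
          by (intro integrable_continuous_real continuous_intros continuous_on_subset[OF Fc]) auto
        fix s assume s: "s \<in> {0..t}"
        then show "0 \<le> F s \<bullet> e i" using d(2)[of s] t d(1) fe F0 by (cases "s = 0") (auto simp: less_imp_le)
      qed
      finally have "integral {0..t} F \<bullet> e i \<ge> 0" .
      moreover have "x \<bullet> e i = 0" using True interface_subset_halfplane[OF i] by simp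
      ultimately show ?thesis using y(3)[of t] t by (simp add: inner_add_left F_def)
    qed
    then show ?thesis using d(1) by (intro exI[of _ "d/2"]) auto
  qed
  then obtain t1 where t1: "t1 > 0" "\<And>t. t \<in> {0..t1} \<Longrightarrow> y t \<bullet> e i \<ge> 0" by blast
  have yP: "y t \<in> P i" if "t \<in> {0..t1}" for t using y(2)[of t] t1(2)[OF that] that halfplane_iff_plane[OF i] by auto
  have adm: "admissible {0..t} x y (\<lambda>_. a)" if t: "t \<in> {0..t1}" for t
  proof (rule admissible_halfplane[OF i])
    fix r assume r: "r \<in> {0..t}"
    have "integral {0..r} (\<lambda>s. f i (closest_point (P i) (y s)) a) = integral {0..r} (\<lambda>s. f i (y s) a)"
      by (rule integral_cong) (use yP r t in \<open>auto simp: closest_point_self\<close>)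
    then show "y r = x + integral {0..r} (\<lambda>s. f i (y s) a)" using y(3)[of r] r by simp
  qed (use a yP t y(1) in \<open>auto intro: continuous_on_subset\<close>)
  define G where "G = (\<lambda>s. l i (y s) a * exp (- lam * s))"
  have "continuous_on {0..t1} (\<lambda>s. (y s, a))" by (intro continuous_intros continuous_on_subset[OF y(1)]) auto
  moreover have "(\<lambda>s. (y s, a)) ` {0..t1} \<subseteq> P i \<times> A i" using yP a by blast
  ultimately have "continuous_on {0..t1} (\<lambda>s. case (y s, a) of (x, a) \<Rightarrow> l i x a)"
    by (rule continuous_on_compose2[OF l_cont[OF i]])
  then have "continuous_on {0..t1} (\<lambda>s. l i (y s) a)" by simp
  then have Gc: "continuous_on {0..t1} G" unfolding G_def by (intro continuous_intros)
  have JG: "J t y (\<lambda>_. a) = integral {0..t} G" if "t \<in> {0..t1}" for t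
    unfolding J_def G_def by (rule integral_cong) (use running_cost_eq[OF i yP a] that in auto)
  have dJ: "((\<lambda>t. integral {0..t} G) has_real_derivative l i x a) (at 0 within {0..t1})"
    using integral_has_real_derivative[OF Gc, of 0] t1(1) by (simp add: G_def y0)
  have dy: "(y has_derivative (\<lambda>h. h *\<^sub>R f i x a)) (at 0 within {0..t1})"
  proof -
    have "((\<lambda>t. integral {0..t} F) has_vector_derivative F 0) (at 0 within {0..t1})"
      by (rule integral_has_vector_derivative[OF continuous_on_subset[OF Fc]]) (use t1 in auto)
    then have "((\<lambda>t. x + integral {0..t} F) has_vector_derivative f i x a) (at 0 within {0..t1})"
      unfolding F0 by (auto intro!: derivative_eq_intros)
    then have "(y has_vector_derivative f i x a) (at 0 within {0..t1})"
      by (rule has_vector_derivative_transform[rotated 2]) (use t1 y(3) in \<open>auto simp: F_def\<close>)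
    then show ?thesis by (simp add: has_vector_derivative_def)
  qed
  have "(\<phi> has_derivative (\<lambda>h. p \<bullet> h)) (at (y 0) within y ` {0..t1})"
    unfolding y0 by (rule has_derivative_subset[of _ _ _ "P i"]) (use p yP in \<open>auto simp: has_plane_gradient_def\<close>)
  from has_derivative_in_compose[OF dy this]
  have d\<phi>: "((\<lambda>t. \<phi> (y t)) has_real_derivative p \<bullet> f i x a) (at 0 within {0..t1})"
    by (simp add: has_field_derivative_def mult.commute[of _ "p \<bullet> f i x a"])
  \<comment> \<open>The right-hand side of dynamic programming with \<open>v\<close> replaced by the
    test function touching it from above. Near 0 it is at least its value \<open>v x\<close> at
    0.\<close>
  define \<psi> where "\<psi> = (\<lambda>t. integral {0..t} G + exp (- lam * t) * (\<phi> (y t) + (v x - \<phi> x)))"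
  have d\<psi>: "(\<psi> has_real_derivative l i x a + (p \<bullet> f i x a - lam * v x)) (at 0 within {0..t1})"
    unfolding \<psi>_def by (auto intro!: derivative_eq_intros dJ d\<phi> simp: y0)
  obtain d where d: "d > 0" "\<And>z. z \<in> S \<Longrightarrow> dist z x < d \<Longrightarrow> v z - \<phi> z \<le> v x - \<phi> x"
  proof -
    obtain d where "d > 0" "\<And>z. z \<in> S \<Longrightarrow> z \<noteq> x \<and> dist z x < d \<Longrightarrow> v z - \<phi> z \<le> v x - \<phi> x"
      using mx unfolding local_max_on_def eventually_at by blast
    then show thesis by (intro that[of d]) auto
  qed
  have "((\<lambda>t. y t) \<longlongrightarrow> y 0) (at 0 within {0..t1})"
    using y(1) by (auto simp: continuous_on_def intro: tendsto_within_subset)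
  then have ev: "eventually (\<lambda>t. dist (y t) x < d) (at 0 within {0..t1})"
    using d(1) unfolding y0 by (rule tendstoD)
  have "eventually (\<lambda>t. t \<in> {0..t1}) (at 0 within {0..t1})" by (simp add: eventually_at_filter)
  with ev have "eventually (\<lambda>t. \<psi> 0 \<le> \<psi> t) (at 0 within {0..t1})"
  proof eventually_elim
    case (elim t)
    have "y t \<in> S" using yP[OF elim(2)] i network_iff by blast
    then have "v (y t) \<le> \<phi> (y t) + (v x - \<phi> x)" using d(2) elim(1) by force
    then have "exp (- lam * t) * v (y t) \<le> exp (- lam * t) * (\<phi> (y t) + (v x - \<phi> x))"
      by (intro mult_left_mono) auto
    moreover have "v x \<le> J t y (\<lambda>_. a) + exp (- lam * t) * v (y t)"
      using dynamic_programming_le[OF adm[OF elim(2)]] elim(2) by simp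
    moreover have "\<psi> 0 = v x" by (simp add: \<psi>_def y0)
    ultimately show ?case unfolding JG[OF elim(2)] \<psi>_def by linarith
  qed
  from derivative_nonneg_at_left_endpoint[OF d\<psi> t1(1) this] show ?thesis by simp
qed


lemma value_subsolution: "viscosity_subsolution N e A f l lam v"
  unfolding viscosity_subsolution_def
proof (intro conjI ballI impI)
  show "usc_on S v" unfolding usc_on_def
    using v_continuous by (auto simp: continuous_on_def intro: order_tendstoD)
next
  fix x \<phi> i
  assume \<phi>: "\<phi> \<in> test_functions N e" and mx: "local_max_on S (\<lambda>z. v z - \<phi> z) x"
    and i: "i \<in> {1..N}" and x: "x \<in> P i - \<Gamma>"
  have "Ham A f l i x (gradient e i \<phi> x) \<le> - lam * v x"
    unfolding Ham_def
  proof (rule cSUP_least[OF A_ne[OF i]])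
    fix a assume a: "a \<in> A i"
    have "has_plane_gradient e i \<phi> x (gradient e i \<phi> x)"
      by (rule has_plane_gradient_gradient[OF i]) (use \<phi> i x in \<open>auto simp: test_functions_def\<close>)
    from subsolution_inequality[OF i _ a _ this mx] x
    show "- (gradient e i \<phi> x \<bullet> f i x a) - l i x a \<le> - lam * v x" by simp
  qed
  then show "lam * v x + Ham A f l i x (gradient e i \<phi> x) \<le> 0" by simp
next
  fix x \<phi>
  assume \<phi>: "\<phi> \<in> test_functions N e" and mx: "local_max_on S (\<lambda>z. v z - \<phi> z) x"
    and x: "x \<in> \<Gamma>"
  have le: "Ham_plus e A f l i x (gradient e i \<phi> x) \<le> - lam * v x" if i: "i \<in> {1..N}" for i
    unfolding Ham_plus_def
  proof (rule cSUP_least)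
    have xP: "x \<in> P i" by (rule interface_subset_halfplane(1)[OF i x])
    obtain b where b: "b \<in> A i" "f i x b \<bullet> e i > 0" by (rule inward_control[OF i x])
    then show "{a \<in> A i. 0 \<le> f i x a \<bullet> e i} \<noteq> {}" by (auto simp: less_imp_le)
    define p where "p = gradient e i \<phi> x"
    have p: "has_plane_gradient e i \<phi> x p" unfolding p_def
      by (rule has_plane_gradient_gradient[OF i _ xP]) (use \<phi> i in \<open>auto simp: test_functions_def\<close>)
    fix a assume a: "a \<in> {a \<in> A i. 0 \<le> f i x a \<bullet> e i}"
    define E where "E = (\<lambda>c. lam * v x - p \<bullet> f i x c - l i x c)"
    \<comment> \<open>The mixture points strictly inward for every \<open>t > 0\<close> because
      \<open>b\<close> does. As \<open>E\<close> is affine along the mixture, letting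
      \<open>t\<close> tend to 0 leaves \<open>E a\<close>.\<close>
    have neg: "(1 - t) * E a + t * E b \<le> 0" if t: "0 < t" "t \<le> 1" for t
    proof -
      obtain c where c: "c \<in> A i" "f i x c = (1 - t) *\<^sub>R f i x a + t *\<^sub>R f i x b"
        "l i x c = (1 - t) * l i x a + t * l i x b"
        using FL_convex_combination[OF i xP, of a b t] a b t by auto
      have "f i x c \<bullet> e i = (1 - t) * (f i x a \<bullet> e i) + t * (f i x b \<bullet> e i)"
        unfolding c(2) by (simp add: inner_add_left)
      also have "\<dots> > 0" using a b t by (intro add_nonneg_pos mult_nonneg_nonneg mult_pos_pos) auto
      finally have "lam * v x - p \<bullet> f i x c - l i x c \<le> 0"
        using subsolution_inequality[OF i xP c(1) _ p mx] by simp
      then show ?thesis unfolding c(2,3) E_def by (simp add: inner_add_right algebra_simps)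
    qed
    have "((\<lambda>t. (1 - t) * E a + t * E b) \<longlongrightarrow> (1 - 0) * E a + 0 * E b) (at_right 0)"
      by (intro tendsto_intros)
    moreover have "eventually (\<lambda>t. (1 - t) * E a + t * E b \<le> 0) (at_right 0)"
      using eventually_at_right_real[of 0 1] by (rule eventually_mono) (use neg in auto)
    ultimately have "(1 - 0) * E a + 0 * E b \<le> 0" by (rule tendsto_upperbound) simp
    then show "- (gradient e i \<phi> x \<bullet> f i x a) - l i x a \<le> - lam * v x" by (simp add: E_def p_def)
  qed
  have "{1..N} \<noteq> {}" using N_gt_1 by auto
  then have "Ham_interface N e A f l x (\<lambda>i. gradient e i \<phi> x) \<le> - lam * v x"
    unfolding Ham_interface_def using le by (intro Max.boundedI) auto
  then show "lam * v x + Ham_interface N e A f l x (\<lambda>i. gradient e i \<phi> x) \<le> 0" by simp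
qed

text \<open>The hypothesis on \<open>H\<close> isolates what depends on the geometry: a first-order
  lower bound along all trajectories from \<open>x\<close>, with \<open>t0\<close> independent of
  the trajectory. This uniformity is essential, because the near-optimal trajectory is chosen only
  after \<open>t\<close>.\<close>

lemma supersolution_inequality:
  assumes x: "x \<in> S" and mn: "local_min_on S (\<lambda>z. v z - \<phi> z) x"
    and p: "\<And>i. i \<in> {1..N} \<Longrightarrow> x \<in> P i \<Longrightarrow> has_plane_gradient e i \<phi> x (p i)"
    and H: "\<And>\<epsilon>. \<epsilon> > 0 \<Longrightarrow> \<exists>t0>0. \<forall>y \<alpha> t. admissible {0..} x y \<alpha> \<longrightarrow> 0 < t \<longrightarrow> t < t0 \<longrightarrow>
      (\<exists>i\<in>{1..N}. x \<in> P i \<and> y t \<in> P i \<and> p i \<bullet> (y t - x) + integral {0..t} (R y \<alpha>) \<ge> - (H + \<epsilon>) * t)"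
  shows "lam * v x + H \<ge> 0"
proof (rule ccontr)
  assume "\<not> lam * v x + H \<ge> 0"
  \<comment> \<open>The errors below add up to \<open>5 * \<epsilon>\<close> per unit time, less
    than the assumed deficit of \<open>8 * \<epsilon>\<close>.\<close>
  define \<epsilon> where "\<epsilon> = - (lam * v x + H) / 8"
  have \<epsilon>: "\<epsilon> > 0" using \<open>\<not> lam * v x + H \<ge> 0\<close> by (simp add: \<epsilon>_def)
  \<comment> \<open>A bound for the increment of \<phi> per unit time: the first-order part is at
    most \<open>norm (p i) * Mf\<close>, the remainder at most \<epsilon>. It controls the effect of
    discounting that increment.\<close>
  define K where "K = (\<Sum>i\<in>{1..N}. norm (p i)) * Mf + \<epsilon>"
  have "(\<Sum>i\<in>{1..N}. norm (p i)) \<ge> 0" by (rule sum_nonneg) simp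
  then have K: "K > 0" using \<epsilon> Mf by (simp add: K_def add_nonneg_pos)
  obtain t0 where t0: "t0 > 0" "\<And>y \<alpha> t. admissible {0..} x y \<alpha> \<Longrightarrow> 0 < t \<Longrightarrow> t < t0 \<Longrightarrow>
      (\<exists>i\<in>{1..N}. x \<in> P i \<and> y t \<in> P i \<and> p i \<bullet> (y t - x) + integral {0..t} (R y \<alpha>) \<ge> - (H + \<epsilon>) * t)"
    using H[OF \<epsilon>] by blast
  \<comment> \<open>The tolerance \<open>\<epsilon> / Mf\<close> turns into an error of at most
    \<open>\<epsilon> * t\<close>, since the state moves at most \<open>Mf * t\<close>.\<close>
  have "\<exists>d>0. \<forall>z\<in>P i. x \<in> P i \<longrightarrow> norm (z - x) < d \<longrightarrow> \<bar>\<phi> z - \<phi> x - p i \<bullet> (z - x)\<bar> \<le> \<epsilon> / Mf * norm (z - x)"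
    if i: "i \<in> {1..N}" for i
  proof (cases "x \<in> P i")
    case True
    then have "(\<phi> has_derivative (\<lambda>h. p i \<bullet> h)) (at x within P i)"
      using p[OF i] by (simp add: has_plane_gradient_def)
    moreover have "\<epsilon> / Mf > 0" using \<epsilon> Mf by simp
    ultimately show ?thesis unfolding has_derivative_within_alt real_norm_def by blast
  next
    case False then show ?thesis by (intro exI[of _ 1]) auto
  qed
  then have "\<forall>i\<in>{1..N}. \<exists>d>0. \<forall>z\<in>P i. x \<in> P i \<longrightarrow> norm (z - x) < d \<longrightarrow>
      \<bar>\<phi> z - \<phi> x - p i \<bullet> (z - x)\<bar> \<le> \<epsilon> / Mf * norm (z - x)" by blast
  from bchoice[OF this] obtain d1 where d1: "\<And>i. i \<in> {1..N} \<Longrightarrow> d1 i > 0"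
    "\<And>i z. i \<in> {1..N} \<Longrightarrow> z \<in> P i \<Longrightarrow> x \<in> P i \<Longrightarrow> norm (z - x) < d1 i \<Longrightarrow>
      \<bar>\<phi> z - \<phi> x - p i \<bullet> (z - x)\<bar> \<le> \<epsilon> / Mf * norm (z - x)" by blast
  obtain d2 where d2: "d2 > 0" "\<And>z. z \<in> S \<Longrightarrow> norm (z - x) < d2 \<Longrightarrow> v x - \<phi> x \<le> v z - \<phi> z"
  proof -
    obtain d where "d > 0" "\<And>z. z \<in> S \<Longrightarrow> z \<noteq> x \<and> dist z x < d \<Longrightarrow> v x - \<phi> x \<le> v z - \<phi> z"
      using mn unfolding local_min_on_def eventually_at by blast
    then show thesis by (intro that[of d]) (auto simp: dist_norm)
  qed
  define d where "d = Min (insert d2 (d1 ` {1..N}))"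
  have d: "d > 0" "d \<le> d2"
    unfolding d_def using d1(1) d2(1) by (auto simp: Min_gr_iff intro!: Min_le)
  have d3: "d \<le> d1 i" if "i \<in> {1..N}" for i
    unfolding d_def by (rule Min_le) (use that in blast)+
  have "((\<lambda>t. Mf * t) \<longlongrightarrow> Mf * 0) (at_right 0)" by (intro tendsto_intros)
  then have e1: "eventually (\<lambda>t. Mf * t < d) (at_right 0)" using d(1) by (intro order_tendstoD) auto
  have "((\<lambda>t. (Ml * lam + lam * K) * t) \<longlongrightarrow> (Ml * lam + lam * K) * 0) (at_right 0)" by (intro tendsto_intros)
  then have e2: "eventually (\<lambda>t. (Ml * lam + lam * K) * t < \<epsilon>) (at_right 0)" using \<epsilon> by (intro order_tendstoD) auto
  have e3: "eventually (\<lambda>t. 0 < t \<and> t < t0) (at_right 0)"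
    using eventually_at_right_real[OF t0(1)] by (rule eventually_mono) auto
  have "((\<lambda>t. exp (- lam * t)) has_real_derivative - lam) (at 0 within {0<..})"
    by (auto intro!: derivative_eq_intros)
  then have "((\<lambda>t. (exp (- lam * t) - exp (- lam * 0)) / (t - 0)) \<longlongrightarrow> - lam) (at_right 0)"
    by (simp add: has_field_derivative_iff)
  then have "((\<lambda>t. v x * ((exp (- lam * t) - 1) / t)) \<longlongrightarrow> v x * (- lam)) (at_right 0)"
    by (intro tendsto_intros) simp
  then have e4: "eventually (\<lambda>t. v x * ((exp (- lam * t) - 1) / t) > v x * (- lam) - \<epsilon>) (at_right 0)"
    using \<epsilon> by (intro order_tendstoD) auto
  have "eventually (\<lambda>t. Mf * t < d \<and> (Ml * lam + lam * K) * t < \<epsilon> \<and> (0 < t \<and> t < t0) \<and>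
      v x * ((exp (- lam * t) - 1) / t) > v x * (- lam) - \<epsilon>) (at_right 0)"
    using e1 e2 e3 e4 by eventually_elim simp
  then obtain t where t: "Mf * t < d" "(Ml * lam + lam * K) * t < \<epsilon>" "0 < t" "t < t0"
    "v x * ((exp (- lam * t) - 1) / t) > v x * (- lam) - \<epsilon>"
    using eventually_happens[of _ "at_right (0::real)"] by auto
  define q where "q = exp (- lam * t)"
  have q: "0 < q" "q \<le> 1" "1 - q \<le> lam * t"
    unfolding q_def using lam t exp_ge_add_one_self[of "- lam * t"] by auto
  have qv: "v x * q \<ge> v x - lam * v x * t - \<epsilon> * t"
  proof -
    have "v x * ((q - 1) / t) * t \<ge> (v x * (- lam) - \<epsilon>) * t"
      using t(3,5) unfolding q_def by (intro mult_right_mono) auto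
    moreover have "v x * ((q - 1) / t) * t = v x * q - v x" using t(3) by (simp add: right_diff_distrib)
    moreover have "(v x * (- lam) - \<epsilon>) * t = - (lam * v x * t) - \<epsilon> * t" by (simp add: algebra_simps)
    ultimately show ?thesis by linarith
  qed
  \<comment> \<open>Optimality is required up to \<open>\<epsilon> * t\<close>, so that the defect
    remains small after division by \<open>t\<close>.\<close>
  have "\<epsilon> * t > 0" using \<epsilon> t by simp
  from dynamic_programming_ge[OF x this] obtain y \<alpha> where y: "admissible {0..} x y \<alpha>"
    "\<forall>T\<ge>0. J T y \<alpha> + exp (- lam * T) * v (y T) \<le> v x + \<epsilon> * t" by metis
  define r where "r = integral {0..t} (R y \<alpha>)"
  obtain i where i: "i \<in> {1..N}" "x \<in> P i" "y t \<in> P i" and g: "p i \<bullet> (y t - x) + r \<ge> - (H + \<epsilon>) * t"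
    using t0(2)[OF y(1) t(3,4)] unfolding r_def by blast
  have ny: "norm (y t - x) \<le> Mf * t"
    using admissible_increment(2)[OF y(1), of t 0] admissible_0[OF y(1)] t(3) by auto
  define \<Delta> where "\<Delta> = \<phi> (y t) - \<phi> x"
  have \<Delta>1: "\<bar>\<Delta> - p i \<bullet> (y t - x)\<bar> \<le> \<epsilon> * t"
  proof -
    have "\<bar>\<Delta> - p i \<bullet> (y t - x)\<bar> \<le> \<epsilon> / Mf * norm (y t - x)"
      unfolding \<Delta>_def using d1(2)[OF i(1,3,2)] d3[OF i(1)] ny t(1) by simp
    also have "\<dots> \<le> \<epsilon> / Mf * (Mf * t)" using ny \<epsilon> Mf by (intro mult_left_mono) auto
    finally show ?thesis using Mf by simp
  qed
  have \<Delta>2: "\<bar>\<Delta>\<bar> \<le> K * t"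
  proof -
    have "\<bar>p i \<bullet> (y t - x)\<bar> \<le> norm (p i) * (Mf * t)"
      using Cauchy_Schwarz_ineq2[of "p i" "y t - x"] mult_left_mono[OF ny, of "norm (p i)"] by simp
    also have "\<dots> \<le> (\<Sum>i\<in>{1..N}. norm (p i)) * (Mf * t)"
      using i(1) Mf t(3) by (intro mult_right_mono member_le_sum) auto
    finally show ?thesis using \<Delta>1 by (simp add: K_def algebra_simps)
  qed
  have "y t \<in> S" using i network_iff by blast
  then have vy: "v (y t) \<ge> v x + \<Delta>" using d2(2)[of "y t"] ny t(1) d(2) by (simp add: \<Delta>_def)
  have "q * v (y t) \<ge> q * (v x + \<Delta>)" using vy q by (intro mult_left_mono) auto
  moreover have "q * (v x + \<Delta>) = v x * q + \<Delta> - (1 - q) * \<Delta>" by (simp add: algebra_simps)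
  moreover have "(1 - q) * \<Delta> \<le> lam * t * (K * t)"
    using \<Delta>2 q lam t(3) K by (intro order_trans[OF mult_left_mono[of \<Delta> "K * t" "1 - q"] mult_right_mono]) auto
  \<comment> \<open>Removing the discount from the running cost changes the integrand by at most
    \<open>Ml * lam * t\<close>, a second-order effect after integration.\<close>
  moreover have "J t y \<alpha> \<ge> r - Ml * lam * t * t"
  proof -
    have a: "admissible {0..t} x y \<alpha>" by (rule admissible_mono[OF y(1)]) auto
    have ai: "R y \<alpha> absolutely_integrable_on {0..t}" by (rule admissible_integrable(2)[OF a]) simp
    note di = discounted_integrable(1)[OF a]
    have "(- (Ml * (lam * t))) * (t - 0) \<le> integral {0..t} (\<lambda>s. R y \<alpha> s * exp (- lam * s) - R y \<alpha> s)"
    proof (rule AE_integral_ge)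
      show "(\<lambda>s. R y \<alpha> s * exp (- lam * s) - R y \<alpha> s) absolutely_integrable_on {0..t}"
        by (rule set_integral_diff(1)[OF di ai])
      have "AE s in lebesgue. s \<in> {0..t} \<longrightarrow> \<bar>R y \<alpha> s\<bar> \<le> Ml"
        using admissible_bound(2)[OF a] by (simp add: AE_restrict_space_iff)
      then show "AE s in lebesgue. s \<in> {0..t} \<longrightarrow> - (Ml * (lam * t)) \<le> R y \<alpha> s * exp (- lam * s) - R y \<alpha> s"
      proof eventually_elim
        case (elim s)
        show ?case
        proof
          assume s: "s \<in> {0..t}"
          have "1 - exp (- lam * s) \<le> lam * s" using exp_ge_add_one_self[of "- lam * s"] by simp
          also have "\<dots> \<le> lam * t" using s lam by simp
          finally have 1: "1 - exp (- lam * s) \<le> lam * t" .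
          have 0: "0 \<le> 1 - exp (- lam * s)" using s lam by simp
          have "R y \<alpha> s * (1 - exp (- lam * s)) \<le> Ml * (lam * t)"
            using elim s 1 0 Ml by (intro order_trans[OF mult_right_mono[of "R y \<alpha> s" Ml] mult_left_mono]) auto
          then show "- (Ml * (lam * t)) \<le> R y \<alpha> s * exp (- lam * s) - R y \<alpha> s" by (simp add: algebra_simps)
        qed
      qed
    qed (use t in auto)
    also have "\<dots> = J t y \<alpha> - r" unfolding J_def r_def
      by (rule Henstock_Kurzweil_Integration.integral_diff)
        (use set_lebesgue_integral_eq_integral(1)[OF di] set_lebesgue_integral_eq_integral(1)[OF ai] in auto)
    finally show ?thesis by (simp add: algebra_simps)
  qed
  moreover have "J t y \<alpha> + q * v (y t) \<le> v x + \<epsilon> * t" using y(2) t(3) unfolding q_def by simp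
  moreover have "(Ml * lam + lam * K) * t * t \<le> \<epsilon> * t" using t(2,3) by (intro mult_right_mono) auto
  moreover have "lam * t * (K * t) + Ml * lam * t * t = (Ml * lam + lam * K) * t * t" by (simp add: algebra_simps)
  ultimately have "\<epsilon> * t \<ge> r + \<Delta> - lam * v x * t - \<epsilon> * t - \<epsilon> * t" using qv by linarith
  moreover have "r + \<Delta> \<ge> - (H + \<epsilon>) * t - \<epsilon> * t" using g \<Delta>1 by linarith
  moreover have "(H + \<epsilon>) * t + lam * v x * t = - 7 * (\<epsilon> * t)"
  proof -
    have "H + \<epsilon> + lam * v x = - 7 * \<epsilon>" by (simp add: \<epsilon>_def field_simps)
    then have "(H + \<epsilon> + lam * v x) * t = - 7 * \<epsilon> * t" by (simp only:)
    then show ?thesis by (simp add: algebra_simps)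
  qed
  ultimately show False using \<open>\<epsilon> * t > 0\<close> by (simp add: algebra_simps)
qed


section \<open>Normal displacement along trajectories\<close>

text \<open>Off \<Gamma> the half-planes are disjoint and relatively closed, so a connected set
  cannot meet two of them. An excursion away from \<Gamma> thus remains on one branch.\<close>

lemma network_minus_interface_connected:
  assumes C: "connected C" "C \<subseteq> S - \<Gamma>" "z \<in> C" and j: "j \<in> {1..N}" "z \<in> P j"
  shows "C \<subseteq> P j - \<Gamma>"
proof -
  define U where "U = (\<Union>k\<in>{1..N} - {j}. P k)"
  have U: "closed U" unfolding U_def by (intro closed_UN closed_halfplane ballI) auto
  have "\<not> (\<exists>A B. closed A \<and> closed B \<and> C \<subseteq> A \<union> B \<and> A \<inter> B \<inter> C = {} \<and> A \<inter> C \<noteq> {} \<and> B \<inter> C \<noteq> {})"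
    using C(1) unfolding connected_closed .
  moreover have "C \<subseteq> P j \<union> U" using C(2) unfolding U_def network_def by blast
  moreover have "P j \<inter> U \<inter> C = {}" using halfplane_Int[OF j(1)] C(2) unfolding U_def by blast
  moreover have "P j \<inter> C \<noteq> {}" using j C(3) by blast
  ultimately have "U \<inter> C = {}" using closed_halfplane[OF j(1)] U by blast
  then show ?thesis using \<open>C \<subseteq> P j \<union> U\<close> C(2) by blast
qed

text \<open>\<open>normal_rate c y \<alpha>\<close> is the derivative along the trajectory of the function which equals
  \<open>c\<^sub>j\<close> times the distance to \<open>\<Gamma>\<close> on the \<open>j\<close>-th half-plane.\<close>

definition normal_rate :: "(nat \<Rightarrow> real) \<Rightarrow> (real \<Rightarrow> real ^ 3) \<Rightarrow> (real \<Rightarrow> 'a) \<Rightarrow> real \<Rightarrow> real" where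
  "normal_rate c y \<alpha> s = (\<Sum>j\<in>{1..N}. indicator (A j) (\<alpha> s) * (c j * (D y \<alpha> s \<bullet> e j)))"

lemma normal_rate_eq:
  assumes j: "j \<in> {1..N}" and a: "\<alpha> s \<in> A j"
  shows "normal_rate c y \<alpha> s = c j * (D y \<alpha> s \<bullet> e j)"
proof -
  have "indicator (A k) (\<alpha> s) * (c k * (D y \<alpha> s \<bullet> e k)) = 0" if "k \<in> {1..N} - {j}" for k
    using A_disj[OF j, of k] that a by (auto simp: indicator_def)
  then have "(\<Sum>k\<in>{1..N} - {j}. indicator (A k) (\<alpha> s) * (c k * (D y \<alpha> s \<bullet> e k))) = 0"
    by (intro sum.neutral ballI)
  then have "normal_rate c y \<alpha> s = indicator (A j) (\<alpha> s) * (c j * (D y \<alpha> s \<bullet> e j))"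
    unfolding normal_rate_def sum.remove[OF finite_atLeastAtMost j] by linarith
  then show ?thesis using a by simp
qed

lemma normal_rate_integrable:
  assumes a: "admissible {0..T} x y \<alpha>"
  shows "normal_rate c y \<alpha> absolutely_integrable_on {0..T}"
proof (rule bounded_measurable_absolutely_integrable)
  have s: "{0..T} \<in> sets lebesgue" by simp
  have \<alpha>m: "\<alpha> \<in> borel_measurable (lebesgue_on {0..T})"
    using borel_measurable_continuous_on[OF _ admissibleD(1)[OF a], of snd] by (simp add: continuous_on_snd)
  have Am: "A j \<in> sets borel" if "j \<in> {1..N}" for j
    using compact_imp_closed[OF A_compact[OF that]] by (rule borel_closed)
  show "normal_rate c y \<alpha> \<in> borel_measurable (lebesgue_on {0..T})"
    unfolding normal_rate_def
  proof (intro borel_measurable_sum borel_measurable_times borel_measurable_const)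
    fix j assume j: "j \<in> {1..N}"
    have "indicator (A j) \<in> borel_measurable borel" using Am[OF j] by simp
    from measurable_compose[OF \<alpha>m this]
    show "(\<lambda>s. indicator (A j) (\<alpha> s) :: real) \<in> borel_measurable (lebesgue_on {0..T})" .
    show "(\<lambda>s. D y \<alpha> s \<bullet> e j) \<in> borel_measurable (lebesgue_on {0..T})"
      by (intro borel_measurable_inner admissible_measurable(1)[OF a s] borel_measurable_const)
  qed
  show "AE s in lebesgue_on {0..T}. norm (normal_rate c y \<alpha> s) \<le> (\<Sum>j\<in>{1..N}. \<bar>c j\<bar> * Mf)"
    using admissible_bound(1)[OF a s]
  proof eventually_elim
    case (elim s)
    have "\<bar>indicator (A j) (\<alpha> s) * (c j * (D y \<alpha> s \<bullet> e j))\<bar> \<le> \<bar>c j\<bar> * Mf" if j: "j \<in> {1..N}" for j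
    proof -
      have "\<bar>D y \<alpha> s \<bullet> e j\<bar> \<le> Mf" using Cauchy_Schwarz_ineq2[of "D y \<alpha> s" "e j"] inner_e(4)[OF j] elim by simp
      then have "\<bar>c j\<bar> * \<bar>D y \<alpha> s \<bullet> e j\<bar> \<le> \<bar>c j\<bar> * Mf" by (intro mult_left_mono) auto
      then show ?thesis using Mf by (simp add: indicator_def abs_mult)
    qed
    then show ?case unfolding normal_rate_def real_norm_def
      by (intro order_trans[OF sum_abs sum_mono])
  qed
qed

text \<open>Off \<Gamma> the control must belong to \<open>A j\<close> at almost every time, so the
  rate is \<open>c j\<close> times the normal velocity. The endpoints are left out because the curve
  may be on \<Gamma> there.\<close>

lemma normal_rate_integral_branch:
  assumes y: "admissible {0..T} x y \<alpha>" and ab: "0 \<le> a" "a \<le> b" "b \<le> T"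
    and j: "j \<in> {1..N}" and br: "\<And>s. a < s \<Longrightarrow> s < b \<Longrightarrow> y s \<in> P j - \<Gamma>"
  shows "integral {a..b} (normal_rate c y \<alpha>) = c j * ((y b - y a) \<bullet> e j)"
proof -
  have "AE s in lebesgue. s \<in> {0..T} \<longrightarrow> (y s, \<alpha> s) \<in> M_set N e A" by (rule admissibleD(2)[OF y])
  then obtain X where X: "negligible X" "\<And>s. s \<notin> X \<Longrightarrow> s \<in> {0..T} \<Longrightarrow> (y s, \<alpha> s) \<in> M_set N e A"
    unfolding eventually_ae_filter_negligible by auto
  have X': "negligible (insert a (insert b X))" using X(1) by (simp add: negligible_insert)
  have "integral {a..b} (normal_rate c y \<alpha>) = integral {a..b} (\<lambda>s. c j * (D y \<alpha> s \<bullet> e j))"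
  proof (rule integral_spike[OF X'])
    fix s assume s: "s \<in> {a..b} - insert a (insert b X)"
    then have s': "a < s" "s < b" "s \<notin> X" "s \<in> {0..T}" using ab by auto
    obtain k where k: "k \<in> {1..N}" "y s \<in> P k" "\<alpha> s \<in> A k" using X(2)[OF s'(3,4)] unfolding M_set_iff by auto
    have "k = j" using halfplane_Int[OF j k(1) _ _ k(2)] br[OF s'(1,2)] by auto
    then show "c j * (D y \<alpha> s \<bullet> e j) = normal_rate c y \<alpha> s" using normal_rate_eq[OF j] k(3) by simp
  qed
  also have "\<dots> = c j * (integral {a..b} (D y \<alpha>) \<bullet> e j)"
  proof -
    have "D y \<alpha> integrable_on {a..b}"
      by (rule set_lebesgue_integral_eq_integral(1)[OF admissible_integrable(1)[OF y]]) (use ab in auto)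
    from integral_linear[OF this bounded_linear_inner_left[of "e j"]]
    show ?thesis by (simp add: o_def)
  qed
  also have "integral {a..b} (D y \<alpha>) = y b - y a"
    by (rule admissible_increment(1)[OF y, symmetric]) (use ab in auto)
  finally show ?thesis .
qed

text \<open>On the set of times spent on \<open>\<Gamma>\<close> the normal velocity vanishes almost everywhere, because
  the component of the trajectory normal to \<open>\<Gamma>\<close> vanishes there.\<close>

lemma normal_rate_zero_on_interface:
  assumes y: "admissible {0..T} x y \<alpha>" and x: "x \<in> \<Gamma>"
  shows "negligible {s \<in> {0..T}. y s \<in> \<Gamma> \<and> normal_rate c y \<alpha> s \<noteq> 0}"
proof -
  \<comment> \<open>The component orthogonal to \<open>e 0\<close>, which vanishes exactly on
    \<Gamma>. At the times spent on \<Gamma> the integral of the projected velocity is zero, so that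
    velocity vanishes at almost all of them.\<close>
  define Q where "Q = (\<lambda>w::real^3. w - (w \<bullet> e 0) *\<^sub>R e 0)"
  have bl: "bounded_linear Q" unfolding Q_def
    by (intro bounded_linear_sub bounded_linear_ident bounded_linear_scaleR_left[THEN bounded_linear_compose]
        bounded_linear_inner_left)
  have Q0: "w \<in> \<Gamma> \<longleftrightarrow> Q w = 0" for w unfolding interface_iff Q_def by auto
  have Di: "D y \<alpha> integrable_on {0..t}" if "t \<in> {0..T}" for t
    by (rule set_lebesgue_integral_eq_integral(1)[OF admissible_integrable(1)[OF y]]) (use that in auto)
  have QI: "integral {0..t} (Q \<circ> D y \<alpha>) = Q (y t) - Q x" if t: "t \<in> {0..T}" for t
  proof -
    have "integral {0..t} (Q \<circ> D y \<alpha>) = Q (integral {0..t} (D y \<alpha>))"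
      by (rule integral_linear[OF Di[OF t] bl])
    also have "integral {0..t} (D y \<alpha>) = y t - x" using admissibleD(4)[OF y t] by (simp add: eq_diff_eq add.commute)
    also have "Q (y t - x) = Q (y t) - Q x" using bl by (simp add: bounded_linear.linear linear_diff)
    finally show ?thesis .
  qed
  define Z where "Z = {s \<in> {0..T}. y s \<in> \<Gamma>}"
  have neg: "negligible {s \<in> Z. (Q \<circ> D y \<alpha>) s \<noteq> 0}"
  proof (cases "0 \<le> T")
    case True
    show ?thesis
    proof (rule negligible_nonzero_on_zeros_of_integral)
      show "(Q \<circ> D y \<alpha>) integrable_on {0..T}"
        by (rule integrable_linear[OF Di bl]) (use True in auto)
      show "Z \<subseteq> {0..T}" by (auto simp: Z_def)
      fix t assume "t \<in> Z"
      then show "integral {0..t} (Q \<circ> D y \<alpha>) = 0" using QI[of t] x Q0 by (auto simp: Z_def)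
    qed
  next
    case False then show ?thesis by (simp add: Z_def)
  qed
  have "{s \<in> {0..T}. y s \<in> \<Gamma> \<and> normal_rate c y \<alpha> s \<noteq> 0} \<subseteq> {s \<in> Z. (Q \<circ> D y \<alpha>) s \<noteq> 0}"
  proof
    fix s assume s: "s \<in> {s \<in> {0..T}. y s \<in> \<Gamma> \<and> normal_rate c y \<alpha> s \<noteq> 0}"
    have "Q (D y \<alpha> s) \<noteq> 0"
    proof
      assume "Q (D y \<alpha> s) = 0"
      then have "D y \<alpha> s \<in> \<Gamma>" using Q0 by simp
      then have "D y \<alpha> s \<bullet> e j = 0" if "j \<in> {1..N}" for j using interface_subset_halfplane(2)[OF that] by simp
      then have "normal_rate c y \<alpha> s = 0" unfolding normal_rate_def by (intro sum.neutral) simp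
      then show False using s by simp
    qed
    then show "s \<in> {s \<in> Z. (Q \<circ> D y \<alpha>) s \<noteq> 0}" using s by (auto simp: Z_def)
  qed
  with neg show ?thesis by (rule negligible_subset)
qed

text \<open>The interval is cut at the last visit to \<Gamma>. Before it there are only complete
  excursions and times on \<Gamma>, which contribute nothing; after it the curve stays on the branch
  of \<open>y T\<close>.\<close>

lemma normal_rate_integral:
  assumes y: "admissible {0..T} x y \<alpha>" and x: "x \<in> \<Gamma>" and T: "0 \<le> T"
    and j: "j \<in> {1..N}" "y T \<in> P j"
  shows "integral {0..T} (normal_rate c y \<alpha>) = c j * (y T \<bullet> e j)"
proof -
  let ?k = "normal_rate c y \<alpha>"
  have yc: "continuous_on {0..T} y"
    by (rule lipschitz_on_continuous_on[OF admissible_lipschitz[OF y]]) auto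
  have y0: "y 0 = x" using admissible_0[OF y] T by simp
  have ki: "?k absolutely_integrable_on {0..T}" by (rule normal_rate_integrable[OF y])
  have kint: "?k integrable_on {0..T}" by (rule set_lebesgue_integral_eq_integral(1)[OF ki])
  define Z where "Z = {0..T} \<inter> y -` \<Gamma>"
  have Z: "closed Z" "0 \<in> Z" "bdd_above Z"
    unfolding Z_def using x y0 T
    by (auto intro!: continuous_closed_preimage[OF yc] closed_interface)
  define \<tau> where "\<tau> = Sup Z"
  have \<tau>Z: "\<tau> \<in> Z" unfolding \<tau>_def using closed_contains_Sup[OF _ Z(3,1)] Z(2) by auto
  then have \<tau>: "0 \<le> \<tau>" "\<tau> \<le> T" "y \<tau> \<in> \<Gamma>" by (auto simp: Z_def)
  have after: "y s \<in> S - \<Gamma>" if "\<tau> < s" "s \<le> T" for s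
  proof -
    have "s \<notin> Z" using cSup_upper[OF _ Z(3), of s] that by (auto simp: \<tau>_def)
    then show ?thesis using admissibleD(3)[OF y, of s] that \<tau> by (auto simp: Z_def)
  qed
  have br: "y s \<in> P k - \<Gamma>"
    if C: "connected X" "X \<subseteq> {0..T}" "\<And>s. s \<in> X \<Longrightarrow> y s \<notin> \<Gamma>" and r: "r \<in> X" "k \<in> {1..N}" "y r \<in> P k" and s: "s \<in> X"
    for X r s k
  proof -
    have "connected (y ` X)" by (rule connected_continuous_image[OF continuous_on_subset[OF yc C(2)] C(1)])
    moreover have "y ` X \<subseteq> S - \<Gamma>" using C(2,3) admissibleD(3)[OF y] by blast
    ultimately have "y ` X \<subseteq> P k - \<Gamma>"
      by (rule network_minus_interface_connected) (use r in auto)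
    then show ?thesis using s by blast
  qed
  have tail: "integral {\<tau>..T} ?k = c j * (y T \<bullet> e j)"
  proof -
    have "integral {\<tau>..T} ?k = c j * ((y T - y \<tau>) \<bullet> e j)"
    proof (rule normal_rate_integral_branch[OF y \<tau>(1,2) order_refl j(1)])
      fix s assume s: "\<tau> < s" "s < T"
      show "y s \<in> P j - \<Gamma>"
        by (rule br[of "{\<tau><..T}" T]) (use s j after \<tau> in auto)
    qed
    then show ?thesis using interface_subset_halfplane(2)[OF j(1) \<tau>(3)] by (simp add: inner_diff_left)
  qed
  \<comment> \<open>The times of the complete excursions. Its components are the single excursions,
    which start and end on \<Gamma>.\<close>
  define U where "U = {0<..<\<tau>} \<inter> y -` (- \<Gamma>)"
  have U: "open U" unfolding U_def
    by (rule continuous_open_preimage[OF continuous_on_subset[OF yc]]) (use \<tau> closed_interface in auto)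
  have Usub: "U \<subseteq> {0..\<tau>}" "U \<subseteq> {0..T}" unfolding U_def using \<tau> by auto
  have "(LINT s:U|lebesgue. ?k s) = 0"
  proof (rule set_integral_open_eq_0[OF U])
    show "bounded U" using Usub(1) bounded_closed_interval bounded_subset by blast
    show "?k absolutely_integrable_on U"
      by (rule set_integrable_subset[OF ki]) (use U Usub in auto)
    fix a b :: real assume ab: "a < b" "{a<..<b} \<subseteq> U" "a \<notin> U" "b \<notin> U"
    have "{a<..<b} \<subseteq> {0..\<tau>}" using ab(2) Usub by blast
    then have "closure {a<..<b} \<subseteq> {0..\<tau>}" by (intro closure_minimal) auto
    then have abt: "0 \<le> a" "b \<le> \<tau>" using ab(1) by (auto simp: closure_greaterThanLessThan)
    have yab: "y a \<in> \<Gamma>" "y b \<in> \<Gamma>"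
    proof -
      show "y a \<in> \<Gamma>" using ab abt y0 x by (cases "a = 0") (auto simp: U_def)
      show "y b \<in> \<Gamma>" using ab abt \<tau>(3) by (cases "b = \<tau>") (auto simp: U_def)
    qed
    obtain r where r: "a < r" "r < b" using ab(1) dense by blast
    then have "r \<in> U" using ab(2) by auto
    then have "y r \<in> S" using admissibleD(3)[OF y] Usub by blast
    then obtain k where k: "k \<in> {1..N}" "y r \<in> P k" unfolding network_iff by blast
    have "integral {a..b} ?k = c k * ((y b - y a) \<bullet> e k)"
    proof (rule normal_rate_integral_branch[OF y _ _ _ k(1)])
      fix s assume s: "a < s" "s < b"
      show "y s \<in> P k - \<Gamma>"
        by (rule br[of "{a<..<b}" r]) (use s r k ab(2) Usub in \<open>auto simp: U_def\<close>)
    qed (use ab abt \<tau> in auto)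
    then show "integral {a..b} ?k = 0"
      using interface_subset_halfplane(2)[OF k(1)] yab by (simp add: inner_diff_left)
  qed
  then have "integral U ?k = 0"
    using set_lebesgue_integral_eq_integral(2)[OF set_integrable_subset[OF ki]] U Usub by simp
  \<comment> \<open>Restricting the integral to \<open>U\<close> discards times on \<Gamma>, where
    the rate is zero outside a negligible set.\<close>
  moreover have "integral {0..\<tau>} ?k = integral {0..\<tau>} (\<lambda>s. if s \<in> U then ?k s else 0)"
  proof (rule integral_spike[OF normal_rate_zero_on_interface[OF y x, of c]])
    fix s assume s: "s \<in> {0..\<tau>} - {s \<in> {0..T}. y s \<in> \<Gamma> \<and> ?k s \<noteq> 0}"
    show "(if s \<in> U then ?k s else 0) = ?k s"
    proof (cases "s \<in> U")
      case False
      then have "y s \<in> \<Gamma>" using s y0 x \<tau> unfolding U_def by (cases "s = 0 \<or> s = \<tau>") auto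
      then show ?thesis using s \<tau> False by auto
    qed simp
  qed
  moreover have "integral {0..\<tau>} (\<lambda>s. if s \<in> U then ?k s else 0) = integral U ?k"
    by (simp add: Henstock_Kurzweil_Integration.integral_restrict_Int Int_absorb2[OF Usub(1)])
  ultimately have "integral {0..\<tau>} ?k = 0" by simp
  moreover have "integral {0..\<tau>} ?k + integral {\<tau>..T} ?k = integral {0..T} ?k"
    by (rule Henstock_Kurzweil_Integration.integral_combine[OF \<tau>(1,2) kint])
  ultimately show ?thesis using tail by simp
qed

section \<open>Supersolution property\<close>

lemma modulus_small:
  assumes "\<epsilon> > 0"
  shows "\<exists>t0>0. \<forall>t. 0 < t \<longrightarrow> t < t0 \<longrightarrow> C * t + \<omega> (Mf * t) < \<epsilon>"
proof -
  have "((\<lambda>t. Mf * t) \<longlongrightarrow> Mf * 0) (at_right 0)" by (intro tendsto_intros)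
  moreover have "eventually (\<lambda>t. Mf * t \<in> {0<..} \<and> Mf * t \<noteq> 0) (at_right 0)"
    using eventually_at_right_less[of "0::real"] by eventually_elim (use Mf in auto)
  ultimately have "filterlim (\<lambda>t. Mf * t) (at_right 0) (at_right 0)" by (simp add: filterlim_at)
  moreover have "(\<omega> \<longlongrightarrow> 0) (at_right 0)" using omega by (simp add: modulus_of_continuity_def)
  ultimately have "((\<lambda>t. \<omega> (Mf * t)) \<longlongrightarrow> 0) (at_right 0)" by (rule filterlim_compose[rotated])
  then have "((\<lambda>t. C * t + \<omega> (Mf * t)) \<longlongrightarrow> C * 0 + 0) (at_right 0)" by (intro tendsto_intros)
  then have "eventually (\<lambda>t. C * t + \<omega> (Mf * t) < \<epsilon>) (at_right 0)"
    using assms by (intro order_tendstoD) auto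
  then show ?thesis unfolding eventually_at_right_field by auto
qed

text \<open>Hamiltonians are evaluated at the starting point \<open>x\<close>, velocities and costs
  at the moving state \<open>z\<close>; this bounds the price of the exchange.\<close>

lemma frozen_coefficients:
  assumes i: "i \<in> {1..N}" and x: "x \<in> P i" and z: "z \<in> P i" and a: "a \<in> A i" and d: "norm (z - x) \<le> d"
  shows "p \<bullet> f i x a + l i x a \<le> p \<bullet> f i z a + l i z a + (norm p * L * d + \<omega> d)"
proof -
  have "p \<bullet> f i x a - p \<bullet> f i z a \<le> norm p * norm (f i x a - f i z a)"
    using Cauchy_Schwarz_ineq2[of p "f i x a - f i z a"] by (simp add: inner_diff_right)
  also have "\<dots> \<le> norm p * (L * d)"
  proof (rule mult_left_mono)
    show "norm (f i x a - f i z a) \<le> L * d"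
      by (rule order_trans[OF f_lip[OF i x z a]])
        (use mult_left_mono[OF d, of L] L in \<open>simp add: norm_minus_commute[of x z]\<close>)
  qed simp
  finally have 1: "p \<bullet> f i x a - p \<bullet> f i z a \<le> norm p * L * d" by simp
  have "l i x a - l i z a \<le> \<omega> (norm (x - z))" using l_mod[OF i x z a] by simp
  also have "\<dots> \<le> \<omega> d" using d by (intro modulus_mono) (auto simp: norm_minus_commute)
  finally show ?thesis using 1 by linarith
qed


text \<open>A ball around \<open>x\<close> avoids \<Gamma> and the other half-planes, and before
  time \<open>d / Mf\<close> no trajectory can leave it. Along the trajectory the integrand is then
  bounded below by the Hamiltonian at \<open>x\<close>, up to the modulus of the data.\<close>

lemma supersolution_interior:
  assumes i: "i \<in> {1..N}" and x: "x \<in> P i - \<Gamma>" and \<epsilon>: "\<epsilon> > 0"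
  shows "\<exists>t0>0. \<forall>y \<alpha> t. admissible {0..} x y \<alpha> \<longrightarrow> 0 < t \<longrightarrow> t < t0 \<longrightarrow>
      x \<in> P i \<and> y t \<in> P i \<and> p \<bullet> (y t - x) + integral {0..t} (R y \<alpha>) \<ge> - (Ham A f l i x p + \<epsilon>) * t"
proof -
  define U where "U = (\<Union>k\<in>{1..N} - {i}. P k)"
  have "closed U" unfolding U_def by (intro closed_UN closed_halfplane ballI) auto
  moreover have "x \<notin> U" using halfplane_Int[OF i] x unfolding U_def by blast
  ultimately have "open (- (U \<union> \<Gamma>))" "x \<in> - (U \<union> \<Gamma>)" using closed_interface x by auto
  then obtain d where d: "d > 0" "ball x d \<subseteq> - (U \<union> \<Gamma>)" by (meson openE)
  obtain t1 where t1: "t1 > 0" "\<And>t. 0 < t \<Longrightarrow> t < t1 \<Longrightarrow> norm p * L * Mf * t + \<omega> (Mf * t) < \<epsilon>"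
    using modulus_small[OF \<epsilon>, of "norm p * L * Mf"] by blast
  show ?thesis
  proof (intro exI[of _ "min t1 (d / Mf)"] conjI allI impI)
    show "min t1 (d / Mf) > 0" using t1 d Mf by simp
    show "x \<in> P i" using x by simp
    fix y \<alpha> t assume y: "admissible {0..} x y \<alpha>" and t: "0 < t" "t < min t1 (d / Mf)"
    have near: "norm (y s - x) \<le> Mf * t" and yP: "y s \<in> P i - \<Gamma>" if s: "s \<in> {0..t}" for s
    proof -
      have "norm (y s - x) \<le> Mf * s"
        using admissible_increment(2)[OF y, of s 0] admissible_0[OF y] s by auto
      also have "\<dots> \<le> Mf * t" using s Mf by simp
      finally show n: "norm (y s - x) \<le> Mf * t" .
      have "Mf * t < d" using t Mf by (simp add: field_simps)
      then have "y s \<in> ball x d" using n by (simp add: dist_norm norm_minus_commute)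
      moreover have "y s \<in> S" using admissibleD(3)[OF y, of s] s by simp
      ultimately show "y s \<in> P i - \<Gamma>" using d(2) unfolding U_def network_def by blast
    qed
    show "y t \<in> P i" using yP[of t] t by simp
    have Di: "D y \<alpha> absolutely_integrable_on {0..t}" and Ri: "R y \<alpha> absolutely_integrable_on {0..t}"
      using admissible_integrable[OF y, of 0 t] by auto
    have pDi: "(\<lambda>s. p \<bullet> D y \<alpha> s) absolutely_integrable_on {0..t}"
      using absolutely_integrable_linear[OF Di bounded_linear_inner_right[of p]] by (simp add: o_def)
    have "- (Ham A f l i x p + \<epsilon>) * (t - 0) \<le> integral {0..t} (\<lambda>s. p \<bullet> D y \<alpha> s + R y \<alpha> s)"
    proof (rule AE_integral_ge)
      show "(\<lambda>s. p \<bullet> D y \<alpha> s + R y \<alpha> s) absolutely_integrable_on {0..t}"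
        by (rule set_integral_add(1)[OF pDi Ri])
      show "AE s in lebesgue. s \<in> {0..t} \<longrightarrow> - (Ham A f l i x p + \<epsilon>) \<le> p \<bullet> D y \<alpha> s + R y \<alpha> s"
        using admissibleD(2)[OF y]
      proof eventually_elim
        case (elim s)
        show ?case
        proof
          assume s: "s \<in> {0..t}"
          then have "(y s, \<alpha> s) \<in> M_set N e A" using elim by simp
          then obtain k where k: "k \<in> {1..N}" "y s \<in> P k" "\<alpha> s \<in> A k" unfolding M_set_iff by auto
          have "k = i" using halfplane_Int[OF i k(1) _ _ k(2)] yP[OF s] by auto
          then have a: "\<alpha> s \<in> A i" using k by simp
          have ys: "y s \<in> P i" using yP[OF s] by simp
          have "p \<bullet> f i x (\<alpha> s) + l i x (\<alpha> s)
              \<le> p \<bullet> f i (y s) (\<alpha> s) + l i (y s) (\<alpha> s) + (norm p * L * (Mf * t) + \<omega> (Mf * t))"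
            by (rule frozen_coefficients[OF i _ ys a near[OF s]]) (use x in simp)
          moreover have "- (p \<bullet> f i x (\<alpha> s)) - l i x (\<alpha> s) \<le> Ham A f l i x p"
            by (rule Ham_upper[OF i _ a]) (use x in simp)
          moreover have "norm p * L * (Mf * t) + \<omega> (Mf * t) < \<epsilon>" using t1(2)[of t] t by (simp add: mult.assoc)
          ultimately show "- (Ham A f l i x p + \<epsilon>) \<le> p \<bullet> D y \<alpha> s + R y \<alpha> s"
            unfolding dynamics_eq[OF i ys a] running_cost_eq[OF i ys a] by linarith
        qed
      qed
    qed (use t in simp)
    also have "\<dots> = integral {0..t} (\<lambda>s. p \<bullet> D y \<alpha> s) + integral {0..t} (R y \<alpha>)"
      by (rule Henstock_Kurzweil_Integration.integral_add)
        (use set_lebesgue_integral_eq_integral(1)[OF pDi] set_lebesgue_integral_eq_integral(1)[OF Ri] in auto)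
    also have "integral {0..t} (\<lambda>s. p \<bullet> D y \<alpha> s) = p \<bullet> (y t - x)"
      using integral_linear[OF set_lebesgue_integral_eq_integral(1)[OF Di] bounded_linear_inner_right[of p]]
        admissible_increment(1)[OF y, of t 0] admissible_0[OF y] t by (simp add: o_def)
    finally show "p \<bullet> (y t - x) + integral {0..t} (R y \<alpha>) \<ge> - (Ham A f l i x p + \<epsilon>) * t" by simp
  qed
qed

text \<open>After the gradients are corrected by the multipliers, the lower bound holds for every
  control of every branch, hence at almost every time wherever the trajectory is. Only then is the
  correction integrated along the trajectory.\<close>

lemma supersolution_interface:
  assumes x: "x \<in> \<Gamma>" and \<epsilon>: "\<epsilon> > 0"
    and tang: "\<And>i j. i \<in> {1..N} \<Longrightarrow> j \<in> {1..N} \<Longrightarrow> p i \<bullet> e 0 = p j \<bullet> e 0"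
  shows "\<exists>t0>0. \<forall>y \<alpha> t. admissible {0..} x y \<alpha> \<longrightarrow> 0 < t \<longrightarrow> t < t0 \<longrightarrow>
      (\<exists>i\<in>{1..N}. x \<in> P i \<and> y t \<in> P i \<and>
        p i \<bullet> (y t - x) + integral {0..t} (R y \<alpha>) \<ge> - (Ham_interface N e A f l x p + \<epsilon>) * t)"
proof -
  define H where "H = Ham_interface N e A f l x p"
  have H: "Ham_plus e A f l i x (p i) \<le> H" if "i \<in> {1..N}" for i
    unfolding H_def Ham_interface_def using that by (intro Max_ge) auto
  have "\<forall>i\<in>{1..N}. \<exists>\<mu>\<ge>0. \<forall>a\<in>A i. - (p i \<bullet> f i x a) - l i x a + \<mu> * (f i x a \<bullet> e i) \<le> Ham_plus e A f l i x (p i)"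
    using Ham_plus_multiplier[OF _ x] by metis
  from bchoice[OF this] obtain \<mu> where \<mu>: "\<And>i. i \<in> {1..N} \<Longrightarrow> \<mu> i \<ge> 0"
    "\<And>i a. i \<in> {1..N} \<Longrightarrow> a \<in> A i \<Longrightarrow>
      - (p i \<bullet> f i x a) - l i x a + \<mu> i * (f i x a \<bullet> e i) \<le> Ham_plus e A f l i x (p i)" by blast
  have one: "1 \<in> {1..N}" using N_gt_1 by simp
  define q where "q = p 1 \<bullet> e 0"
  have q: "p i \<bullet> e 0 = q" if "i \<in> {1..N}" for i unfolding q_def using tang[OF that one] .
  \<comment> \<open>\<open>p'\<close> carries the full corrected gradient, used for the pointwise
    bound; \<open>c\<close> is its normal coordinate, used for the integrated one.\<close>
  define p' where "p' = (\<lambda>i. p i - \<mu> i *\<^sub>R e i)"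
  define c where "c = (\<lambda>i. p i \<bullet> e i - \<mu> i)"
  define C where "C = (\<Sum>i\<in>{1..N}. norm (p' i)) * L * Mf"
  obtain t0 where t0: "t0 > 0" "\<And>t. 0 < t \<Longrightarrow> t < t0 \<Longrightarrow> C * t + \<omega> (Mf * t) < \<epsilon>"
    using modulus_small[OF \<epsilon>, of C] by blast
  have "\<exists>i\<in>{1..N}. x \<in> P i \<and> y t \<in> P i \<and> p i \<bullet> (y t - x) + integral {0..t} (R y \<alpha>) \<ge> - (H + \<epsilon>) * t"
    if y: "admissible {0..} x y \<alpha>" and t: "0 < t" "t < t0" for y \<alpha> t
  proof -
    have a: "admissible {0..t} x y \<alpha>" by (rule admissible_mono[OF y]) auto
    have "y t \<in> S" using admissibleD(3)[OF y, of t] t by simp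
    then obtain i where i: "i \<in> {1..N}" "y t \<in> P i" unfolding network_iff by blast
    have xP: "x \<in> P j" if "j \<in> {1..N}" for j using interface_subset_halfplane(1)[OF that x] .
    have Di: "D y \<alpha> absolutely_integrable_on {0..t}" and Ri: "R y \<alpha> absolutely_integrable_on {0..t}"
      using admissible_integrable[OF a order_refl] by auto
    have ki: "normal_rate c y \<alpha> absolutely_integrable_on {0..t}" by (rule normal_rate_integrable[OF a])
    have qDi: "(\<lambda>s. (q *\<^sub>R e 0) \<bullet> D y \<alpha> s) absolutely_integrable_on {0..t}"
      using absolutely_integrable_linear[OF Di bounded_linear_inner_right[of "q *\<^sub>R e 0"]] by (simp add: o_def)
    have qki: "(\<lambda>s. (q *\<^sub>R e 0) \<bullet> D y \<alpha> s + normal_rate c y \<alpha> s) absolutely_integrable_on {0..t}"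
      by (rule set_integral_add(1)[OF qDi ki])
    have near: "norm (y s - x) \<le> Mf * t" if s: "s \<in> {0..t}" for s
    proof -
      have "norm (y s - x) \<le> Mf * s"
        using admissible_increment(2)[OF y, of s 0] admissible_0[OF y] s by auto
      also have "\<dots> \<le> Mf * t" using s Mf by simp
      finally show ?thesis .
    qed
    have "- (H + \<epsilon>) * (t - 0)
        \<le> integral {0..t} (\<lambda>s. (q *\<^sub>R e 0) \<bullet> D y \<alpha> s + normal_rate c y \<alpha> s + R y \<alpha> s)"
    proof (rule AE_integral_ge)
      show "(\<lambda>s. (q *\<^sub>R e 0) \<bullet> D y \<alpha> s + normal_rate c y \<alpha> s + R y \<alpha> s) absolutely_integrable_on {0..t}"
        by (rule set_integral_add(1)[OF qki Ri])
      show "AE s in lebesgue. s \<in> {0..t} \<longrightarrow>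
          - (H + \<epsilon>) \<le> (q *\<^sub>R e 0) \<bullet> D y \<alpha> s + normal_rate c y \<alpha> s + R y \<alpha> s"
        using admissibleD(2)[OF a]
      proof eventually_elim
        case (elim s)
        show ?case
        proof
          assume s: "s \<in> {0..t}"
          then have "(y s, \<alpha> s) \<in> M_set N e A" using elim by simp
          then obtain k where k: "k \<in> {1..N}" "y s \<in> P k" "\<alpha> s \<in> A k" unfolding M_set_iff by auto
          \<comment> \<open>The common tangential coordinate \<open>q\<close> is what makes this
            splitting valid on all branches with one and the same first term, which can be
            integrated without knowing the branch.\<close>
          have pD: "(q *\<^sub>R e 0) \<bullet> D y \<alpha> s + normal_rate c y \<alpha> s = p' k \<bullet> D y \<alpha> s"
          proof -
            have "D y \<alpha> s \<in> plane e k" unfolding dynamics_eq[OF k] by (rule f_plane[OF k])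
            then have "D y \<alpha> s = (D y \<alpha> s \<bullet> e 0) *\<^sub>R e 0 + (D y \<alpha> s \<bullet> e k) *\<^sub>R e k" using plane_iff[OF k(1)] by blast
            then have "p k \<bullet> D y \<alpha> s
                = p k \<bullet> ((D y \<alpha> s \<bullet> e 0) *\<^sub>R e 0 + (D y \<alpha> s \<bullet> e k) *\<^sub>R e k)"
              by (rule arg_cong)
            also have "\<dots> = (D y \<alpha> s \<bullet> e 0) * (p k \<bullet> e 0) + (D y \<alpha> s \<bullet> e k) * (p k \<bullet> e k)"
              by (simp add: inner_add_right)
            finally have pk: "p k \<bullet> D y \<alpha> s
                = (D y \<alpha> s \<bullet> e 0) * q + (D y \<alpha> s \<bullet> e k) * (p k \<bullet> e k)"
              unfolding q[OF k(1)] .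
            have "p' k \<bullet> D y \<alpha> s = p k \<bullet> D y \<alpha> s - \<mu> k * (D y \<alpha> s \<bullet> e k)"
              by (simp add: p'_def inner_diff_left inner_commute)
            then show ?thesis unfolding normal_rate_eq[where \<alpha> = \<alpha> and s = s, OF k(1,3)] pk c_def
              by (simp add: inner_commute[of "e 0"] algebra_simps)
          qed
          have "p' k \<bullet> f k x (\<alpha> s) + l k x (\<alpha> s)
              \<le> p' k \<bullet> f k (y s) (\<alpha> s) + l k (y s) (\<alpha> s) + (norm (p' k) * L * (Mf * t) + \<omega> (Mf * t))"
            by (rule frozen_coefficients[OF k(1) xP[OF k(1)] k(2,3) near[OF s]])
          moreover have "- (p' k \<bullet> f k x (\<alpha> s)) - l k x (\<alpha> s) \<le> H"
          proof -
            have "p' k \<bullet> f k x (\<alpha> s) = p k \<bullet> f k x (\<alpha> s) - \<mu> k * (f k x (\<alpha> s) \<bullet> e k)"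
              by (simp add: p'_def inner_diff_left inner_commute[of "e k"])
            then show ?thesis using \<mu>(2)[OF k(1,3)] H[OF k(1)] by linarith
          qed
          moreover have "norm (p' k) * L * (Mf * t) \<le> C * t"
          proof -
            have "norm (p' k) \<le> (\<Sum>i\<in>{1..N}. norm (p' i))" using k(1) by (intro member_le_sum) auto
            then have "norm (p' k) * (L * (Mf * t)) \<le> (\<Sum>i\<in>{1..N}. norm (p' i)) * (L * (Mf * t))"
              using L Mf t by (intro mult_right_mono) auto
            then show ?thesis by (simp add: C_def mult.assoc)
          qed
          moreover have "C * t + \<omega> (Mf * t) < \<epsilon>" by (rule t0(2)[OF t])
          ultimately show "- (H + \<epsilon>) \<le> (q *\<^sub>R e 0) \<bullet> D y \<alpha> s + normal_rate c y \<alpha> s + R y \<alpha> s"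
            unfolding pD unfolding dynamics_eq[OF k] running_cost_eq[OF k] by linarith
        qed
      qed
    qed (use t in simp)
    also have "\<dots> = integral {0..t} (\<lambda>s. (q *\<^sub>R e 0) \<bullet> D y \<alpha> s + normal_rate c y \<alpha> s) + integral {0..t} (R y \<alpha>)"
      by (rule Henstock_Kurzweil_Integration.integral_add)
        (use set_lebesgue_integral_eq_integral(1)[OF qki] set_lebesgue_integral_eq_integral(1)[OF Ri] in auto)
    also have "integral {0..t} (\<lambda>s. (q *\<^sub>R e 0) \<bullet> D y \<alpha> s + normal_rate c y \<alpha> s)
        = integral {0..t} (\<lambda>s. (q *\<^sub>R e 0) \<bullet> D y \<alpha> s) + integral {0..t} (normal_rate c y \<alpha>)"
      by (rule Henstock_Kurzweil_Integration.integral_add)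
        (use set_lebesgue_integral_eq_integral(1)[OF qDi] set_lebesgue_integral_eq_integral(1)[OF ki] in auto)
    also have "integral {0..t} (\<lambda>s. (q *\<^sub>R e 0) \<bullet> D y \<alpha> s) = (q *\<^sub>R e 0) \<bullet> (y t - x)"
      using integral_linear[OF set_lebesgue_integral_eq_integral(1)[OF Di] bounded_linear_inner_right[of "q *\<^sub>R e 0"]]
        admissible_increment(1)[OF y, of t 0] admissible_0[OF y] t by (simp add: o_def)
    also have "integral {0..t} (normal_rate c y \<alpha>) = c i * (y t \<bullet> e i)"
      by (rule normal_rate_integral[OF a x _ i]) (use t in simp)
    finally have 1: "- (H + \<epsilon>) * t \<le> (q *\<^sub>R e 0) \<bullet> (y t - x) + c i * (y t \<bullet> e i) + integral {0..t} (R y \<alpha>)" by simp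
    have "p i \<bullet> (y t - x) = (q *\<^sub>R e 0) \<bullet> (y t - x) + (p i \<bullet> e i) * (y t \<bullet> e i)"
    proof -
      define w where "w = y t - x"
      have "y t \<in> plane e i" "x \<in> plane e i" using i(2) xP[OF i(1)] halfplane_iff_plane[OF i(1)] by blast+
      then have "w \<in> plane e i" unfolding w_def by (rule subspace_diff[OF subspace_plane])
      then have "w = (w \<bullet> e 0) *\<^sub>R e 0 + (w \<bullet> e i) *\<^sub>R e i" using plane_iff[OF i(1)] by blast
      then have "p i \<bullet> w = p i \<bullet> ((w \<bullet> e 0) *\<^sub>R e 0 + (w \<bullet> e i) *\<^sub>R e i)"
        by (rule arg_cong)
      also have "\<dots> = (w \<bullet> e 0) * q + (w \<bullet> e i) * (p i \<bullet> e i)"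
        by (simp add: inner_add_right q[OF i(1)])
      finally have "p i \<bullet> w = (w \<bullet> e 0) * q + (w \<bullet> e i) * (p i \<bullet> e i)" .
      moreover have "w \<bullet> e i = y t \<bullet> e i" using interface_subset_halfplane(2)[OF i(1) x] by (simp add: w_def inner_diff_left)
      ultimately show ?thesis unfolding w_def[symmetric] by (simp add: inner_commute[of "e 0"] mult.commute)
    qed
    \<comment> \<open>The multiplier enters as \<open>- \<mu> i\<close> times the distance of
      \<open>y t\<close> from \<Gamma>, so dropping it only increases the right-hand side.\<close>
    moreover have "c i * (y t \<bullet> e i) \<le> (p i \<bullet> e i) * (y t \<bullet> e i)"
      using i(2) \<mu>(1)[OF i(1)] halfplane_iff_plane[OF i(1)] by (intro mult_right_mono) (auto simp: c_def)
    ultimately have "p i \<bullet> (y t - x) + integral {0..t} (R y \<alpha>) \<ge> - (H + \<epsilon>) * t" using 1 by linarith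
    then show ?thesis using i xP by blast
  qed
  then show ?thesis using t0(1) unfolding H_def by blast
qed

lemma value_supersolution: "viscosity_supersolution N e A f l lam v"
  unfolding viscosity_supersolution_def
proof (intro conjI ballI impI)
  show "lsc_on S v" unfolding lsc_on_def
    using v_continuous by (auto simp: continuous_on_def intro: order_tendstoD)
next
  fix x \<phi> i
  assume xS: "x \<in> S" and \<phi>: "\<phi> \<in> test_functions N e" and mn: "local_min_on S (\<lambda>z. v z - \<phi> z) x"
    and i: "i \<in> {1..N}" and x: "x \<in> P i - \<Gamma>"
  show "0 \<le> lam * v x + Ham A f l i x (gradient e i \<phi> x)"
  proof (rule supersolution_inequality[OF xS mn, of "\<lambda>j. gradient e j \<phi> x"])
    fix j assume "j \<in> {1..N}" "x \<in> P j"
    then show "has_plane_gradient e j \<phi> x (gradient e j \<phi> x)"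
      using \<phi> by (intro has_plane_gradient_gradient) (auto simp: test_functions_def)
  next
    fix \<epsilon> :: real assume "\<epsilon> > 0"
    from supersolution_interior[OF i x this, of "gradient e i \<phi> x"] i
    show "\<exists>t0>0. \<forall>y \<alpha> t. admissible {0..} x y \<alpha> \<longrightarrow> 0 < t \<longrightarrow> t < t0 \<longrightarrow>
      (\<exists>j\<in>{1..N}. x \<in> P j \<and> y t \<in> P j \<and> gradient e j \<phi> x \<bullet> (y t - x) + integral {0..t} (R y \<alpha>)
        \<ge> - (Ham A f l i x (gradient e i \<phi> x) + \<epsilon>) * t)" by blast
  qed
next
  fix x \<phi>
  assume xS: "x \<in> S" and \<phi>: "\<phi> \<in> test_functions N e" and mn: "local_min_on S (\<lambda>z. v z - \<phi> z) x"
    and x: "x \<in> \<Gamma>"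
  show "0 \<le> lam * v x + Ham_interface N e A f l x (\<lambda>i. gradient e i \<phi> x)"
  proof (rule supersolution_inequality[OF xS mn, of "\<lambda>j. gradient e j \<phi> x"])
    fix j assume "j \<in> {1..N}" "x \<in> P j"
    then show "has_plane_gradient e j \<phi> x (gradient e j \<phi> x)"
      using \<phi> by (intro has_plane_gradient_gradient) (auto simp: test_functions_def)
  qed (rule supersolution_interface[OF x _ gradient_tangential_eq[OF _ _ \<phi> x]])
qed

lemma value_viscosity_solution: "viscosity_solution N e A f l lam v"
  unfolding viscosity_solution_def using v_continuous value_subsolution value_supersolution by simp

end

theorem theorem2p3:
  fixes N :: nat
    and e :: "nat \<Rightarrow> real ^ 3"
    and A :: "nat \<Rightarrow> 'a::metric_space set"
    and f :: "nat \<Rightarrow> real ^ 3 \<Rightarrow> 'a \<Rightarrow> real ^ 3"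
    and l :: "nat \<Rightarrow> real ^ 3 \<Rightarrow> 'a \<Rightarrow> real"
    and lam :: real
  assumes "junction N e"
    and "lam > 0"
    and "H0 N e A f"
    and "H1 N e A l"
    and "H2 N e A f l"
    and "H3 N e A f"
  shows "\<exists>v :: real ^ 3 \<Rightarrow> real.
           (\<forall>x\<in>network N e. value_function N e A f l lam x = ereal (v x)) \<and>
           bounded (v ` network N e) \<and>
           viscosity_solution N e A f l lam v"
proof -
  \<comment> \<open>A finite union of bounded sets gives one bound for all branches, positive as the
    locale demands; likewise for the costs.\<close>
  have "bounded (\<Union>i\<in>{1..N}. (\<lambda>(x, a). f i x a) ` (halfplane e i \<times> A i))"
    using assms(3) unfolding H0_def by (intro bounded_UN) auto
  then obtain Mf where Mf: "Mf > 0"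
    "\<And>w. w \<in> (\<Union>i\<in>{1..N}. (\<lambda>(x, a). f i x a) ` (halfplane e i \<times> A i)) \<Longrightarrow> norm w \<le> Mf"
    unfolding bounded_pos by blast
  have "bounded (\<Union>i\<in>{1..N}. (\<lambda>(x, a). l i x a) ` (halfplane e i \<times> A i))"
    using assms(4) unfolding H1_def by (intro bounded_UN) auto
  then obtain Ml where Ml: "Ml > 0"
    "\<And>w. w \<in> (\<Union>i\<in>{1..N}. (\<lambda>(x, a). l i x a) ` (halfplane e i \<times> A i)) \<Longrightarrow> norm w \<le> Ml"
    unfolding bounded_pos by blast
  obtain L where L: "L > 0" "\<forall>i\<in>{1..N}. \<forall>x\<in>halfplane e i. \<forall>y\<in>halfplane e i. \<forall>a\<in>A i.
      norm (f i x a - f i y a) \<le> L * norm (x - y)"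
    using assms(3) unfolding H0_def by blast
  obtain \<omega> where \<omega>: "modulus_of_continuity \<omega>" "\<forall>i\<in>{1..N}. \<forall>x\<in>halfplane e i. \<forall>y\<in>halfplane e i. \<forall>a\<in>A i.
      \<bar>l i x a - l i y a\<bar> \<le> \<omega> (norm (x - y))"
    using assms(4) unfolding H1_def by blast
  obtain \<delta> where \<delta>: "\<delta> > 0" "\<forall>i\<in>{1..N}. \<forall>x\<in>interface e. ball 0 \<delta> \<inter> plane e i \<subseteq> f i x ` A i"
    using assms(6) unfolding H3_def by blast
  interpret junction_control N e A f l lam Mf L Ml \<delta> \<omega>
  proof
    fix i x a assume "i \<in> {1..N}" "x \<in> halfplane e i" "a \<in> A i"
    then show "norm (f i x a) \<le> Mf" "\<bar>l i x a\<bar> \<le> Ml"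
      using Mf(2)[of "f i x a"] Ml(2)[of "l i x a"] by force+
  qed (use assms Mf(1) Ml(1) L \<omega> \<delta> in \<open>auto simp: H0_def H1_def H2_def\<close>)
  have "bounded (v ` network N e)"
    using v_bound by (auto simp: bounded_iff)
  then show ?thesis using value_function_eq value_viscosity_solution by blast
qed

end
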